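(* Let $\bar M$ be a nearly cosymplectic manifold with structure $(\phi,\xi,\eta,g)$, and let $M=N_T\times_f N_\theta$ be a warped product semi-slant submanifold of $\bar M$, where $N_T$ is an invariant submanifold and $N_\theta$ is a proper slant submanifold of $\bar M$ with slant angle $\theta$, and where $\xi$ is tangent to $N_T$. Let $2q=\dim N_\theta$ and let $h$ be the second fundamental form of $M$ in $\bar M$. Then: (i) the squared norm of $h$ satisfies $$\|h\|^2\ \geq\ 4q\,\csc^2\theta\,\Big\{1+\tfrac19\cos^2\theta\Big\}\,\|\nabla\ln f\|^2 ,$$ where $\nabla\ln f$ is the gradient of $\ln f$; (ii) if equality holds in this inequality (identically on $M$), then $N_T$ is totally geodesic in $\bar M$ and $N_\theta$ is a totally umbilical submanifold of $\bar M$. Moreover, $M$ is then a minimal submanifold of $\bar M$.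
   Context: An almost contact metric manifold $(\bar M^{2n+1},\phi,\xi,\eta,g)$ is a Riemannian manifold with a $(1,1)$-tensor $\phi$, a vector field $\xi$ and a 1-form $\eta$ such that $\phi^2=-I+\eta\otimes\xi$, $\phi\xi=0$, $\eta\circ\phi=0$, $\eta(\xi)=1$, $\eta(X)=g(X,\xi)$ and $g(\phi X,\phi Y)=g(X,Y)-\eta(X)\eta(Y)$. It is nearly cosymplectic if $(\bar\nabla_X\phi)Y+(\bar\nabla_Y\phi)X=0$ for all $X,Y$, where $\bar\nabla$ is the Levi-Civita connection and $(\bar\nabla_X\phi)Y=\bar\nabla_X(\phi Y)-\phi\bar\nabla_XY$. A submanifold $N$ is invariant if $\phi X$ is tangent to $N$ for all $X$ tangent to $N$, and anti-invariant if $\phi X$ is normal to $N$ for all such $X$. It is slant with slant angle $\theta\in[0,\pi/2]$ if the angle between $\phi X$ and $T_xN$ equals the constant $\theta$ for all $x\in N$ and all nonzero $X\in T_xN$ not proportional to $\xi_x$. A slant submanifold is proper slant if it is neither invariant nor anti-invariant (so $0<\theta<\pi/2$). The warped product $N_1\times_fN_2$ of Riemannian manifolds $(N_1,g_1)$, $(N_2,g_2)$ with warping function $f>0$, a smooth function on $N_1$, is $N_1\times N_2$ with metric $g=g_1+f^2g_2$. A warped product semi-slant submanifold $M=N_T\times_fN_\theta$ of $\bar M$ is a submanifold of $\bar M$ whose induced metric is such a warped product metric, with (the copies of) $N_T$ invariant and (the copies of) $N_\theta$ proper slant in $\bar M$. Here $\xi$ is tangent to $N_T$, hence orthogonal to $N_\theta$.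 The second fundamental form $h$ is defined by $\bar\nabla_XY=\nabla_XY+h(X,Y)$ for $X,Y$ tangent to $M$, where $\nabla$ is the induced connection and $h(X,Y)$ is normal. $\|h\|^2=\sum_{i,j=1}^m g(h(e_i,e_j),h(e_i,e_j))$ for a local orthonormal frame $e_1,\dots,e_m$ of $TM$. $M$ is minimal if the trace of $h$ vanishes. *)

theory Defs
  imports "HOL-Analysis.Analysis"
begin

section \<open>Smooth functions on open subsets of Euclidean spaces\<close>

fun Ck_on :: "nat \<Rightarrow> ('a::real_normed_vector \<Rightarrow> 'b::real_normed_vector) \<Rightarrow> 'a set \<Rightarrow> bool" where
  "Ck_on 0 f S \<longleftrightarrow> continuous_on S f"
| "Ck_on (Suc k) f S \<longleftrightarrow> (\<forall>x\<in>S. f differentiable (at x)) \<and>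
     (\<forall>v. Ck_on k (\<lambda>x. frechet_derivative f (at x) v) S)"

definition smooth_on :: "('a::real_normed_vector \<Rightarrow> 'b::real_normed_vector) \<Rightarrow> 'a set \<Rightarrow> bool" where
  "smooth_on f S \<longleftrightarrow> (\<forall>k. Ck_on k f S)"


section \<open>Manifolds\<close>

text \<open>
  A manifold structure on a (Hausdorff, second countable) type is a family of pairwise smoothly
  compatible charts, one chosen around each point; the atlas is the range of the family.
  The chart chosen at \<open>p\<close> identifies the tangent space at \<open>p\<close> with the model space \<open>'e\<close>:
  a tangent vector at \<open>p\<close> is represented by its coordinates in the chart chosen at \<open>p\<close>.
  Hence a vector field is a function \<open>'m \<Rightarrow> 'e\<close>, a metric a function \<open>'m \<Rightarrow> 'e \<Rightarrow> 'e \<Rightarrow> real\<close>, etc.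
  As the chosen chart varies with the point, smoothness and derivatives of such fields are
  always taken after passing to a fixed chart.
\<close>

type_synonym ('m, 'e) charts = "'m \<Rightarrow> 'm set \<times> ('m \<Rightarrow> 'e)"

definition cdom :: "('m, 'e) charts \<Rightarrow> 'm \<Rightarrow> 'm set" where
  "cdom C p = fst (C p)"

definition crd :: "('m, 'e) charts \<Rightarrow> 'm \<Rightarrow> 'm \<Rightarrow> 'e" where
  "crd C p = snd (C p)"

definition cinv :: "('m, 'e) charts \<Rightarrow> 'm \<Rightarrow> 'e \<Rightarrow> 'm" where
  "cinv C p = inv_into (cdom C p) (crd C p)"

definition manifold ::
  "('m::{t2_space, second_countable_topology}, 'e::euclidean_space) charts \<Rightarrow> bool" where
  "manifold C \<longleftrightarrow>
     (\<forall>p. p \<in> cdom C p \<and> open (cdom C p) \<and> open (crd C p ` cdom C p) \<and>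
          homeomorphism (cdom C p) (crd C p ` cdom C p) (crd C p) (cinv C p)) \<and>
     (\<forall>p q. smooth_on (crd C q \<circ> cinv C p) (crd C p ` (cdom C p \<inter> cdom C q)))"

definition prod_charts :: "('a, 'd) charts \<Rightarrow> ('b, 'f) charts \<Rightarrow> ('a \<times> 'b, 'd \<times> 'f) charts" where
  "prod_charts C1 C2 = (\<lambda>(x, y). (cdom C1 x \<times> cdom C2 y, map_prod (crd C1 x) (crd C2 y)))"

text \<open>\<open>coord_change C p q a v\<close>: coordinates in the chart at \<open>q\<close> of the tangent vector at \<open>a\<close>
  whose coordinates in the chart at \<open>p\<close> are \<open>v\<close>.\<close>

definition coord_change ::
  "('m, 'e::euclidean_space) charts \<Rightarrow> 'm \<Rightarrow> 'm \<Rightarrow> 'm \<Rightarrow> 'e \<Rightarrow> 'e" where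
  "coord_change C p q a v = frechet_derivative (crd C q \<circ> cinv C p) (at (crd C p a)) v"

definition to_chart :: "('m, 'e::euclidean_space) charts \<Rightarrow> 'm \<Rightarrow> 'm \<Rightarrow> 'e \<Rightarrow> 'e" where
  "to_chart C p a v = coord_change C a p a v"

text \<open>\<open>coord_field C p u\<close> is the vector field on the domain of the chart at \<open>p\<close> with constant
  coordinates \<open>u\<close> in that chart.\<close>

definition coord_field :: "('m, 'e::euclidean_space) charts \<Rightarrow> 'm \<Rightarrow> 'e \<Rightarrow> 'm \<Rightarrow> 'e" where
  "coord_field C p u a = coord_change C p a a u"

definition smooth_fun :: "('m, 'e::euclidean_space) charts \<Rightarrow> ('m \<Rightarrow> real) \<Rightarrow> bool" where
  "smooth_fun C f \<longleftrightarrow> (\<forall>p. smooth_on (f \<circ> cinv C p) (crd C p ` cdom C p))"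

definition smooth_map ::
  "('n::topological_space, 'd::euclidean_space) charts \<Rightarrow>
   ('m::topological_space, 'e::euclidean_space) charts \<Rightarrow> ('n \<Rightarrow> 'm) \<Rightarrow> bool" where
  "smooth_map D C F \<longleftrightarrow> continuous_on UNIV F \<and>
     (\<forall>p q. smooth_on (crd C q \<circ> F \<circ> cinv D p) (crd D p ` (cdom D p \<inter> F -` cdom C q)))"

definition differential ::
  "('n, 'd::euclidean_space) charts \<Rightarrow> ('m, 'e::euclidean_space) charts \<Rightarrow> ('n \<Rightarrow> 'm) \<Rightarrow> 'n \<Rightarrow> 'd \<Rightarrow> 'e"
where
  "differential D C F p =
     frechet_derivative (crd C (F p) \<circ> F \<circ> cinv D p) (at (crd D p p))"

definition smooth_vector_field_on ::
  "('m, 'e::euclidean_space) charts \<Rightarrow> 'm set \<Rightarrow> ('m \<Rightarrow> 'e) \<Rightarrow> bool" where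
  "smooth_vector_field_on C U X \<longleftrightarrow>
     (\<forall>p. smooth_on (\<lambda>x. let a = cinv C p x in to_chart C p a (X a)) (crd C p ` (cdom C p \<inter> U)))"

definition smooth_one_form ::
  "('m, 'e::euclidean_space) charts \<Rightarrow> ('m \<Rightarrow> 'e \<Rightarrow> real) \<Rightarrow> bool" where
  "smooth_one_form C \<omega> \<longleftrightarrow> (\<forall>p. linear (\<omega> p)) \<and>
     (\<forall>p u. smooth_on (\<lambda>x. let a = cinv C p x in \<omega> a (coord_field C p u a))
              (crd C p ` cdom C p))"

definition smooth_endomorphism ::
  "('m, 'e::euclidean_space) charts \<Rightarrow> ('m \<Rightarrow> 'e \<Rightarrow> 'e) \<Rightarrow> bool" where
  "smooth_endomorphism C \<phi> \<longleftrightarrow> (\<forall>p. linear (\<phi> p)) \<and>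
     (\<forall>p u. smooth_on (\<lambda>x. let a = cinv C p x in to_chart C p a (\<phi> a (coord_field C p u a)))
              (crd C p ` cdom C p))"


section \<open>Inner products\<close>

definition inner_product :: "('e::euclidean_space \<Rightarrow> 'e \<Rightarrow> real) \<Rightarrow> bool" where
  "inner_product B \<longleftrightarrow> bilinear B \<and> (\<forall>u v. B u v = B v u) \<and> (\<forall>u. u \<noteq> 0 \<longrightarrow> B u u > 0)"

definition norm_wrt :: "('e \<Rightarrow> 'e \<Rightarrow> real) \<Rightarrow> 'e \<Rightarrow> real" where
  "norm_wrt B v = sqrt (B v v)"

definition normal_part :: "('e \<Rightarrow> 'e \<Rightarrow> real) \<Rightarrow> 'e set \<Rightarrow> 'e::euclidean_space \<Rightarrow> 'e" where
  "normal_part B S z = (THE w. (\<forall>s\<in>S. B w s = 0) \<and> z - w \<in> S)"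

definition tangential_part :: "('e \<Rightarrow> 'e \<Rightarrow> real) \<Rightarrow> 'e set \<Rightarrow> 'e::euclidean_space \<Rightarrow> 'e" where
  "tangential_part B S z = z - normal_part B S z"

text \<open>The angle in \<open>[0, \<pi>/2]\<close> between a nonzero vector and a subspace.\<close>

definition angle_to_subspace :: "('e \<Rightarrow> 'e \<Rightarrow> real) \<Rightarrow> 'e::euclidean_space \<Rightarrow> 'e set \<Rightarrow> real" where
  "angle_to_subspace B v S = arccos (norm_wrt B (tangential_part B S v) / norm_wrt B v)"

definition orthonormal_frame :: "('e::euclidean_space \<Rightarrow> 'e \<Rightarrow> real) \<Rightarrow> 'e set \<Rightarrow> bool" where
  "orthonormal_frame B E \<longleftrightarrow> finite E \<and> card E = DIM('e) \<and>
     (\<forall>e\<in>E. \<forall>e'\<in>E. B e e' = (if e = e' then 1 else 0))"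


section \<open>Riemannian metrics and the Levi-Civita connection\<close>

text \<open>The component of the metric along the coordinate fields \<open>u\<close>, \<open>v\<close> of the chart at \<open>p\<close>,
  as a function of the coordinates.\<close>

definition metric_coords ::
  "('m, 'e::euclidean_space) charts \<Rightarrow> ('m \<Rightarrow> 'e \<Rightarrow> 'e \<Rightarrow> real) \<Rightarrow> 'm \<Rightarrow> 'e \<Rightarrow> 'e \<Rightarrow> 'e \<Rightarrow> real" where
  "metric_coords C g p u v x =
     (let a = cinv C p x in g a (coord_field C p u a) (coord_field C p v a))"

definition riemannian_metric ::
  "('m, 'e::euclidean_space) charts \<Rightarrow> ('m \<Rightarrow> 'e \<Rightarrow> 'e \<Rightarrow> real) \<Rightarrow> bool" where
  "riemannian_metric C g \<longleftrightarrow> (\<forall>p. inner_product (g p)) \<and>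
     (\<forall>p u v. smooth_on (metric_coords C g p u v) (crd C p ` cdom C p))"

text \<open>
  The Christoffel symbols at \<open>p\<close>, in the chart at \<open>p\<close>, of the Levi-Civita connection:
  \<open>christoffel C g p u v\<close> is the value at \<open>p\<close> of the covariant derivative of the coordinate
  field \<open>v\<close> in direction \<open>u\<close>. Coordinate fields commute, so vanishing torsion is symmetry in
  \<open>u\<close>, \<open>v\<close>; the last conjunct says that the metric is parallel.
\<close>

definition christoffel ::
  "('m, 'e::euclidean_space) charts \<Rightarrow> ('m \<Rightarrow> 'e \<Rightarrow> 'e \<Rightarrow> real) \<Rightarrow> 'm \<Rightarrow> 'e \<Rightarrow> 'e \<Rightarrow> 'e" where
  "christoffel C g p = (THE \<Gamma>. bilinear \<Gamma> \<and> (\<forall>u v. \<Gamma> u v = \<Gamma> v u) \<and>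
     (\<forall>u v w. frechet_derivative (metric_coords C g p v w) (at (crd C p p)) u =
                g p (\<Gamma> u v) w + g p v (\<Gamma> u w)))"

text \<open>
  The covariant derivative at \<open>p\<close>, in direction \<open>u\<close> tangent to \<open>N\<close> at \<open>p\<close>, of a vector field \<open>V\<close>
  along \<open>F : N \<rightarrow> M\<close> (so \<open>V a\<close> is tangent to \<open>M\<close> at \<open>F a\<close>), for the Levi-Civita connection
  of \<open>(M, g)\<close>. With \<open>F = id\<close> it is the Levi-Civita connection itself.
\<close>

definition cov_deriv_along ::
  "('n, 'd::euclidean_space) charts \<Rightarrow> ('m, 'e::euclidean_space) charts \<Rightarrow>
   ('m \<Rightarrow> 'e \<Rightarrow> 'e \<Rightarrow> real) \<Rightarrow> ('n \<Rightarrow> 'm) \<Rightarrow> ('n \<Rightarrow> 'e) \<Rightarrow> 'n \<Rightarrow> 'd \<Rightarrow> 'e" where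
  "cov_deriv_along D C g F V p u =
     frechet_derivative (\<lambda>x. let a = cinv D p x in to_chart C (F p) (F a) (V a)) (at (crd D p p)) u
     + christoffel C g (F p) (differential D C F p u) (V p)"

definition cov_deriv ::
  "('m, 'e::euclidean_space) charts \<Rightarrow> ('m \<Rightarrow> 'e \<Rightarrow> 'e \<Rightarrow> real) \<Rightarrow> ('m \<Rightarrow> 'e) \<Rightarrow> ('m \<Rightarrow> 'e) \<Rightarrow> 'm \<Rightarrow> 'e"
where
  "cov_deriv C g X Y p = cov_deriv_along C C g id Y p (X p)"

definition gradient ::
  "('m, 'e::euclidean_space) charts \<Rightarrow> ('m \<Rightarrow> 'e \<Rightarrow> 'e \<Rightarrow> real) \<Rightarrow> ('m \<Rightarrow> real) \<Rightarrow> 'm \<Rightarrow> 'e" where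
  "gradient C g f p =
     (THE w. \<forall>v. g p w v = frechet_derivative (f \<circ> cinv C p) (at (crd C p p)) v)"

definition gradient_norm_sq ::
  "('m, 'e::euclidean_space) charts \<Rightarrow> ('m \<Rightarrow> 'e \<Rightarrow> 'e \<Rightarrow> real) \<Rightarrow> ('m \<Rightarrow> real) \<Rightarrow> 'm \<Rightarrow> real" where
  "gradient_norm_sq C g f p = g p (gradient C g f p) (gradient C g f p)"


section \<open>Nearly cosymplectic manifolds\<close>

definition almost_contact_metric ::
  "('m::{t2_space, second_countable_topology}, 'e::euclidean_space) charts \<Rightarrow>
   ('m \<Rightarrow> 'e \<Rightarrow> 'e) \<Rightarrow> ('m \<Rightarrow> 'e) \<Rightarrow> ('m \<Rightarrow> 'e \<Rightarrow> real) \<Rightarrow> ('m \<Rightarrow> 'e \<Rightarrow> 'e \<Rightarrow> real) \<Rightarrow> bool" where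
  "almost_contact_metric C \<phi> \<xi> \<eta> g \<longleftrightarrow>
     manifold C \<and> odd DIM('e) \<and> riemannian_metric C g \<and>
     smooth_endomorphism C \<phi> \<and> smooth_vector_field_on C UNIV \<xi> \<and> smooth_one_form C \<eta> \<and>
     (\<forall>p X. \<phi> p (\<phi> p X) = - X + \<eta> p X *\<^sub>R \<xi> p) \<and>
     (\<forall>p. \<phi> p (\<xi> p) = 0) \<and>
     (\<forall>p X. \<eta> p (\<phi> p X) = 0) \<and>
     (\<forall>p. \<eta> p (\<xi> p) = 1) \<and>
     (\<forall>p X. \<eta> p X = g p X (\<xi> p)) \<and>
     (\<forall>p X Y. g p (\<phi> p X) (\<phi> p Y) = g p X Y - \<eta> p X * \<eta> p Y)"

definition cov_deriv_endo ::
  "('m, 'e::euclidean_space) charts \<Rightarrow> ('m \<Rightarrow> 'e \<Rightarrow> 'e \<Rightarrow> real) \<Rightarrow> ('m \<Rightarrow> 'e \<Rightarrow> 'e) \<Rightarrow>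
   ('m \<Rightarrow> 'e) \<Rightarrow> ('m \<Rightarrow> 'e) \<Rightarrow> 'm \<Rightarrow> 'e" where
  "cov_deriv_endo C g \<phi> X Y p =
     cov_deriv C g X (\<lambda>a. \<phi> a (Y a)) p - \<phi> p (cov_deriv C g X Y p)"

text \<open>The vector fields range over all locally defined ones.\<close>

definition nearly_cosymplectic ::
  "('m::{t2_space, second_countable_topology}, 'e::euclidean_space) charts \<Rightarrow>
   ('m \<Rightarrow> 'e \<Rightarrow> 'e) \<Rightarrow> ('m \<Rightarrow> 'e) \<Rightarrow> ('m \<Rightarrow> 'e \<Rightarrow> real) \<Rightarrow> ('m \<Rightarrow> 'e \<Rightarrow> 'e \<Rightarrow> real) \<Rightarrow> bool" where
  "nearly_cosymplectic C \<phi> \<xi> \<eta> g \<longleftrightarrow> almost_contact_metric C \<phi> \<xi> \<eta> g \<and>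
     (\<forall>U X Y. open U \<longrightarrow> smooth_vector_field_on C U X \<longrightarrow> smooth_vector_field_on C U Y \<longrightarrow>
        (\<forall>p\<in>U. cov_deriv_endo C g \<phi> X Y p + cov_deriv_endo C g \<phi> Y X p = 0))"


section \<open>Submanifolds\<close>

text \<open>Submanifolds are immersed: a submanifold of \<open>M\<close> is an immersion \<open>F : N \<rightarrow> M\<close>.\<close>

definition immersion ::
  "('n::topological_space, 'd::euclidean_space) charts \<Rightarrow>
   ('m::topological_space, 'e::euclidean_space) charts \<Rightarrow> ('n \<Rightarrow> 'm) \<Rightarrow> bool" where
  "immersion D C F \<longleftrightarrow> smooth_map D C F \<and> (\<forall>p. inj (differential D C F p))"

definition tangent_image ::
  "('n, 'd::euclidean_space) charts \<Rightarrow> ('m, 'e::euclidean_space) charts \<Rightarrow> ('n \<Rightarrow> 'm) \<Rightarrow> 'n \<Rightarrow> 'e set"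
where
  "tangent_image D C F p = range (differential D C F p)"

definition induced_metric ::
  "('n, 'd::euclidean_space) charts \<Rightarrow> ('m, 'e::euclidean_space) charts \<Rightarrow>
   ('m \<Rightarrow> 'e \<Rightarrow> 'e \<Rightarrow> real) \<Rightarrow> ('n \<Rightarrow> 'm) \<Rightarrow> 'n \<Rightarrow> 'd \<Rightarrow> 'd \<Rightarrow> real" where
  "induced_metric D C g F p u v = g (F p) (differential D C F p u) (differential D C F p v)"

text \<open>
  For vector fields \<open>X\<close>, \<open>Y\<close> tangent to the submanifold, \<open>h(X, Y)\<close> is the normal component of the
  ambient covariant derivative of \<open>Y\<close> along \<open>X\<close>. It is tensorial, so its value on tangent vectors
  \<open>u\<close>, \<open>v\<close> at \<open>p\<close> is obtained by extending \<open>v\<close> to a coordinate field of the chart at \<open>p\<close>.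
\<close>

definition second_fundamental_form ::
  "('n, 'd::euclidean_space) charts \<Rightarrow> ('m, 'e::euclidean_space) charts \<Rightarrow>
   ('m \<Rightarrow> 'e \<Rightarrow> 'e \<Rightarrow> real) \<Rightarrow> ('n \<Rightarrow> 'm) \<Rightarrow> 'n \<Rightarrow> 'd \<Rightarrow> 'd \<Rightarrow> 'e" where
  "second_fundamental_form D C g F p u v =
     normal_part (g (F p)) (tangent_image D C F p)
       (cov_deriv_along D C g F (\<lambda>a. differential D C F a (coord_field D p v a)) p u)"

text \<open>The next two definitions do not depend on the choice of the orthonormal frame.\<close>

definition sff_norm_sq ::
  "('n, 'd::euclidean_space) charts \<Rightarrow> ('m, 'e::euclidean_space) charts \<Rightarrow>
   ('m \<Rightarrow> 'e \<Rightarrow> 'e \<Rightarrow> real) \<Rightarrow> ('n \<Rightarrow> 'm) \<Rightarrow> 'n \<Rightarrow> real" where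
  "sff_norm_sq D C g F p =
     (let E = (SOME E. orthonormal_frame (induced_metric D C g F p) E);
          h = second_fundamental_form D C g F p
      in \<Sum>e\<in>E. \<Sum>e'\<in>E. g (F p) (h e e') (h e e'))"

definition sff_trace ::
  "('n, 'd::euclidean_space) charts \<Rightarrow> ('m, 'e::euclidean_space) charts \<Rightarrow>
   ('m \<Rightarrow> 'e \<Rightarrow> 'e \<Rightarrow> real) \<Rightarrow> ('n \<Rightarrow> 'm) \<Rightarrow> 'n \<Rightarrow> 'e" where
  "sff_trace D C g F p =
     (let E = (SOME E. orthonormal_frame (induced_metric D C g F p) E)
      in \<Sum>e\<in>E. second_fundamental_form D C g F p e e)"

definition mean_curvature ::
  "('n, 'd::euclidean_space) charts \<Rightarrow> ('m, 'e::euclidean_space) charts \<Rightarrow>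
   ('m \<Rightarrow> 'e \<Rightarrow> 'e \<Rightarrow> real) \<Rightarrow> ('n \<Rightarrow> 'm) \<Rightarrow> 'n \<Rightarrow> 'e" where
  "mean_curvature D C g F p = (1 / real DIM('d)) *\<^sub>R sff_trace D C g F p"

definition totally_geodesic ::
  "('n, 'd::euclidean_space) charts \<Rightarrow> ('m, 'e::euclidean_space) charts \<Rightarrow>
   ('m \<Rightarrow> 'e \<Rightarrow> 'e \<Rightarrow> real) \<Rightarrow> ('n \<Rightarrow> 'm) \<Rightarrow> bool" where
  "totally_geodesic D C g F \<longleftrightarrow> (\<forall>p u v. second_fundamental_form D C g F p u v = 0)"

definition totally_umbilical ::
  "('n, 'd::euclidean_space) charts \<Rightarrow> ('m, 'e::euclidean_space) charts \<Rightarrow>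
   ('m \<Rightarrow> 'e \<Rightarrow> 'e \<Rightarrow> real) \<Rightarrow> ('n \<Rightarrow> 'm) \<Rightarrow> bool" where
  "totally_umbilical D C g F \<longleftrightarrow> (\<forall>p u v.
     second_fundamental_form D C g F p u v = induced_metric D C g F p u v *\<^sub>R mean_curvature D C g F p)"

definition minimal_submanifold ::
  "('n, 'd::euclidean_space) charts \<Rightarrow> ('m, 'e::euclidean_space) charts \<Rightarrow>
   ('m \<Rightarrow> 'e \<Rightarrow> 'e \<Rightarrow> real) \<Rightarrow> ('n \<Rightarrow> 'm) \<Rightarrow> bool" where
  "minimal_submanifold D C g F \<longleftrightarrow> (\<forall>p. sff_trace D C g F p = 0)"

definition invariant_submanifold ::
  "('n, 'd::euclidean_space) charts \<Rightarrow> ('m, 'e::euclidean_space) charts \<Rightarrow>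
   ('m \<Rightarrow> 'e \<Rightarrow> 'e) \<Rightarrow> ('n \<Rightarrow> 'm) \<Rightarrow> bool" where
  "invariant_submanifold D C \<phi> F \<longleftrightarrow>
     (\<forall>p. \<forall>X\<in>tangent_image D C F p. \<phi> (F p) X \<in> tangent_image D C F p)"

definition anti_invariant_submanifold ::
  "('n, 'd::euclidean_space) charts \<Rightarrow> ('m, 'e::euclidean_space) charts \<Rightarrow>
   ('m \<Rightarrow> 'e \<Rightarrow> 'e) \<Rightarrow> ('m \<Rightarrow> 'e \<Rightarrow> 'e \<Rightarrow> real) \<Rightarrow> ('n \<Rightarrow> 'm) \<Rightarrow> bool" where
  "anti_invariant_submanifold D C \<phi> g F \<longleftrightarrow>
     (\<forall>p. \<forall>X\<in>tangent_image D C F p. \<forall>Y\<in>tangent_image D C F p. g (F p) (\<phi> (F p) X) Y = 0)"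

definition slant_submanifold ::
  "('n, 'd::euclidean_space) charts \<Rightarrow> ('m, 'e::euclidean_space) charts \<Rightarrow>
   ('m \<Rightarrow> 'e \<Rightarrow> 'e) \<Rightarrow> ('m \<Rightarrow> 'e) \<Rightarrow> ('m \<Rightarrow> 'e \<Rightarrow> 'e \<Rightarrow> real) \<Rightarrow> ('n \<Rightarrow> 'm) \<Rightarrow> real \<Rightarrow> bool" where
  "slant_submanifold D C \<phi> \<xi> g F \<theta> \<longleftrightarrow> 0 \<le> \<theta> \<and> \<theta> \<le> pi / 2 \<and>
     (\<forall>p. \<forall>X\<in>tangent_image D C F p. X \<noteq> 0 \<longrightarrow> (\<nexists>c. X = c *\<^sub>R \<xi> (F p)) \<longrightarrow>
        angle_to_subspace (g (F p)) (\<phi> (F p) X) (tangent_image D C F p) = \<theta>)"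

definition proper_slant_submanifold ::
  "('n, 'd::euclidean_space) charts \<Rightarrow> ('m, 'e::euclidean_space) charts \<Rightarrow>
   ('m \<Rightarrow> 'e \<Rightarrow> 'e) \<Rightarrow> ('m \<Rightarrow> 'e) \<Rightarrow> ('m \<Rightarrow> 'e \<Rightarrow> 'e \<Rightarrow> real) \<Rightarrow> ('n \<Rightarrow> 'm) \<Rightarrow> real \<Rightarrow> bool" where
  "proper_slant_submanifold D C \<phi> \<xi> g F \<theta> \<longleftrightarrow> slant_submanifold D C \<phi> \<xi> g F \<theta> \<and>
     \<not> invariant_submanifold D C \<phi> F \<and> \<not> anti_invariant_submanifold D C \<phi> g F"


section \<open>Warped products\<close>

definition warped_metric ::
  "('a \<Rightarrow> 'd \<Rightarrow> 'd \<Rightarrow> real) \<Rightarrow> ('b \<Rightarrow> 'f \<Rightarrow> 'f \<Rightarrow> real) \<Rightarrow> ('a \<Rightarrow> real) \<Rightarrow>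
   'a \<times> 'b \<Rightarrow> 'd \<times> 'f \<Rightarrow> 'd \<times> 'f \<Rightarrow> real" where
  "warped_metric g1 g2 f =
     (\<lambda>(x, y) (u, v) (u', v'). g1 x u u' + (f x)\<^sup>2 * g2 y v v')"

text \<open>
  \<open>\<iota>\<close> immerses \<open>N\<^sub>T \<times> N\<^sub>\<theta>\<close> (charts \<open>C1\<close>, \<open>C2\<close>) into the ambient manifold (charts \<open>C\<close>).
  The copies of \<open>N\<^sub>T\<close> and \<open>N\<^sub>\<theta>\<close> are the partial maps of \<open>\<iota>\<close>; the last conjunct says that
  \<open>\<xi>\<close> is tangent to \<open>N\<^sub>T\<close>.
\<close>

definition warped_product_semi_slant ::
  "('m::{t2_space, second_countable_topology}, 'e::euclidean_space) charts \<Rightarrow>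
   ('m \<Rightarrow> 'e \<Rightarrow> 'e) \<Rightarrow> ('m \<Rightarrow> 'e) \<Rightarrow> ('m \<Rightarrow> 'e \<Rightarrow> 'e \<Rightarrow> real) \<Rightarrow>
   ('a::{t2_space, second_countable_topology}, 'd::euclidean_space) charts \<Rightarrow>
   ('a \<Rightarrow> 'd \<Rightarrow> 'd \<Rightarrow> real) \<Rightarrow>
   ('b::{t2_space, second_countable_topology}, 'f::euclidean_space) charts \<Rightarrow>
   ('b \<Rightarrow> 'f \<Rightarrow> 'f \<Rightarrow> real) \<Rightarrow>
   ('a \<Rightarrow> real) \<Rightarrow> ('a \<times> 'b \<Rightarrow> 'm) \<Rightarrow> real \<Rightarrow> bool" where
  "warped_product_semi_slant C \<phi> \<xi> g C1 g1 C2 g2 f \<iota> \<theta> \<longleftrightarrow>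
     manifold C1 \<and> riemannian_metric C1 g1 \<and> manifold C2 \<and> riemannian_metric C2 g2 \<and>
     smooth_fun C1 f \<and> (\<forall>x. f x > 0) \<and>
     immersion (prod_charts C1 C2) C \<iota> \<and>
     induced_metric (prod_charts C1 C2) C g \<iota> = warped_metric g1 g2 f \<and>
     (\<forall>y. invariant_submanifold C1 C \<phi> (\<lambda>x. \<iota> (x, y))) \<and>
     (\<forall>x. proper_slant_submanifold C2 C \<phi> \<xi> g (\<lambda>y. \<iota> (x, y)) \<theta>) \<and>
     (\<forall>x y. \<xi> (\<iota> (x, y)) \<in> tangent_image C1 C (\<lambda>x. \<iota> (x, y)) x)"

end

(*
  Differentiate the pulled back 2-form omega(v, w) = g(phi v, w) on M.  Mixed components of omega
  vanish, and since nabla phi is a 3-form T, this gives g(h(X, Z), F W) in terms of the derivatives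
  of ln f and T(X, Z, W), where F is the normal part of phi on the tangent space of the slant factor;
  moreover the derivative of omega along X on the slant factor equals 3 T(X, ., .).  By slantness
  the squared length of omega on the fibres is a constant multiple of f^4, so differentiation along X
  fixes the component of T(X, ., .) in the direction of omega.  Expanding h(X, Z) in the orthonormal
  frame F Z_k / sin theta and projecting on omega yields the bound, with xi(ln f) = 0 giving the
  two equal sums over the base.  In the equality case h vanishes on pairs of horizontal and on pairs
  of vertical vectors, and Koszul's formula for the warped metric does the rest.
*)
theory Submission
  imports Defs
begin

section \<open>Orthonormal systems of a positive definite form\<close>

text \<open>The obstacle is that T(X, ., .) need not be proportional to omega on the fibres; only
  its component along omega is under control, and the rest has to enter the estimate as a discarded
  square. The constant 1/9 is a squared 1/3. In a frame of the fibre kept fixed along the base, the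
  squared length of omega is a multiple of \<open>f ^ 4\<close>, so the inner product of omega with
  its derivative along X is 2 X(ln f) times the squared length of omega. That derivative is 3 T(X,
  ., .), so T(X, ., .) has component (2/3) X(ln f) along omega. The skew part of g(h(X, Z), F W) is
  X(ln f) omega - T(X, ., .), which leaves (1/3) X(ln f). The factor cos^2 is the squared length of
  omega per dimension of the fibre, and 1 / sin^2 comes from the length of F Z. The summand 1 of the
  bound comes from the remaining term -(\<phi> X)(ln f) g(Z, W), which lives on the diagonal, where
  skew forms vanish.\<close>

locale pos_def_form =
  fixes B :: "'e::euclidean_space \<Rightarrow> 'e \<Rightarrow> real"
  assumes inner_product: "inner_product B"
begin

lemma bil: "bilinear B"
  using inner_product by (simp add: inner_product_def)

lemma sym: "B u v = B v u"
  using inner_product by (simp add: inner_product_def)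

lemma pos: "u \<noteq> 0 \<Longrightarrow> B u u > 0"
  using inner_product by (simp add: inner_product_def)

lemmas linear_simps = bilinear_ladd[OF bil] bilinear_radd[OF bil] bilinear_lsub[OF bil]
  bilinear_rsub[OF bil] bilinear_lmul[OF bil] bilinear_rmul[OF bil] bilinear_lneg[OF bil]
  bilinear_rneg[OF bil] bilinear_lzero[OF bil] bilinear_rzero[OF bil]

lemma linear_left: "linear (\<lambda>u. B u v)" and linear_right: "linear (B u)"
  using bil by (auto simp: bilinear_def)

lemma sum_left: "B (sum f I) v = (\<Sum>i\<in>I. B (f i) v)"
  by (rule linear_sum[OF linear_left])

lemma sum_right: "B v (sum f I) = (\<Sum>i\<in>I. B v (f i))"
  by (rule linear_sum[OF linear_right])

lemma nonneg: "B u u \<ge> 0"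
  using pos[of u] by (cases "u = 0") (auto simp: linear_simps)

lemma eq_0_iff: "B u u = 0 \<longleftrightarrow> u = 0"
  using pos[of u] by (cases "u = 0") (auto simp: linear_simps)

lemma eqI: "(\<And>w. B u w = B v w) \<Longrightarrow> u = v"
  using eq_0_iff[of "u - v"] by (simp add: linear_simps)

text \<open>No cardinality is imposed, in contrast to \<open>orthonormal_frame\<close>: orthonormal
  bases of subspaces, such as the tangent space of a fibre, are wanted too.\<close>

definition orthonormal :: "'e set \<Rightarrow> bool" where
  "orthonormal E \<longleftrightarrow> finite E \<and> (\<forall>e\<in>E. \<forall>e'\<in>E. B e e' = (if e = e' then 1 else 0))"

lemma orthonormal_coeff:
  assumes "orthonormal E" "e \<in> E"
  shows "B (\<Sum>e'\<in>E. c e' *\<^sub>R e') e = c e"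
proof -
  have "B (\<Sum>e'\<in>E. c e' *\<^sub>R e') e = (\<Sum>e'\<in>E. if e' = e then c e' else 0)"
    unfolding sum_left using assms
    by (intro sum.cong) (auto simp: orthonormal_def linear_simps)
  then show ?thesis
    using assms by (simp add: orthonormal_def)
qed

lemma orthonormal_independent:
  assumes "orthonormal E"
  shows "independent E"
proof -
  have "finite E" using assms by (simp add: orthonormal_def)
  have "c e = 0" if "(\<Sum>e\<in>E. c e *\<^sub>R e) = 0" "e \<in> E" for c e
    using orthonormal_coeff[OF assms that(2), of c] that(1) by (simp add: linear_simps)
  then show ?thesis
    using independent_if_scalars_zero[OF \<open>finite E\<close>] by blast
qed

lemma expand:
  assumes "orthonormal E" "x \<in> span E"
  shows "x = (\<Sum>e\<in>E. B x e *\<^sub>R e)"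
proof -
  have "finite E" using assms by (simp add: orthonormal_def)
  then obtain c where c: "x = (\<Sum>e\<in>E. c e *\<^sub>R e)"
    using assms(2) unfolding span_finite[OF \<open>finite E\<close>] by auto
  have "B x e = c e" if "e \<in> E" for e
    using orthonormal_coeff[OF assms(1) that, of c] c by simp
  then show ?thesis
    by (subst c) (auto intro!: sum.cong)
qed

lemma parseval:
  assumes "orthonormal E" "x \<in> span E"
  shows "B x y = (\<Sum>e\<in>E. B x e * B e y)"
  by (subst expand[OF assms]) (simp add: sum_left linear_simps)

lemma parseval_sq:
  assumes "orthonormal E" "x \<in> span E"
  shows "B x x = (\<Sum>e\<in>E. (B x e)\<^sup>2)"
  by (subst parseval[OF assms]) (simp add: power2_eq_square sym)

text \<open>An orthonormal subset of \<open>S\<close> of greatest cardinality exists because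
  orthonormal sets are independent. If it missed some \<open>z\<close> of \<open>S\<close>, one
  Gram-Schmidt step, the normalised residual \<open>w\<close> of \<open>z\<close>, would enlarge
  it.\<close>

lemma orthonormal_basis_exists:
  assumes "subspace S"
  shows "\<exists>E\<subseteq>S. orthonormal E \<and> span E = S \<and> card E = dim S"
proof -
  define P where "P E \<longleftrightarrow> E \<subseteq> S \<and> orthonormal E" for E
  have "P {}" by (simp add: P_def orthonormal_def)
  moreover have "card E < Suc DIM('e)" if "P E" for E
    using independent_bound[OF orthonormal_independent[of E]] that by (auto simp: P_def)
  ultimately obtain E where E: "P E" and mx: "\<And>E'. P E' \<Longrightarrow> card E' \<le> card E"
    using ex_has_greatest_nat[of P "{}" card "Suc DIM('e)"] by blast
  have on: "orthonormal E" and sub: "E \<subseteq> S" and fin: "finite E"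
    using E by (auto simp: P_def orthonormal_def)
  have "S \<subseteq> span E"
  proof
    fix z assume "z \<in> S"
    show "z \<in> span E"
    proof (rule ccontr)
      assume nz: "z \<notin> span E"
      define y where "y = z - (\<Sum>e\<in>E. B z e *\<^sub>R e)"
      have yE: "B y e = 0" if "e \<in> E" for e
        using orthonormal_coeff[OF on that, of "B z"] by (simp add: y_def linear_simps)
      have "(\<Sum>e\<in>E. B z e *\<^sub>R e) \<in> span E"
        by (intro span_sum span_scale span_base)
      then have y0: "y \<noteq> 0" using nz by (auto simp: y_def)
      define w where "w = (1 / sqrt (B y y)) *\<^sub>R y"
      have ww: "B w w = 1"
        using pos[OF y0] by (simp add: w_def linear_simps)
      have wE: "B w e = 0" "B e w = 0" if "e \<in> E" for e
        using yE[OF that] by (auto simp: w_def linear_simps sym)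
      have "w \<notin> E" using wE[of w] ww by auto
      have "(\<Sum>e\<in>E. B z e *\<^sub>R e) \<in> S"
        using sub assms by (intro subspace_sum subspace_scale) auto
      then have "w \<in> S"
        using \<open>z \<in> S\<close> assms by (simp add: w_def y_def subspace_diff subspace_scale)
      then have "P (insert w E)"
        using on sub wE ww \<open>w \<notin> E\<close> by (auto simp: P_def orthonormal_def)
      from mx[OF this] show False
        using fin \<open>w \<notin> E\<close> by simp
    qed
  qed
  then have sp: "span E = S"
    using sub assms by (simp add: span_minimal subset_antisym)
  then have "card E = dim S"
    using orthonormal_independent[OF on] dim_span_eq_card_independent by metis
  with sp on sub show ?thesis by blast
qed

lemma orthonormal_frame_exists: "\<exists>E. orthonormal_frame B E"
proof -
  obtain E where "orthonormal E" "card E = dim (UNIV :: 'e set)"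
    using orthonormal_basis_exists[OF subspace_UNIV] by blast
  then have "orthonormal_frame B E"
    unfolding orthonormal_frame_def orthonormal_def by (auto simp: dim_UNIV)
  then show ?thesis ..
qed

lemma orthonormal_frameD:
  assumes "orthonormal_frame B E"
  shows "orthonormal E" "span E = UNIV"
proof -
  show on: "orthonormal E"
    using assms by (simp add: orthonormal_def orthonormal_frame_def)
  have "UNIV \<subseteq> span E"
    using assms orthonormal_independent[OF on]
    by (intro card_ge_dim_independent) (auto simp: orthonormal_frame_def dim_UNIV)
  then show "span E = UNIV" by auto
qed

text \<open>Expanding each vector of \<open>E\<close> in \<open>E'\<close> leaves the coefficient
  sums of \<open>B e a * B e b\<close> over \<open>E\<close>, which Parseval turns into
  \<open>B a b\<close>. This frees \<open>sff_norm_sq\<close> and \<open>sff_trace\<close> from the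
  frame picked by \<open>SOME\<close>; the values lie in any real vector space so that the
  vector-valued trace is covered as well.\<close>

lemma trace_frame_independent:
  fixes Q :: "'e \<Rightarrow> 'e \<Rightarrow> 'w::real_vector"
  assumes E: "orthonormal_frame B E" and E': "orthonormal_frame B E'"
    and Q1: "\<And>v. linear (\<lambda>u. Q u v)" and Q2: "\<And>u. linear (Q u)"
  shows "(\<Sum>e\<in>E. Q e e) = (\<Sum>e\<in>E'. Q e e)"
proof -
  note on = orthonormal_frameD[OF E] and on' = orthonormal_frameD[OF E']
  have "Q e e = (\<Sum>a\<in>E'. \<Sum>b\<in>E'. (B e a * B e b) *\<^sub>R Q a b)" for e
  proof -
    have "Q e e = Q (\<Sum>a\<in>E'. B e a *\<^sub>R a) (\<Sum>b\<in>E'. B e b *\<^sub>R b)"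
      using expand[OF on'(1), of e] on'(2) by simp
    also have "\<dots> = (\<Sum>a\<in>E'. \<Sum>b\<in>E'. (B e a * B e b) *\<^sub>R Q a b)"
      unfolding linear_sum[OF Q1] linear_scale[OF Q1]
      by (simp add: linear_sum[OF Q2] linear_scale[OF Q2] scaleR_sum_right)
    finally show ?thesis .
  qed
  then have "(\<Sum>e\<in>E. Q e e) = (\<Sum>e\<in>E. \<Sum>a\<in>E'. \<Sum>b\<in>E'. (B e a * B e b) *\<^sub>R Q a b)"
    by simp
  also have "\<dots> = (\<Sum>a\<in>E'. \<Sum>b\<in>E'. (\<Sum>e\<in>E. B e a * B e b) *\<^sub>R Q a b)"
    unfolding scaleR_sum_left by (subst sum.swap, rule sum.cong[OF refl], rule sum.swap)
  also have "\<dots> = (\<Sum>a\<in>E'. \<Sum>b\<in>E'. B a b *\<^sub>R Q a b)"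
    using on(2) by (intro sum.cong refl arg_cong[where f = "\<lambda>c. c *\<^sub>R _"])
      (subst parseval[OF on(1)], auto intro!: sum.cong simp: sym)
  also have "\<dots> = (\<Sum>a\<in>E'. \<Sum>b\<in>E'. if b = a then Q a b else 0)"
    using on'(1) by (intro sum.cong refl) (auto simp: orthonormal_def)
  also have "\<dots> = (\<Sum>a\<in>E'. Q a a)"
    using on'(1) by (intro sum.cong refl) (simp add: orthonormal_def)
  finally show ?thesis .
qed

text \<open>The residual of \<open>w\<close> after projection to the \<open>n i\<close> has
  nonnegative square. A family instead of a set, since it is applied to normal vectors indexed by a
  frame of the fibre.\<close>

lemma bessel:
  assumes "finite I" and "\<And>i j. i \<in> I \<Longrightarrow> j \<in> I \<Longrightarrow> B (n i) (n j) = (if i = j then 1 else 0)"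
  shows "(\<Sum>i\<in>I. (B w (n i))\<^sup>2) \<le> B w w"
proof -
  define y where "y = (\<Sum>i\<in>I. B w (n i) *\<^sub>R n i)"
  have y: "B y (n i) = B w (n i)" if "i \<in> I" for i
  proof -
    have "B y (n i) = (\<Sum>j\<in>I. if j = i then B w (n j) else 0)"
      unfolding y_def sum_left using assms that by (intro sum.cong) (auto simp: linear_simps)
    then show ?thesis using assms that by simp
  qed
  have "B w y = (\<Sum>i\<in>I. (B w (n i))\<^sup>2)"
    by (simp add: y_def sum_right linear_simps power2_eq_square)
  moreover have "B y y = (\<Sum>i\<in>I. (B w (n i))\<^sup>2)"
    using y by (subst (2) y_def) (simp add: sum_right linear_simps power2_eq_square)
  moreover have "0 \<le> B (w - y) (w - y)" by (rule nonneg)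
  ultimately show ?thesis
    by (simp add: linear_simps sym)
qed

text \<open>The witness is the sum of \<open>l e *\<^sub>R e\<close> over an orthonormal frame. It
  produces the Christoffel symbols from the Koszul expression and the gradient of ln f on the
  base.\<close>

lemma riesz:
  assumes "linear l"
  shows "\<exists>!w. \<forall>v. B w v = l v"
proof -
  obtain E where E: "orthonormal_frame B E" using orthonormal_frame_exists by blast
  note on = orthonormal_frameD[OF E]
  have "B (\<Sum>e\<in>E. l e *\<^sub>R e) v = l v" for v
  proof -
    have "l v = l (\<Sum>e\<in>E. B v e *\<^sub>R e)"
      using expand[OF on(1), of v] on(2) by simp
    also have "\<dots> = (\<Sum>e\<in>E. B e v * l e)"
      by (simp add: linear_sum[OF assms] linear_scale[OF assms] sym)
    finally show ?thesis
      by (simp add: sum_left linear_simps mult.commute)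
  qed
  then show ?thesis
    using eqI by metis
qed

section \<open>Orthogonal projection onto a subspace and the angle with it\<close>

lemma normal_part_ex1:
  assumes "subspace S"
  shows "\<exists>!w. (\<forall>s\<in>S. B w s = 0) \<and> z - w \<in> S"
proof -
  obtain E where E: "orthonormal E" "span E = S" "E \<subseteq> S"
    using orthonormal_basis_exists[OF assms] by blast
  define w where "w = z - (\<Sum>e\<in>E. B z e *\<^sub>R e)"
  have "B w s = 0" if "s \<in> S" for s
  proof -
    have we: "B w e = 0" if "e \<in> E" for e
      using orthonormal_coeff[OF E(1) that, of "B z"] by (simp add: w_def linear_simps)
    have "B s w = 0"
      using parseval[OF E(1), of s w] that E(2) we by (simp add: sym)
    then show ?thesis by (simp add: sym)
  qed
  moreover have "z - w \<in> S"
    using E(3) assms by (auto simp: w_def intro!: subspace_sum subspace_scale)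
  moreover have "v = w" if "\<forall>s\<in>S. B v s = 0" "z - v \<in> S" for v
  proof -
    have "v - w \<in> S"
      using subspace_diff[OF assms \<open>z - w \<in> S\<close> that(2)] by simp
    then have "B (v - w) (v - w) = 0"
      using that(1) calculation(1)[of "v - w"] by (simp add: bilinear_lsub[OF bil])
    then show ?thesis by (simp add: eq_0_iff)
  qed
  ultimately show ?thesis by blast
qed

lemma normal_part_eq:
  assumes "subspace S" "\<And>s. s \<in> S \<Longrightarrow> B w s = 0" "z - w \<in> S"
  shows "normal_part B S z = w"
  unfolding normal_part_def using assms normal_part_ex1[OF assms(1), of z] by (intro the1_equality) auto

lemma normal_part:
  assumes "subspace S"
  shows "s \<in> S \<Longrightarrow> B (normal_part B S z) s = 0" "z - normal_part B S z \<in> S"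
  using theI'[OF normal_part_ex1[OF assms, of z]] unfolding normal_part_def by auto

lemma linear_normal_part:
  assumes "subspace S"
  shows "linear (normal_part B S)"
proof
  note n = normal_part[OF assms]
  fix x y :: 'e and r :: real
  show "normal_part B S (x + y) = normal_part B S x + normal_part B S y"
    using n subspace_add[OF assms n(2)[of x] n(2)[of y]] assms
    by (intro normal_part_eq) (auto simp: linear_simps algebra_simps)
  show "normal_part B S (r *\<^sub>R x) = r *\<^sub>R normal_part B S x"
    using n subspace_scale[OF assms n(2)[of x], of r] assms
    by (intro normal_part_eq) (auto simp: linear_simps algebra_simps)
qed

lemma normal_part_eq_0:
  assumes "subspace S" "normal_part B S z = 0"
  shows "z \<in> S"
  using normal_part(2)[OF assms(1), of z] assms(2) by simp

text \<open>Pythagoras for the tangential and normal parts. The third claim, where no length is lost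
  under projection, is what turns slant angle zero into invariance.\<close>

lemma tangential_part_norm:
  assumes "subspace S" "orthonormal E" "span E = S"
  shows "B (tangential_part B S z) (tangential_part B S z) = (\<Sum>e\<in>E. (B z e)\<^sup>2)"
    and "B (tangential_part B S z) (tangential_part B S z) \<le> B z z"
    and "B (tangential_part B S z) (tangential_part B S z) = B z z \<Longrightarrow> z \<in> S"
proof -
  note n = normal_part[OF assms(1)]
  have t: "tangential_part B S z \<in> S" using n(2) by (simp add: tangential_part_def)
  have "B (tangential_part B S z) e = B z e" if "e \<in> E" for e
    using n(1)[of e z] span_base[OF that] assms(3) by (simp add: tangential_part_def linear_simps)
  then show "B (tangential_part B S z) (tangential_part B S z) = (\<Sum>e\<in>E. (B z e)\<^sup>2)"
    using parseval_sq[OF assms(2)] t assms(3) by simp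
  have "B z z = B (tangential_part B S z) (tangential_part B S z)
      + B (normal_part B S z) (normal_part B S z)"
    using n(1)[OF t, of z] by (simp add: tangential_part_def linear_simps sym)
  then show "B (tangential_part B S z) (tangential_part B S z) \<le> B z z"
    and "B (tangential_part B S z) (tangential_part B S z) = B z z \<Longrightarrow> z \<in> S"
    using nonneg[of "normal_part B S z"] normal_part_eq_0[OF assms(1), of z]
    by (auto simp: eq_0_iff)
qed

lemma tangential_part_angle:
  assumes "subspace S"
  shows "B (tangential_part B S z) (tangential_part B S z) = (cos (angle_to_subspace B z S))\<^sup>2 * B z z"
proof -
  obtain E where E: "orthonormal E" "span E = S"
    using orthonormal_basis_exists[OF assms] by blast
  define t where "t = tangential_part B S z"
  have le: "B t t \<le> B z z" unfolding t_def by (rule tangential_part_norm[OF assms E])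
  show ?thesis
  proof (cases "z = 0")
    \<comment> \<open>Both sides vanish here, whatever angle the division by zero in
      \<open>angle_to_subspace\<close> produces.\<close>
    case True
    then have "B t t = 0" using le nonneg[of t] by (simp add: linear_simps)
    then show ?thesis using True by (simp add: t_def linear_simps)
  next
    case False
    have "0 < B z z" using pos[OF False] .
    have "sqrt (B t t) / sqrt (B z z) \<le> 1" "0 \<le> sqrt (B t t) / sqrt (B z z)"
      using le \<open>0 < B z z\<close> nonneg[of t] by auto
    then have "cos (angle_to_subspace B z S) = sqrt (B t t) / sqrt (B z z)"
      unfolding angle_to_subspace_def norm_wrt_def t_def[symmetric] by (intro cos_arccos) linarith+
    then show ?thesis
      using \<open>0 < B z z\<close> nonneg[of t] by (simp add: t_def power_divide)
  qed
qed

end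

section \<open>Calculus of smooth functions\<close>

text \<open>Product rule for a field \<open>L\<close> applied to a moving vector \<open>a\<close>.
  Smoothness of tensor fields is only given componentwise, for frozen arguments, so
  \<open>L x\<close> is expanded in the standard basis and each scalar coefficient is differentiated
  separately.\<close>

lemma has_derivative_linear_family:
  fixes L :: "'a::real_normed_vector \<Rightarrow> 'b::euclidean_space \<Rightarrow> 'c::real_normed_vector"
  assumes S: "open S" "x0 \<in> S" and lin: "\<And>x. x \<in> S \<Longrightarrow> linear (L x)"
    and comp: "\<And>v. (\<lambda>x. L x v) differentiable (at x0)"
    and a: "(a has_derivative a') (at x0)"
  shows "((\<lambda>x. L x (a x)) has_derivative
    (\<lambda>u. frechet_derivative (\<lambda>x. L x (a x0)) (at x0) u + L x0 (a' u))) (at x0)"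
proof -
  define D where "D b = frechet_derivative (\<lambda>x. L x b) (at x0)" for b
  have D: "((\<lambda>x. L x b) has_derivative D b) (at x0)" for b
    using comp frechet_derivative_works unfolding D_def by blast
  have expand: "L x v = (\<Sum>b\<in>Basis. (v \<bullet> b) *\<^sub>R L x b)" if "x \<in> S" for x v
    using linear_sum[OF lin[OF that], of "\<lambda>b. (v \<bullet> b) *\<^sub>R b" Basis]
    by (simp add: linear_scale[OF lin[OF that]] euclidean_representation)
  have gen: "((\<lambda>x. L x (c x)) has_derivative
    (\<lambda>u. \<Sum>b\<in>Basis. (c x0 \<bullet> b) *\<^sub>R D b u + (c' u \<bullet> b) *\<^sub>R L x0 b)) (at x0)"
    if c: "(c has_derivative c') (at x0)" for c c'
  proof -
    have "((\<lambda>x. \<Sum>b\<in>Basis. (c x \<bullet> b) *\<^sub>R L x b) has_derivative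
      (\<lambda>u. \<Sum>b\<in>Basis. (c x0 \<bullet> b) *\<^sub>R D b u + (c' u \<bullet> b) *\<^sub>R L x0 b)) (at x0)"
      by (intro has_derivative_sum has_derivative_scaleR has_derivative_inner_left c D)
    then show ?thesis
      by (rule has_derivative_transform_within_open[OF _ S]) (simp add: expand[symmetric])
  qed
  \<comment> \<open>The same formula for the constant vector \<open>a x0\<close> recognises the
    first part of the sum as the derivative with frozen argument.\<close>
  have "frechet_derivative (\<lambda>x. L x (a x0)) (at x0) = (\<lambda>u. \<Sum>b\<in>Basis. (a x0 \<bullet> b) *\<^sub>R D b u)"
    using frechet_derivative_at[OF gen[OF has_derivative_const, of "a x0"]] by simp
  then show ?thesis
    using gen[OF a] expand[OF S(2), symmetric] by (simp add: sum.distrib)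
qed

lemma has_derivative_bilinear_family:
  fixes G :: "'a::real_normed_vector \<Rightarrow> 'b::euclidean_space \<Rightarrow> 'd::euclidean_space \<Rightarrow> 'c::real_normed_vector"
  assumes S: "open S" "x0 \<in> S" and bil: "\<And>x. x \<in> S \<Longrightarrow> bilinear (G x)"
    and comp: "\<And>v w. (\<lambda>x. G x v w) differentiable (at x0)"
    and a: "(a has_derivative a') (at x0)" and b: "(b has_derivative b') (at x0)"
  shows "((\<lambda>x. G x (a x) (b x)) has_derivative
    (\<lambda>u. frechet_derivative (\<lambda>x. G x (a x0) (b x0)) (at x0) u + G x0 (a' u) (b x0)
       + G x0 (a x0) (b' u))) (at x0)"
proof -
  have 1: "((\<lambda>x. G x (a x) w) has_derivative
    (\<lambda>u. frechet_derivative (\<lambda>x. G x (a x0) w) (at x0) u + G x0 (a' u) w)) (at x0)" for w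
    using has_derivative_linear_family[OF S _ _ a, of "\<lambda>x v. G x v w"] bil comp
    by (auto simp: bilinear_def)
  have "((\<lambda>x. G x (a x) (b x)) has_derivative
    (\<lambda>u. frechet_derivative (\<lambda>x. G x (a x) (b x0)) (at x0) u + G x0 (a x0) (b' u))) (at x0)"
    using bil differentiableI[OF 1]
    by (intro has_derivative_linear_family[OF S _ _ b]) (auto simp: bilinear_def)
  then show ?thesis
    unfolding frechet_derivative_at[OF 1, symmetric] by simp
qed

section \<open>Closure properties of functions of class C^k\<close>

lemma Ck_on_SucD:
  assumes "Ck_on (Suc k) f S"
  shows "x \<in> S \<Longrightarrow> (f has_derivative frechet_derivative f (at x)) (at x)"
    and "Ck_on k (\<lambda>x. frechet_derivative f (at x) v) S"
  using assms frechet_derivative_works[of f] by (simp_all only: Ck_on.simps)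

text \<open>Congruence at level \<open>k\<close> is a premise because the induction for
  \<open>Ck_on_cong\<close> uses this rule with its own induction hypothesis; afterwards
  \<open>Ck_on_SucI\<close> discharges it.\<close>

lemma Ck_on_Suc_aux:
  fixes f :: "'a::real_normed_vector \<Rightarrow> 'b::real_normed_vector"
  assumes "open S" "\<And>x. x \<in> S \<Longrightarrow> (f has_derivative f' x) (at x)" "\<And>v. Ck_on k (\<lambda>x. f' x v) S"
    and cong: "\<And>f g :: 'a \<Rightarrow> 'b. (\<And>x. x \<in> S \<Longrightarrow> f x = g x) \<Longrightarrow> Ck_on k f S \<Longrightarrow> Ck_on k g S"
  shows "Ck_on (Suc k) f S"
proof -
  have eq: "frechet_derivative f (at x) = f' x" if "x \<in> S" for x
    using frechet_derivative_at[OF assms(2)[OF that]] by simp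
  have "Ck_on k (\<lambda>x. frechet_derivative f (at x) v) S" for v
    by (rule cong[rotated, OF assms(3)]) (simp add: eq)
  then show ?thesis
    using differentiableI[OF assms(2)] by simp
qed

lemma Ck_on_cong:
  assumes "open S" "\<And>x. x \<in> S \<Longrightarrow> f x = g x" "Ck_on k f S"
  shows "Ck_on k g S"
  using assms(2,3)
proof (induction k arbitrary: f g)
  case 0
  then show ?case by (auto cong: continuous_on_cong)
next
  case (Suc k)
  have "(g has_derivative frechet_derivative f (at x)) (at x)" if "x \<in> S" for x
    using Ck_on_SucD(1)[OF Suc.prems(2) that] assms(1) that Suc.prems(1)
    by (rule has_derivative_transform_within_open)
  then show ?case
    using Ck_on_SucD(2)[OF Suc.prems(2)] Suc.IH by (rule Ck_on_Suc_aux[OF assms(1)])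
qed

lemma Ck_on_SucI:
  assumes "open S" "\<And>x. x \<in> S \<Longrightarrow> (f has_derivative f' x) (at x)" "\<And>v. Ck_on k (\<lambda>x. f' x v) S"
  shows "Ck_on (Suc k) f S"
  using assms Ck_on_cong[OF assms(1)] by (rule Ck_on_Suc_aux)

lemma Ck_on_Suc_imp_Ck_on: "Ck_on (Suc k) f S \<Longrightarrow> Ck_on k f S"
proof (induction k arbitrary: f)
  case 0
  then show ?case
    by (auto intro!: continuous_at_imp_continuous_on differentiable_imp_continuous_within)
next
  case (Suc k)
  then show ?case by (metis Ck_on.simps(2))
qed

lemma Ck_on_const: "Ck_on k (\<lambda>x. c) S"
  by (induction k arbitrary: c) auto

lemma Ck_on_bounded_linear:
  assumes "open S" "bounded_linear l" "Ck_on k f S"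
  shows "Ck_on k (\<lambda>x. l (f x)) S"
  using assms(3)
proof (induction k arbitrary: f)
  case 0
  then show ?case
    using bounded_linear.continuous_on[OF assms(2)] by auto
next
  case (Suc k)
  note D = Ck_on_SucD[OF Suc.prems]
  show ?case
    using bounded_linear.has_derivative[OF assms(2) D(1)] Suc.IH[OF D(2)]
    by (rule Ck_on_SucI[OF assms(1)])
qed

lemma Ck_on_add:
  assumes "open S" "Ck_on k f S" "Ck_on k g S"
  shows "Ck_on k (\<lambda>x. f x + g x) S"
  using assms(2,3)
proof (induction k arbitrary: f g)
  case 0
  then show ?case by (auto intro: continuous_intros)
next
  case (Suc k)
  note D = Ck_on_SucD[OF Suc.prems(1)] Ck_on_SucD[OF Suc.prems(2)]
  show ?case
    using has_derivative_add[OF D(1) D(3)] Suc.IH[OF D(2) D(4)]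
    by (rule Ck_on_SucI[OF assms(1)])
qed

lemma Ck_on_sum:
  assumes "open S" "\<And>i. i \<in> I \<Longrightarrow> Ck_on k (f i) S"
  shows "Ck_on k (\<lambda>x. \<Sum>i\<in>I. f i x) S"
  using assms(2)
  by (induction I rule: infinite_finite_induct) (auto intro: Ck_on_const Ck_on_add[OF assms(1)])

lemma Ck_on_scaleR:
  fixes f :: "'a::real_normed_vector \<Rightarrow> real"
  assumes "open S" "Ck_on k f S" "Ck_on k g S"
  shows "Ck_on k (\<lambda>x. f x *\<^sub>R g x) S"
  using assms(2,3)
proof (induction k arbitrary: f g)
  case 0
  then show ?case by (auto intro: continuous_intros)
next
  case (Suc k)
  note D = Ck_on_SucD[OF Suc.prems(1)] Ck_on_SucD[OF Suc.prems(2)]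
  show ?case
    using has_derivative_scaleR[OF D(1) D(3)]
      Ck_on_add[OF assms(1) Suc.IH[OF Ck_on_Suc_imp_Ck_on[OF Suc.prems(1)] D(4)]
        Suc.IH[OF D(2) Ck_on_Suc_imp_Ck_on[OF Suc.prems(2)]]]
    by (rule Ck_on_SucI[OF assms(1)])
qed

text \<open>The chain rule is written out in the standard basis, so that the derivative becomes a
  sum of scalar C^k functions times partial derivatives of \<open>g\<close> composed with
  \<open>f\<close>. To each of these, with a fixed basis vector, the induction hypothesis
  applies.\<close>

lemma Ck_on_compose:
  fixes f :: "'a::real_normed_vector \<Rightarrow> 'b::euclidean_space"
  assumes "open S" "f ` S \<subseteq> T" "Ck_on k f S" "Ck_on k g T"
  shows "Ck_on k (\<lambda>x. g (f x)) S"
  using assms(3,4)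
proof (induction k arbitrary: g)
  case 0
  then show ?case
    using assms(2) by (auto intro: continuous_on_compose2)
next
  case (Suc k)
  note f = Ck_on_SucD[OF Suc.prems(1)] and g = Ck_on_SucD[OF Suc.prems(2)]
  have "((\<lambda>x. g (f x)) has_derivative (\<lambda>v. \<Sum>b\<in>Basis. (frechet_derivative f (at x) v \<bullet> b) *\<^sub>R
    frechet_derivative g (at (f x)) b)) (at x)" if "x \<in> S" for x
  proof -
    have l: "linear (frechet_derivative g (at (f x)))"
      using has_derivative_linear[OF g(1)] that assms(2) by blast
    have "frechet_derivative g (at (f x)) w = (\<Sum>b\<in>Basis. (w \<bullet> b) *\<^sub>R frechet_derivative g (at (f x)) b)"
      for w
      using linear_sum[OF l, of "\<lambda>b. (w \<bullet> b) *\<^sub>R b" Basis]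
      by (simp add: linear_scale[OF l] euclidean_representation)
    from this[of "frechet_derivative f (at x) _"]
    have "frechet_derivative g (at (f x)) \<circ> frechet_derivative f (at x) =
      (\<lambda>v. \<Sum>b\<in>Basis. (frechet_derivative f (at x) v \<bullet> b) *\<^sub>R frechet_derivative g (at (f x)) b)"
      unfolding o_def by (rule ext)
    with diff_chain_at[OF f(1)[OF that] g(1)] that assms(2) show ?thesis
      by (simp add: o_def image_subset_iff)
  qed
  moreover have "Ck_on k (\<lambda>x. \<Sum>b\<in>Basis. (frechet_derivative f (at x) v \<bullet> b) *\<^sub>R
    frechet_derivative g (at (f x)) b) S" for v
    by (rule Ck_on_sum[OF assms(1) Ck_on_scaleR[OF assms(1)
          Ck_on_bounded_linear[OF assms(1) bounded_linear_inner_left f(2)]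
          Suc.IH[OF Ck_on_Suc_imp_Ck_on[OF Suc.prems(1)] g(2)]]])
  ultimately show ?case
    by (rule Ck_on_SucI[OF assms(1)])
qed

lemma smooth_onD:
  assumes "smooth_on f S" "x \<in> S"
  shows "f differentiable (at x)" "(\<lambda>x. frechet_derivative f (at x) v) differentiable (at x)"
  using assms unfolding smooth_on_def by (metis Ck_on.simps(2))+

lemma smooth_on_frechet_derivative:
  assumes "smooth_on f S"
  shows "smooth_on (\<lambda>x. frechet_derivative f (at x) v) S"
  using assms unfolding smooth_on_def by (metis Ck_on.simps(2))

lemma smooth_on_cong:
  assumes "smooth_on f S" "open S" "\<And>x. x \<in> S \<Longrightarrow> f x = g x"
  shows "smooth_on g S"
  using assms Ck_on_cong unfolding smooth_on_def by blast

lemma smooth_on_compose: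
  fixes f :: "'a::real_normed_vector \<Rightarrow> 'b::euclidean_space"
  assumes "smooth_on f S" "smooth_on g T" "open S" "f ` S \<subseteq> T"
  shows "smooth_on (\<lambda>x. g (f x)) S"
  using assms Ck_on_compose unfolding smooth_on_def by blast

section \<open>Symmetry of second derivatives\<close>

lemma mixed_difference:
  fixes f :: "'a::real_normed_vector \<Rightarrow> real"
  assumes h: "0 < h"
    and dom: "\<And>s t. 0 \<le> s \<Longrightarrow> s \<le> h \<Longrightarrow> 0 \<le> t \<Longrightarrow> t \<le> h \<Longrightarrow> x + s *\<^sub>R u + t *\<^sub>R v \<in> S"
    and f: "\<And>y. y \<in> S \<Longrightarrow> f differentiable (at y)"
    and df: "\<And>y. y \<in> S \<Longrightarrow> (\<lambda>z. frechet_derivative f (at z) u) differentiable (at y)"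
  shows "\<exists>s t. 0 < s \<and> s < h \<and> 0 < t \<and> t < h \<and>
    f (x + h *\<^sub>R u + h *\<^sub>R v) - f (x + h *\<^sub>R u) - f (x + h *\<^sub>R v) + f x =
    h\<^sup>2 * frechet_derivative (\<lambda>z. frechet_derivative f (at z) u) (at (x + s *\<^sub>R u + t *\<^sub>R v)) v"
proof -
  let ?D = "\<lambda>z. frechet_derivative f (at z) u"
  have line: "DERIV (\<lambda>s. F (p + s *\<^sub>R w)) s :> frechet_derivative F (at (p + s *\<^sub>R w)) w"
    if "F differentiable (at (p + s *\<^sub>R w))" for F :: "'a \<Rightarrow> real" and p w s
  proof -
    have "((\<lambda>s. p + s *\<^sub>R w) has_derivative (\<lambda>c. c *\<^sub>R w)) (at s)"
      by (auto intro!: derivative_eq_intros)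
    from diff_chain_at[OF this, of F] that
    have "((\<lambda>s. F (p + s *\<^sub>R w)) has_derivative
      (\<lambda>c. frechet_derivative F (at (p + s *\<^sub>R w)) (c *\<^sub>R w))) (at s)"
      by (simp add: frechet_derivative_works o_def)
    then show ?thesis
      using linear_scale[OF linear_frechet_derivative[OF that]]
      by (simp add: has_field_derivative_def mult.commute[of _ "frechet_derivative F _ _"] mult_commute_abs)
  qed
  have swap: "x + s *\<^sub>R u + t *\<^sub>R v = (x + t *\<^sub>R v) + s *\<^sub>R u" for s t by simp
  \<comment> \<open>Mean value theorem in direction \<open>u\<close> for the difference of
    \<open>f\<close> along the two sides of the parallelogram; a second application, in direction
    \<open>v\<close>, is made to the derivative of \<open>f\<close> along \<open>u\<close>.\<close>
  have "\<exists>s. 0 < s \<and> s < h \<and>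
    (f (x + h *\<^sub>R v + h *\<^sub>R u) - f (x + h *\<^sub>R u)) - (f (x + h *\<^sub>R v + 0 *\<^sub>R u) - f (x + 0 *\<^sub>R u)) =
    (h - 0) * (?D (x + h *\<^sub>R v + s *\<^sub>R u) - ?D (x + s *\<^sub>R u))"
    using h dom[of _ h] dom[of _ 0] f
    by (intro MVT2 DERIV_diff line) (auto simp: swap)
  then obtain s where s: "0 < s" "s < h" and e1:
    "(f (x + h *\<^sub>R v + h *\<^sub>R u) - f (x + h *\<^sub>R u)) - (f (x + h *\<^sub>R v) - f x) =
      h * (?D (x + h *\<^sub>R v + s *\<^sub>R u) - ?D (x + s *\<^sub>R u))" by auto
  have "\<exists>t. 0 < t \<and> t < h \<and> ?D (x + s *\<^sub>R u + h *\<^sub>R v) - ?D (x + s *\<^sub>R u + 0 *\<^sub>R v) =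
    (h - 0) * frechet_derivative ?D (at (x + s *\<^sub>R u + t *\<^sub>R v)) v"
    using h dom[of s] s df by (intro MVT2 line) auto
  then obtain t where t: "0 < t" "t < h" and e2: "?D (x + s *\<^sub>R u + h *\<^sub>R v) - ?D (x + s *\<^sub>R u) =
    h * frechet_derivative ?D (at (x + s *\<^sub>R u + t *\<^sub>R v)) v" by auto
  have "f (x + h *\<^sub>R u + h *\<^sub>R v) - f (x + h *\<^sub>R u) - f (x + h *\<^sub>R v) + f x =
    h * (?D (x + h *\<^sub>R v + s *\<^sub>R u) - ?D (x + s *\<^sub>R u))"
    using e1 by (simp add: algebra_simps)
  also have "\<dots> = h\<^sup>2 * frechet_derivative ?D (at (x + s *\<^sub>R u + t *\<^sub>R v)) v"
    using e2 by (simp add: power2_eq_square add_ac)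
  finally show ?thesis using s t by blast
qed

text \<open>The second difference of \<open>f\<close> over a small parallelogram is symmetric in
  \<open>u\<close> and \<open>v\<close>, and by \<open>mixed_difference\<close> it is
  \<open>h\<^sup>2\<close> times either mixed derivative at some nearby point. Continuity of both
  mixed derivatives then compares them at \<open>x\<close>.\<close>

lemma frechet_derivative_symmetric_real:
  fixes f :: "'a::real_normed_vector \<Rightarrow> real"
  assumes S: "open S" "x \<in> S" and f: "Ck_on 2 f S"
  shows "frechet_derivative (\<lambda>z. frechet_derivative f (at z) v) (at x) u =
    frechet_derivative (\<lambda>z. frechet_derivative f (at z) u) (at x) v"
proof -
  define DD where "DD u v = (\<lambda>y. frechet_derivative (\<lambda>z. frechet_derivative f (at z) u) (at y) v)" for u v
  have d: "\<And>y. y \<in> S \<Longrightarrow> f differentiable (at y)"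
    "\<And>y u. y \<in> S \<Longrightarrow> (\<lambda>z. frechet_derivative f (at z) u) differentiable (at y)"
    "\<And>u v. continuous_on S (DD u v)"
    using f by (auto simp: numeral_2_eq_2 DD_def)
  have "\<bar>DD v u x - DD u v x\<bar> < 2 * e" if e: "e > 0" for e
  proof -
    have ct: "\<exists>r>0. \<forall>y. dist y x < r \<longrightarrow> y \<in> S \<and> dist (DD a b y) (DD a b x) < e" for a b
    proof -
      have "isCont (DD a b) x"
        using d(3) S by (simp add: continuous_on_eq_continuous_at)
      then obtain r1 where "r1 > 0" "\<forall>y. dist y x < r1 \<longrightarrow> dist (DD a b y) (DD a b x) < e"
        using continuous_at_eps_delta[THEN iffD1, rule_format, OF _ e] by blast
      moreover obtain r2 where "r2 > 0" "\<forall>y. dist y x < r2 \<longrightarrow> y \<in> S"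
        using S unfolding open_dist by blast
      ultimately show ?thesis
        by (intro exI[of _ "min r1 r2"]) auto
    qed
    obtain r1 where r1: "r1 > 0" "\<And>y. dist y x < r1 \<Longrightarrow> y \<in> S \<and> dist (DD u v y) (DD u v x) < e"
      using ct by metis
    obtain r2 where r2: "r2 > 0" "\<And>y. dist y x < r2 \<Longrightarrow> y \<in> S \<and> dist (DD v u y) (DD v u x) < e"
      using ct by metis
    define r where "r = min r1 r2"
    \<comment> \<open>The summand 1 keeps \<open>K\<close> positive even if
      \<open>u = v = 0\<close>; the side \<open>h\<close> is chosen such that the whole
      parallelogram lies in the ball of radius \<open>r\<close>.\<close>
    define K where "K = norm u + norm v + 1"
    define h where "h = r / (2 * K)"
    have den: "K > 0" using norm_ge_zero[of u] norm_ge_zero[of v] unfolding K_def by linarith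
    have h: "h > 0" using r1(1) r2(1) den by (simp add: h_def r_def)
    have near: "dist (x + s *\<^sub>R u + t *\<^sub>R v) x < r" if "0 \<le> s" "s \<le> h" "0 \<le> t" "t \<le> h" for s t
    proof -
      have "dist (x + s *\<^sub>R u + t *\<^sub>R v) x = norm (s *\<^sub>R u + t *\<^sub>R v)"
        by (simp add: dist_norm algebra_simps)
      also have "\<dots> \<le> s * norm u + t * norm v"
        using norm_triangle_ineq[of "s *\<^sub>R u" "t *\<^sub>R v"] that by simp
      also have "\<dots> \<le> h * norm u + h * norm v"
        using that by (intro add_mono mult_right_mono) auto
      also have "\<dots> = h * K - h" by (simp add: K_def algebra_simps)
      also have "\<dots> < 2 * (h * K)"
        using h mult_pos_pos[OF h den] by linarith
      also have "\<dots> = r" using den by (simp add: h_def)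
      finally show ?thesis .
    qed
    have near': "dist (x + s *\<^sub>R v + t *\<^sub>R u) x < r" if "0 \<le> s" "s \<le> h" "0 \<le> t" "t \<le> h" for s t
      using near[of t s] that by (simp add: add_ac)
    let ?E = "f (x + h *\<^sub>R u + h *\<^sub>R v) - f (x + h *\<^sub>R u) - f (x + h *\<^sub>R v) + f x"
    have sub: "y \<in> S" if "dist y x < r" for y using r1 that by (auto simp: r_def)
    obtain s t where st: "0 < s" "s < h" "0 < t" "t < h" "?E = h\<^sup>2 * DD u v (x + s *\<^sub>R u + t *\<^sub>R v)"
      using mixed_difference[OF h sub[OF near] d(1,2)] unfolding DD_def by blast
    obtain s' t' where st': "0 < s'" "s' < h" "0 < t'" "t' < h"
      "f (x + h *\<^sub>R v + h *\<^sub>R u) - f (x + h *\<^sub>R v) - f (x + h *\<^sub>R u) + f x =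
        h\<^sup>2 * DD v u (x + s' *\<^sub>R v + t' *\<^sub>R u)"
      using mixed_difference[OF h sub[OF near'] d(1,2)] unfolding DD_def by blast
    have "f (x + h *\<^sub>R v + h *\<^sub>R u) - f (x + h *\<^sub>R v) - f (x + h *\<^sub>R u) + f x = ?E"
      by (simp add: add_ac)
    then have eq: "DD u v (x + s *\<^sub>R u + t *\<^sub>R v) = DD v u (x + s' *\<^sub>R v + t' *\<^sub>R u)"
      using st(5) st'(5) h by simp
    have "dist (DD u v (x + s *\<^sub>R u + t *\<^sub>R v)) (DD u v x) < e"
      using near[of s t] st r1(2) by (auto simp: r_def)
    moreover have "dist (DD v u (x + s' *\<^sub>R v + t' *\<^sub>R u)) (DD v u x) < e"
      using near'[of s' t'] st' r2(2) by (auto simp: r_def)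
    ultimately show ?thesis
      using eq by (simp add: dist_real_def)
  qed
  \<comment> \<open>With \<open>e\<close> half the distance of the two values, the bound would say
    that this distance is less than itself.\<close>
  from this[of "\<bar>DD v u x - DD u v x\<bar> / 2"] have "DD v u x = DD u v x"
    by (cases "DD v u x = DD u v x") auto
  then show ?thesis by (simp add: DD_def)
qed

lemma frechet_derivative_symmetric:
  fixes f :: "'a::real_normed_vector \<Rightarrow> 'b::euclidean_space"
  assumes S: "open S" "x \<in> S" and f: "smooth_on f S"
  shows "frechet_derivative (\<lambda>z. frechet_derivative f (at z) v) (at x) u =
    frechet_derivative (\<lambda>z. frechet_derivative f (at z) u) (at x) v"
proof (rule euclidean_eqI)
  fix b :: 'b assume "b \<in> Basis"
  have inner: "frechet_derivative (\<lambda>z. F z \<bullet> b) (at y) w = frechet_derivative F (at y) w \<bullet> b"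
    if "F differentiable (at y)" for F :: "'a \<Rightarrow> 'b" and y w
    using fun_cong[OF frechet_derivative_at[OF
          has_derivative_inner_left[OF iffD1[OF frechet_derivative_works that]]], of w] by simp
  have 2: "frechet_derivative (\<lambda>z. frechet_derivative (\<lambda>z. f z \<bullet> b) (at z) v) (at x) u =
    frechet_derivative (\<lambda>z. frechet_derivative f (at z) v) (at x) u \<bullet> b" for u v
  proof -
    have "frechet_derivative (\<lambda>z. frechet_derivative (\<lambda>z. f z \<bullet> b) (at z) v) (at x) =
      frechet_derivative (\<lambda>z. frechet_derivative f (at z) v \<bullet> b) (at x)"
      using smooth_onD[OF f] S inner
      by (intro frechet_derivative_transform_within_open[OF _ S, symmetric]) auto
    then show ?thesis
      using inner[OF smooth_onD(2)[OF f S(2)]] by simp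
  qed
  have "Ck_on 2 (\<lambda>z. f z \<bullet> b) S"
    using f by (intro Ck_on_bounded_linear[OF S(1) bounded_linear_inner_left]) (simp add: smooth_on_def)
  from frechet_derivative_symmetric_real[OF S this, of v u] show
    "frechet_derivative (\<lambda>z. frechet_derivative f (at z) v) (at x) u \<bullet> b =
    frechet_derivative (\<lambda>z. frechet_derivative f (at z) u) (at x) v \<bullet> b"
    by (simp add: 2)
qed

section \<open>Charts and the Levi-Civita connection\<close>

text \<open>Weaker than \<open>manifold\<close>: a topological space with differentiable transition
  maps. The domain of an immersion enters in this form, and for \<open>prod_charts\<close> it
  follows from the derivative of a product of two maps.\<close>

locale chart_family =
  fixes C :: "('m::topological_space, 'e::euclidean_space) charts"
  assumes center: "p \<in> cdom C p"
    and open_cdom: "open (cdom C p)"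
    and open_crd: "open (crd C p ` cdom C p)"
    and homeo: "homeomorphism (cdom C p) (crd C p ` cdom C p) (crd C p) (cinv C p)"
    and transition: "a \<in> cdom C p \<Longrightarrow> a \<in> cdom C q \<Longrightarrow>
      (crd C q \<circ> cinv C p) differentiable (at (crd C p a))"
begin

lemma cinv_crd: "a \<in> cdom C p \<Longrightarrow> cinv C p (crd C p a) = a"
  using homeo[of p] by (simp add: homeomorphism_def)

lemma crd_cinv: "x \<in> crd C p ` cdom C p \<Longrightarrow> crd C p (cinv C p x) = x"
  using homeo[of p] by (auto simp: homeomorphism_def)

lemma cinv_in: "x \<in> crd C p ` cdom C p \<Longrightarrow> cinv C p x \<in> cdom C p"
  by (auto simp: cinv_crd)

lemma open_crd_Int:
  assumes "open V"
  shows "open (crd C p ` (cdom C p \<inter> V))"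
proof -
  have "openin (top_of_set (crd C p ` cdom C p)) (crd C p ` (cdom C p \<inter> V))"
    using assms by (intro homeomorphism_imp_open_map[OF homeo]) (auto simp: openin_open)
  then show ?thesis
    using open_crd openin_open_trans by blast
qed

lemma open_crd_vimage:
  assumes "continuous_on UNIV F" "open V"
  shows "open (crd C p ` (cdom C p \<inter> F -` V))"
  using open_crd_Int[OF open_vimage[OF assms(2,1)]] .

lemma crd_Int_iff:
  "x \<in> crd C p ` (cdom C p \<inter> V) \<longleftrightarrow> x \<in> crd C p ` cdom C p \<and> cinv C p x \<in> V"
  using cinv_crd by auto

lemma center_in: "crd C p p \<in> crd C p ` cdom C p"
  using center by blast

lemma cinv_center [simp]: "cinv C p (crd C p p) = p"
  using cinv_crd center by blast

end

lemma manifold_chart_family: "manifold C \<Longrightarrow> chart_family C"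
  unfolding manifold_def by unfold_locales (auto intro: smooth_onD(1))

section \<open>Maps in local coordinates and the chain rule\<close>

definition rep_deriv ::
  "('n, 'd::euclidean_space) charts \<Rightarrow> ('m, 'e::euclidean_space) charts \<Rightarrow> ('n \<Rightarrow> 'm) \<Rightarrow>
    'n \<Rightarrow> 'm \<Rightarrow> 'n \<Rightarrow> 'd \<Rightarrow> 'e" where
  "rep_deriv D C F p q a = frechet_derivative (crd C q \<circ> F \<circ> cinv D p) (at (crd D p a))"

definition rep_differentiable ::
  "('n::topological_space, 'd::euclidean_space) charts \<Rightarrow>
    ('m::topological_space, 'e::euclidean_space) charts \<Rightarrow> ('n \<Rightarrow> 'm) \<Rightarrow> bool" where
  "rep_differentiable D C F \<longleftrightarrow> continuous_on UNIV F \<and>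
    (\<forall>p q a. a \<in> cdom D p \<longrightarrow> F a \<in> cdom C q \<longrightarrow>
      (crd C q \<circ> F \<circ> cinv D p) differentiable (at (crd D p a)))"

lemma coord_change_eq: "coord_change C p q a = rep_deriv C C id p q a"
  by (simp add: coord_change_def rep_deriv_def fun_eq_iff)

lemma differential_eq: "differential D C F p = rep_deriv D C F p (F p) p"
  by (simp add: differential_def rep_deriv_def)

lemma (in chart_family) rep_differentiable_id: "rep_differentiable C C id"
  using transition by (auto simp: rep_differentiable_def)

lemma smooth_map_rep_differentiable: "smooth_map D C F \<Longrightarrow> rep_differentiable D C F"
  unfolding smooth_map_def rep_differentiable_def
  by (auto intro!: smooth_onD(1)[where S = "crd D _ ` _"])

text \<open>Stated for arbitrary charts around the three points. Since \<open>coord_change\<close>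
  is the case of the identity and \<open>differential\<close> the case of charts centred at the
  point and its image, it gives both the cocycle rule for coordinate changes and the passage between
  differentials and fixed charts.\<close>

lemma rep_deriv_compose:
  assumes "chart_family D" "chart_family C" "chart_family E"
    and F: "rep_differentiable D C F" and G: "rep_differentiable C E G"
    and a: "a \<in> cdom D p" "F a \<in> cdom C q" "G (F a) \<in> cdom E r"
  shows "rep_deriv D E (G \<circ> F) p r a v = rep_deriv C E G q r (F a) (rep_deriv D C F p q a v)"
proof -
  interpret D: chart_family D by fact
  interpret C: chart_family C by fact
  let ?f = "crd C q \<circ> F \<circ> cinv D p" and ?g = "crd E r \<circ> G \<circ> cinv C q"
  let ?S = "crd D p ` (cdom D p \<inter> F -` cdom C q)"
  have fa: "?f (crd D p a) = crd C q (F a)" using a by (simp add: D.cinv_crd)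
  have S: "open ?S" "crd D p a \<in> ?S"
    using a F by (auto simp: rep_differentiable_def intro!: D.open_crd_vimage C.open_cdom)
  have "(?f has_derivative rep_deriv D C F p q a) (at (crd D p a))"
    using F a by (simp add: rep_deriv_def rep_differentiable_def frechet_derivative_works[symmetric])
  moreover have "(?g has_derivative rep_deriv C E G q r (F a)) (at (?f (crd D p a)))"
    using G a fa by (simp add: rep_deriv_def rep_differentiable_def frechet_derivative_works[symmetric])
  ultimately have "(?g \<circ> ?f has_derivative rep_deriv C E G q r (F a) \<circ> rep_deriv D C F p q a)
    (at (crd D p a))"
    by (rule diff_chain_at)
  then have "(crd E r \<circ> (G \<circ> F) \<circ> cinv D p has_derivative
    rep_deriv C E G q r (F a) \<circ> rep_deriv D C F p q a) (at (crd D p a))"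
    by (rule has_derivative_transform_within_open[OF _ S])
      (auto simp: D.crd_Int_iff C.cinv_crd)
  from frechet_derivative_at[OF this] show ?thesis
    by (simp add: rep_deriv_def fun_eq_iff)
qed

lemma linear_rep_deriv:
  assumes "rep_differentiable D C F" "a \<in> cdom D p" "F a \<in> cdom C q"
  shows "linear (rep_deriv D C F p q a)"
  using assms by (auto simp: rep_deriv_def rep_differentiable_def intro: linear_frechet_derivative)

context chart_family
begin

lemma coord_change_same [simp]:
  assumes "a \<in> cdom C p"
  shows "coord_change C p p a v = v"
proof -
  have "(crd C p \<circ> cinv C p has_derivative (\<lambda>v. v)) (at (crd C p a))"
    using assms crd_cinv
    by (intro has_derivative_transform_within_open[OF has_derivative_ident open_crd[of p]]) auto
  from frechet_derivative_at[OF this] show ?thesis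
    by (simp add: coord_change_def fun_eq_iff)
qed

lemma coord_change_trans:
  assumes "a \<in> cdom C p" "a \<in> cdom C q" "a \<in> cdom C r"
  shows "coord_change C q r a (coord_change C p q a v) = coord_change C p r a v"
  using rep_deriv_compose[OF chart_family_axioms chart_family_axioms chart_family_axioms
      rep_differentiable_id rep_differentiable_id, of a p q r v] assms
  by (simp add: coord_change_eq)

lemma linear_coord_change:
  assumes "a \<in> cdom C p" "a \<in> cdom C q"
  shows "linear (coord_change C p q a)"
  using linear_rep_deriv[OF rep_differentiable_id assms(1)] assms(2) by (simp add: coord_change_eq)

lemma to_chart_coord_field [simp]:
  "a \<in> cdom C p \<Longrightarrow> to_chart C p a (coord_field C p v a) = v"
  using coord_change_trans[of a p a p] center by (simp add: to_chart_def coord_field_def)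

lemma coord_field_to_chart [simp]:
  "a \<in> cdom C p \<Longrightarrow> coord_field C p (to_chart C p a v) a = v"
  using coord_change_trans[of a a p a] center by (simp add: to_chart_def coord_field_def)

lemma coord_field_center [simp]: "coord_field C p v p = v"
  using center by (simp add: coord_field_def)

lemma to_chart_center [simp]: "to_chart C p p v = v"
  using center by (simp add: to_chart_def)

lemma linear_coord_field: "a \<in> cdom C p \<Longrightarrow> linear (\<lambda>v. coord_field C p v a)"
  using linear_coord_change center by (simp add: coord_field_def)

lemma linear_to_chart: "a \<in> cdom C p \<Longrightarrow> linear (to_chart C p a)"
  using linear_coord_change[of a a p] center unfolding to_chart_def by simp

lemma differential_id [simp]: "differential C C id p = (\<lambda>v. v)"
  using coord_change_same[OF center, of p] by (auto simp: differential_eq coord_change_eq)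

end

text \<open>The chain rule through the charts centred at \<open>a\<close> and at \<open>F a\<close>.
  It reconciles the convention that a vector at \<open>a\<close> has its coordinates in the chart
  chosen at \<open>a\<close> with differentiation, which needs charts that stay fixed while
  \<open>a\<close> moves.\<close>

lemma to_chart_differential:
  assumes D: "chart_family D" and C: "chart_family C" and F: "rep_differentiable D C F"
    and a: "a \<in> cdom D p" "F a \<in> cdom C q"
  shows "to_chart C q (F a) (differential D C F a (coord_field D p v a)) = rep_deriv D C F p q a v"
proof -
  interpret D: chart_family D by fact
  interpret C: chart_family C by fact
  have "rep_deriv D C F p q a v = rep_deriv D C F a q a (rep_deriv D D id p a a v)"
    using rep_deriv_compose[OF D D C D.rep_differentiable_id F, of a p a q v] a D.center by simp
  also have "\<dots> = rep_deriv C C id (F a) q (F a) (rep_deriv D C F a (F a) a (rep_deriv D D id p a a v))"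
    using rep_deriv_compose[OF D C C F C.rep_differentiable_id, of a a "F a" q] a D.center C.center
    by simp
  finally show ?thesis
    by (simp add: to_chart_def coord_field_def coord_change_eq differential_eq)
qed

text \<open>The condition \<open>nearly_cosymplectic\<close> speaks about smooth local fields, and
  coordinate fields are those it is applied to. In the chart at \<open>q\<close> such a field is a
  directional derivative of the transition map from \<open>p\<close>, taken along the reverse
  transition.\<close>

lemma coord_field_smooth:
  fixes C :: "('m::{t2_space, second_countable_topology}, 'e::euclidean_space) charts"
  assumes "manifold C"
  shows "smooth_vector_field_on C (cdom C p) (coord_field C p u)"
  unfolding smooth_vector_field_on_def
proof
  fix q
  interpret chart_family C using assms by (rule manifold_chart_family)
  have tr: "smooth_on (crd C q \<circ> cinv C p) (crd C p ` (cdom C p \<inter> cdom C q))" for p q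
    using assms by (simp add: manifold_def)
  let ?S = "crd C q ` (cdom C q \<inter> cdom C p)"
  have S: "open ?S" by (rule open_crd_Int[OF open_cdom])
  have "smooth_on (\<lambda>x. frechet_derivative (crd C q \<circ> cinv C p) (at ((crd C p \<circ> cinv C q) x)) u) ?S"
    using smooth_on_frechet_derivative[OF tr] S
    by (rule smooth_on_compose[OF tr]) (auto simp: cinv_crd)
  then show "smooth_on (\<lambda>x. let a = cinv C q x in to_chart C q a (coord_field C p u a)) ?S"
  proof (rule smooth_on_cong[OF _ S])
    fix x assume "x \<in> ?S"
    then have a: "cinv C q x \<in> cdom C q" "cinv C q x \<in> cdom C p"
      by (auto simp: cinv_crd)
    then show "frechet_derivative (crd C q \<circ> cinv C p) (at ((crd C p \<circ> cinv C q) x)) u =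
      (let a = cinv C q x in to_chart C q a (coord_field C p u a))"
      using coord_change_trans[of "cinv C q x" p "cinv C q x" q u] center
      by (simp add: to_chart_def coord_field_def Let_def) (simp add: coord_change_def)
  qed
qed

lemma linear_derivative_family:
  assumes S: "open S" "x0 \<in> S" and lin: "\<And>x. x \<in> S \<Longrightarrow> linear (L x)"
    and comp: "\<And>v. (\<lambda>x. L x v) differentiable (at x0)"
  shows "linear (\<lambda>v. frechet_derivative (\<lambda>x. L x v) (at x0) u)"
proof
  note d = frechet_derivative_works[THEN iffD1, OF comp]
  fix v w and c :: real
  have "((\<lambda>x. L x (v + w)) has_derivative
    (\<lambda>u. frechet_derivative (\<lambda>x. L x v) (at x0) u + frechet_derivative (\<lambda>x. L x w) (at x0) u)) (at x0)"
    by (rule has_derivative_transform_within_open[OF has_derivative_add[OF d d] S])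
      (simp add: linear_add[OF lin])
  from frechet_derivative_at[OF this, symmetric]
  show "frechet_derivative (\<lambda>x. L x (v + w)) (at x0) u =
    frechet_derivative (\<lambda>x. L x v) (at x0) u + frechet_derivative (\<lambda>x. L x w) (at x0) u" by simp
  have "((\<lambda>x. L x (c *\<^sub>R v)) has_derivative
    (\<lambda>u. c *\<^sub>R frechet_derivative (\<lambda>x. L x v) (at x0) u)) (at x0)"
    by (rule has_derivative_transform_within_open[OF has_derivative_scaleR_right[OF d] S])
      (simp add: linear_scale[OF lin])
  from frechet_derivative_at[OF this, symmetric]
  show "frechet_derivative (\<lambda>x. L x (c *\<^sub>R v)) (at x0) u =
    c *\<^sub>R frechet_derivative (\<lambda>x. L x v) (at x0) u" by simp
qed

section \<open>Existence and uniqueness of the Christoffel symbols\<close>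

locale riemannian_manifold =
  fixes C :: "('m::{t2_space, second_countable_topology}, 'e::euclidean_space) charts"
    and g :: "'m \<Rightarrow> 'e \<Rightarrow> 'e \<Rightarrow> real"
  assumes manifold: "manifold C" and metric: "riemannian_metric C g"
begin

sublocale chart_family C
  using manifold by (rule manifold_chart_family)

sublocale form: pos_def_form "g p" for p
  using metric by unfold_locales (simp add: riemannian_metric_def)

lemma metric_coords_eq:
  "metric_coords C g p v w x = g (cinv C p x) (coord_field C p v (cinv C p x)) (coord_field C p w (cinv C p x))"
  by (simp add: metric_coords_def Let_def)

lemma metric_coords_center: "metric_coords C g p v w (crd C p p) = g p v w"
  by (simp add: metric_coords_eq)

lemma metric_coords_differentiable:
  "x \<in> crd C p ` cdom C p \<Longrightarrow> metric_coords C g p v w differentiable (at x)"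
  using metric by (auto simp: riemannian_metric_def intro!: smooth_onD(1)[where S = "crd C p ` cdom C p"])

lemma metric_coords_bilinear:
  "x \<in> crd C p ` cdom C p \<Longrightarrow> bilinear (\<lambda>v w. metric_coords C g p v w x)"
  unfolding metric_coords_eq bilinear_def
  using linear_compose[OF linear_coord_field[OF cinv_in, of x p] form.linear_left]
    linear_compose[OF linear_coord_field[OF cinv_in, of x p] form.linear_right]
  by (auto simp: o_def)

lemma metric_coords_sym: "metric_coords C g p v w = metric_coords C g p w v"
  by (simp add: metric_coords_eq fun_eq_iff form.sym)

definition dmetric :: "'m \<Rightarrow> 'e \<Rightarrow> 'e \<Rightarrow> 'e \<Rightarrow> real" where
  "dmetric p u v w = frechet_derivative (metric_coords C g p v w) (at (crd C p p)) u"

lemma dmetric_linear: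
  "linear (\<lambda>u. dmetric p u v w)" "linear (\<lambda>v. dmetric p u v w)" "linear (\<lambda>w. dmetric p u v w)"
proof -
  show "linear (\<lambda>u. dmetric p u v w)"
    unfolding dmetric_def by (intro linear_frechet_derivative metric_coords_differentiable center_in)
  show "linear (\<lambda>v. dmetric p u v w)"
    unfolding dmetric_def
    by (rule linear_derivative_family[OF open_crd center_in])
      (use metric_coords_bilinear metric_coords_differentiable[OF center_in] in \<open>auto simp: bilinear_def\<close>)
  show "linear (\<lambda>w. dmetric p u v w)"
    unfolding dmetric_def
    by (rule linear_derivative_family[OF open_crd center_in])
      (use metric_coords_bilinear metric_coords_differentiable[OF center_in] in \<open>auto simp: bilinear_def\<close>)
qed

lemma dmetric_sym: "dmetric p u v w = dmetric p u w v"
  by (simp add: dmetric_def metric_coords_sym[of p v w])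

abbreviation Gam :: "'m \<Rightarrow> 'e \<Rightarrow> 'e \<Rightarrow> 'e" where
  "Gam p \<equiv> christoffel C g p"

lemma christoffel_ex1:
  "\<exists>!\<Gamma>. bilinear \<Gamma> \<and> (\<forall>u v. \<Gamma> u v = \<Gamma> v u) \<and>
     (\<forall>u v w. dmetric p u v w = g p (\<Gamma> u v) w + g p v (\<Gamma> u w))"
proof -
  \<comment> \<open>Koszul's expression for commuting fields. The three cyclic instances of metric
    compatibility, with symmetry, force \<open>g p (\<Gamma> u v) w = K u v w\<close>, which gives
    uniqueness; conversely \<open>riesz\<close> turns \<open>K\<close> into a vector.\<close>
  define K where "K u v w = (dmetric p u v w + dmetric p v u w - dmetric p w u v) / 2" for u v w
  have K: "linear (\<lambda>u. K u v w)" "linear (\<lambda>v. K u v w)" "linear (\<lambda>w. K u v w)" for u v w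
    unfolding K_def
    by (auto intro!: linearI simp: linear_add[OF dmetric_linear(1)] linear_scale[OF dmetric_linear(1)]
        linear_add[OF dmetric_linear(2)] linear_scale[OF dmetric_linear(2)]
        linear_add[OF dmetric_linear(3)] linear_scale[OF dmetric_linear(3)]
        algebra_simps add_divide_distrib diff_divide_distrib)
  define \<Gamma> where "\<Gamma> u v = (THE x. \<forall>w. g p x w = K u v w)" for u v
  have \<Gamma>: "g p (\<Gamma> u v) w = K u v w" for u v w
    using theI'[OF form.riesz[OF K(3), of p u v]] unfolding \<Gamma>_def by blast
  have lin: "linear (\<Gamma> u)" "linear (\<lambda>u. \<Gamma> u v)" for u v
    by (auto intro!: linearI form.eqI[of p]
        simp: \<Gamma> form.linear_simps linear_add[OF K(1)] linear_add[OF K(2)] linear_scale[OF K(1)] linear_scale[OF K(2)])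
  have sym: "\<Gamma> u v = \<Gamma> v u" for u v
    by (rule form.eqI[of p]) (simp add: \<Gamma> K_def dmetric_sym[of p _ u v])
  have compat: "dmetric p u v w = g p (\<Gamma> u v) w + g p v (\<Gamma> u w)" for u v w
    using dmetric_sym[of p u v w] dmetric_sym[of p v u w] dmetric_sym[of p w u v]
    by (simp add: \<Gamma> form.sym[of p v] K_def field_simps)
  show ?thesis
  proof (rule ex1I[of _ \<Gamma>])
    show "bilinear \<Gamma> \<and> (\<forall>u v. \<Gamma> u v = \<Gamma> v u) \<and>
      (\<forall>u v w. dmetric p u v w = g p (\<Gamma> u v) w + g p v (\<Gamma> u w))"
      using lin sym compat by (auto simp: bilinear_def)
  next
    fix \<Gamma>' assume *: "bilinear \<Gamma>' \<and> (\<forall>u v. \<Gamma>' u v = \<Gamma>' v u) \<and>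
      (\<forall>u v w. dmetric p u v w = g p (\<Gamma>' u v) w + g p v (\<Gamma>' u w))"
    have "g p (\<Gamma>' u v) w = K u v w" for u v w
    proof -
      have "dmetric p u v w = g p (\<Gamma>' u v) w + g p (\<Gamma>' u w) v"
        "dmetric p v u w = g p (\<Gamma>' u v) w + g p (\<Gamma>' v w) u"
        "dmetric p w u v = g p (\<Gamma>' u w) v + g p (\<Gamma>' v w) u"
        using * by (metis form.sym)+
      then show ?thesis by (simp add: K_def)
    qed
    then show "\<Gamma>' = \<Gamma>"
      by (intro ext form.eqI[of p]) (simp add: \<Gamma>)
  qed
qed

lemma christoffel:
  "bilinear (Gam p)" "Gam p u v = Gam p v u"
  "dmetric p u v w = g p (Gam p u v) w + g p v (Gam p u w)"
proof -
  have *: "bilinear (Gam p) \<and> (\<forall>u v. Gam p u v = Gam p v u) \<and>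
     (\<forall>u v w. dmetric p u v w = g p (Gam p u v) w + g p v (Gam p u w))"
    using theI'[OF christoffel_ex1[of p]] unfolding christoffel_def dmetric_def .
  then show "bilinear (Gam p)" "Gam p u v = Gam p v u"
    "dmetric p u v w = g p (Gam p u v) w + g p v (Gam p u w)" by blast+
qed

end

section \<open>The covariant derivative of the structure tensor\<close>

locale nearly_cosymplectic_manifold =
  fixes C :: "('m::{t2_space, second_countable_topology}, 'e::euclidean_space) charts"
    and \<phi> :: "'m \<Rightarrow> 'e \<Rightarrow> 'e" and \<xi> :: "'m \<Rightarrow> 'e" and \<eta> :: "'m \<Rightarrow> 'e \<Rightarrow> real"
    and g :: "'m \<Rightarrow> 'e \<Rightarrow> 'e \<Rightarrow> real"
  assumes nearly_cosymplectic: "nearly_cosymplectic C \<phi> \<xi> \<eta> g"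
begin

lemma acm: "almost_contact_metric C \<phi> \<xi> \<eta> g"
  using nearly_cosymplectic by (simp add: nearly_cosymplectic_def)

sublocale riemannian_manifold C g
  using acm by unfold_locales (auto simp: almost_contact_metric_def)

lemma phi_phi: "\<phi> p (\<phi> p X) = - X + \<eta> p X *\<^sub>R \<xi> p"
  and phi_xi [simp]: "\<phi> p (\<xi> p) = 0"
  and eta_phi [simp]: "\<eta> p (\<phi> p X) = 0"
  and eta_xi [simp]: "\<eta> p (\<xi> p) = 1"
  and eta_eq: "\<eta> p X = g p X (\<xi> p)"
  and metric_phi_phi: "g p (\<phi> p X) (\<phi> p Y) = g p X Y - \<eta> p X * \<eta> p Y"
  using acm unfolding almost_contact_metric_def by blast+

lemma linear_phi: "linear (\<phi> p)" and linear_eta: "linear (\<eta> p)"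
  using acm by (auto simp: almost_contact_metric_def smooth_endomorphism_def smooth_one_form_def)

lemma phi_skew: "g p (\<phi> p X) Y = - g p X (\<phi> p Y)"
  using metric_phi_phi[of p X "\<phi> p Y"] eta_phi[of p X]
  by (simp add: phi_phi form.linear_simps eta_eq[of p "\<phi> p X", symmetric])

section \<open>The structure tensors in a fixed chart\<close>

definition phi_coords :: "'m \<Rightarrow> 'e \<Rightarrow> 'e \<Rightarrow> 'e" where
  "phi_coords p x v = (let a = cinv C p x in to_chart C p a (\<phi> a (coord_field C p v a)))"

definition eta_coords :: "'m \<Rightarrow> 'e \<Rightarrow> 'e \<Rightarrow> real" where
  "eta_coords p x v = (let a = cinv C p x in \<eta> a (coord_field C p v a))"

lemma phi_coords_center [simp]: "phi_coords p (crd C p p) v = \<phi> p v"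
  and eta_coords_center [simp]: "eta_coords p (crd C p p) v = \<eta> p v"
  by (simp_all add: phi_coords_def eta_coords_def)

lemma phi_coords_differentiable: "(\<lambda>x. phi_coords p x v) differentiable (at (crd C p p))"
  using acm unfolding almost_contact_metric_def smooth_endomorphism_def phi_coords_def
  by (intro smooth_onD(1)[OF _ center_in]) blast

lemma eta_coords_differentiable: "(\<lambda>x. eta_coords p x v) differentiable (at (crd C p p))"
  using acm unfolding almost_contact_metric_def smooth_one_form_def eta_coords_def
  by (intro smooth_onD(1)[OF _ center_in]) blast

lemma linear_phi_coords: "x \<in> crd C p ` cdom C p \<Longrightarrow> linear (phi_coords p x)"
  using linear_compose[OF linear_compose[OF linear_coord_field[OF cinv_in] linear_phi] linear_to_chart[OF cinv_in]]
  by (simp add: phi_coords_def[abs_def] o_def Let_def)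

lemma linear_eta_coords: "x \<in> crd C p ` cdom C p \<Longrightarrow> linear (eta_coords p x)"
  using linear_compose[OF linear_coord_field[OF cinv_in] linear_eta]
  by (simp add: eta_coords_def[abs_def] o_def Let_def)

lemma coord_field_phi_coords:
  "x \<in> crd C p ` cdom C p \<Longrightarrow>
    coord_field C p (phi_coords p x v) (cinv C p x) = \<phi> (cinv C p x) (coord_field C p v (cinv C p x))"
  by (simp add: phi_coords_def Let_def cinv_in)

text \<open>\<open>nabla_phi p U V\<close> is the value at \<open>p\<close> of \<open>(\<nabla>\<^sub>U \<phi>) V\<close>.\<close>

definition nabla_phi :: "'m \<Rightarrow> 'e \<Rightarrow> 'e \<Rightarrow> 'e" where
  "nabla_phi p U V = frechet_derivative (\<lambda>x. phi_coords p x V) (at (crd C p p)) U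
     + Gam p U (\<phi> p V) - \<phi> p (Gam p U V)"

text \<open>Despite the name not the exterior derivative of \<open>\<eta>\<close>, but the
  coordinate derivative of its components; subtracting \<open>\<eta> p (Gam p U V)\<close> gives its
  covariant derivative.\<close>

definition deta :: "'m \<Rightarrow> 'e \<Rightarrow> 'e \<Rightarrow> real" where
  "deta p U V = frechet_derivative (\<lambda>x. eta_coords p x V) (at (crd C p p)) U"

lemma cov_deriv_endo_coord_field:
  "cov_deriv_endo C g \<phi> (coord_field C p U) (coord_field C p V) p = nabla_phi p U V"
proof -
  have "((\<lambda>x. let a = cinv C p x in to_chart C p (id a) (coord_field C p V a)) has_derivative (\<lambda>u. 0))
    (at (crd C p p))"
    by (rule has_derivative_transform_within_open[OF has_derivative_const[of V] open_crd center_in])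
      (simp add: cinv_in Let_def)
  from frechet_derivative_at[OF this, symmetric] show ?thesis
    by (simp add: cov_deriv_endo_def cov_deriv_def cov_deriv_along_def nabla_phi_def phi_coords_def[abs_def])
qed

lemma nabla_phi_skew1: "nabla_phi p U V = - nabla_phi p V U"
proof -
  have "cov_deriv_endo C g \<phi> (coord_field C p U) (coord_field C p V) p +
    cov_deriv_endo C g \<phi> (coord_field C p V) (coord_field C p U) p = 0"
    using nearly_cosymplectic open_cdom[of p] coord_field_smooth[OF manifold, of p] center[of p]
    unfolding nearly_cosymplectic_def by blast
  then show ?thesis
    by (simp add: cov_deriv_endo_coord_field eq_neg_iff_add_eq_0)
qed

text \<open>The derivative of the metric components splits by \<open>christoffel(3)\<close> into two
  terms, one of which completes each of \<open>a'\<close> and \<open>b'\<close> to a covariant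
  derivative.\<close>

lemma metric_deriv:
  assumes a: "(a has_derivative a') (at (crd C p p))" and b: "(b has_derivative b') (at (crd C p p))"
  shows "((\<lambda>x. metric_coords C g p (a x) (b x) x) has_derivative
    (\<lambda>U. g p (a' U + Gam p U (a (crd C p p))) (b (crd C p p)) +
         g p (a (crd C p p)) (b' U + Gam p U (b (crd C p p))))) (at (crd C p p))"
proof -
  let ?x = "crd C p p"
  have "((\<lambda>x. metric_coords C g p (a x) (b x) x) has_derivative
    (\<lambda>u. dmetric p u (a ?x) (b ?x) + g p (a' u) (b ?x) + g p (a ?x) (b' u))) (at ?x)"
    using has_derivative_bilinear_family[OF open_crd center_in, of p "\<lambda>x v w. metric_coords C g p v w x", OF metric_coords_bilinear _ a b]
      metric_coords_differentiable[OF center_in]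
    by (simp add: metric_coords_center dmetric_def)
  moreover have "(\<lambda>u. dmetric p u (a ?x) (b ?x) + g p (a' u) (b ?x) + g p (a ?x) (b' u)) =
    (\<lambda>U. g p (a' U + Gam p U (a ?x)) (b ?x) + g p (a ?x) (b' U + Gam p U (b ?x)))"
    by (rule ext) (simp add: christoffel(3) form.linear_simps)
  ultimately show ?thesis by simp
qed

lemma phi_coords_deriv:
  "((\<lambda>x. phi_coords p x v) has_derivative
    (\<lambda>U. nabla_phi p U v + \<phi> p (Gam p U v) - Gam p U (\<phi> p v))) (at (crd C p p))"
  using frechet_derivative_works[THEN iffD1, OF phi_coords_differentiable]
  by (simp add: nabla_phi_def)

text \<open>Differentiating the skewness of \<open>\<phi>\<close> with a parallel metric. Together
  with \<open>nabla_phi_skew1\<close>, which is the nearly cosymplectic condition on coordinate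
  fields, this makes \<open>g p (nabla_phi p U V) W\<close> alternating in all three
  arguments.\<close>

lemma nabla_phi_skew2: "g p (nabla_phi p U V) W = - g p V (nabla_phi p U W)"
proof -
  note 1 = metric_deriv[OF phi_coords_deriv has_derivative_const, of p V W]
    and 2 = metric_deriv[OF has_derivative_const phi_coords_deriv, of p V W]
  have "((\<lambda>x. metric_coords C g p (phi_coords p x V) W x + metric_coords C g p V (phi_coords p x W) x)
    has_derivative (\<lambda>U. 0)) (at (crd C p p))"
    by (rule has_derivative_transform_within_open[OF has_derivative_const[of 0] open_crd center_in])
      (simp add: metric_coords_eq coord_field_phi_coords phi_skew)
  from fun_cong[OF has_derivative_unique[OF this has_derivative_add[OF 1 2]], of U] show ?thesis
    by (simp add: form.linear_simps phi_skew)
qed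

text \<open>Derivative of the compatibility \<open>metric_phi_phi\<close>, computed on both sides.
  The cases \<open>W = V\<close> and \<open>W = \<xi> p\<close> below are the two ingredients of
  \<open>dlnf_xi\<close>.\<close>

lemma nabla_phi_polar:
  "g p (nabla_phi p U V) (\<phi> p W) + g p (\<phi> p V) (nabla_phi p U W) =
    \<eta> p (Gam p U V) * \<eta> p W + \<eta> p V * \<eta> p (Gam p U W) - deta p U V * \<eta> p W - \<eta> p V * deta p U W"
proof -
  note 1 = metric_deriv[OF phi_coords_deriv phi_coords_deriv, of p V W]
    and 2 = metric_deriv[OF has_derivative_const has_derivative_const, of p V W]
    and d = eta_coords_differentiable[THEN frechet_derivative_works[THEN iffD1]]
  have 3: "((\<lambda>x. metric_coords C g p V W x - eta_coords p x V * eta_coords p x W) has_derivative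
    (\<lambda>U. g p (0 + Gam p U V) W + g p V (0 + Gam p U W) - (\<eta> p V * deta p U W + deta p U V * \<eta> p W)))
    (at (crd C p p))"
    unfolding deta_def by (rule has_derivative_diff[OF 2 has_derivative_mult[OF d d, simplified]])
  have 4: "((\<lambda>x. metric_coords C g p (phi_coords p x V) (phi_coords p x W) x) has_derivative
    (\<lambda>U. g p (0 + Gam p U V) W + g p V (0 + Gam p U W) - (\<eta> p V * deta p U W + deta p U V * \<eta> p W)))
    (at (crd C p p))"
    by (rule has_derivative_transform_within_open[OF 3 open_crd center_in])
      (simp add: metric_coords_eq coord_field_phi_coords metric_phi_phi eta_coords_def Let_def)
  from fun_cong[OF has_derivative_unique[OF 4 1], of U] show ?thesis
    by (simp add: form.linear_simps metric_phi_phi algebra_simps)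
qed

lemma nabla_phi_ortho: "\<eta> p Z = 0 \<Longrightarrow> g p (nabla_phi p U Z) (\<phi> p Z) = 0"
  using nabla_phi_polar[of p U Z Z] form.sym[of p "\<phi> p Z"] by simp

lemma nabla_phi_xi:
  "\<eta> p Z = 0 \<Longrightarrow> g p (nabla_phi p U (\<xi> p)) (\<phi> p Z) = \<eta> p (Gam p U Z) - deta p U Z"
  using nabla_phi_polar[of p U Z "\<xi> p"] form.sym[of p "\<phi> p Z"] by (simp add: form.linear_simps)

end

section \<open>Immersions in coordinates\<close>

locale immersed_submanifold =
  nearly_cosymplectic_manifold C \<phi> \<xi> \<eta> g + D: chart_family D
  for C :: "('m::{t2_space, second_countable_topology}, 'e::euclidean_space) charts"
    and \<phi> \<xi> \<eta> g and D :: "('n::topological_space, 'd::euclidean_space) charts" +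
  fixes F :: "'n \<Rightarrow> 'm"
  assumes immersion: "immersion D C F"
begin

lemma smooth_map: "smooth_map D C F"
  using immersion by (simp add: immersion_def)

lemma rep_differentiable: "rep_differentiable D C F"
  using smooth_map by (rule smooth_map_rep_differentiable)

abbreviation dF :: "'n \<Rightarrow> 'd \<Rightarrow> 'e" where
  "dF p \<equiv> differential D C F p"

lemma linear_dF: "linear (dF p)"
  unfolding differential_eq by (rule linear_rep_deriv[OF rep_differentiable D.center center])

lemma inj_dF: "inj (dF p)"
  using immersion by (simp add: immersion_def)

definition rep :: "'n \<Rightarrow> 'd \<Rightarrow> 'e" where
  "rep p = crd C (F p) \<circ> F \<circ> cinv D p"

definition rep_dom :: "'n \<Rightarrow> 'd set" where
  "rep_dom p = crd D p ` (cdom D p \<inter> F -` cdom C (F p))"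

lemma rep_smooth: "smooth_on (rep p) (rep_dom p)"
  using smooth_map by (simp add: smooth_map_def rep_def rep_dom_def)

lemma open_rep_dom: "open (rep_dom p)"
  using smooth_map unfolding rep_dom_def smooth_map_def by (intro D.open_crd_vimage open_cdom) auto

lemma center_rep_dom: "crd D p p \<in> rep_dom p"
  using D.center center by (auto simp: rep_dom_def)

lemma rep_center [simp]: "rep p (crd D p p) = crd C (F p) (F p)"
  by (simp add: rep_def)

lemma rep_domD:
  assumes "z \<in> rep_dom p"
  shows "cinv D p z \<in> cdom D p" "F (cinv D p z) \<in> cdom C (F p)"
    "crd D p (cinv D p z) = z" "rep p z \<in> crd C (F p) ` cdom C (F p)"
    "cinv C (F p) (rep p z) = F (cinv D p z)"
  using assms by (auto simp: rep_dom_def rep_def D.cinv_crd cinv_crd)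

abbreviation drep :: "'n \<Rightarrow> 'd \<Rightarrow> 'd \<Rightarrow> 'e" where
  "drep p z v \<equiv> frechet_derivative (rep p) (at z) v"

lemma drep_center [simp]: "drep p (crd D p p) = dF p"
  by (simp add: rep_def differential_def)

lemma coord_field_drep:
  assumes "z \<in> rep_dom p"
  shows "coord_field C (F p) (drep p z v) (F (cinv D p z)) =
    dF (cinv D p z) (coord_field D p v (cinv D p z))"
proof -
  note z = rep_domD[OF assms]
  have "drep p z v = rep_deriv D C F p (F p) (cinv D p z) v"
    using z(3) by (simp add: rep_deriv_def rep_def)
  also have "\<dots> = to_chart C (F p) (F (cinv D p z)) (dF (cinv D p z) (coord_field D p v (cinv D p z)))"
    using to_chart_differential[OF D.chart_family_axioms chart_family_axioms rep_differentiable z(1,2)]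
    by simp
  finally show ?thesis using z(2) by simp
qed

lemma coord_field_phi_rep:
  assumes "z \<in> rep_dom p"
  shows "coord_field C (F p) (phi_coords (F p) (rep p z) v) (F (cinv D p z)) =
    \<phi> (F (cinv D p z)) (coord_field C (F p) v (F (cinv D p z)))"
  using coord_field_phi_coords[OF rep_domD(4)[OF assms]] by (simp add: rep_domD(5)[OF assms])

text \<open>\<open>cov p u v\<close> is the ambient covariant derivative, in direction \<open>u\<close>, of the coordinate
  field \<open>v\<close> of the submanifold.\<close>

definition cov :: "'n \<Rightarrow> 'd \<Rightarrow> 'd \<Rightarrow> 'e" where
  "cov p u v = frechet_derivative (\<lambda>z. drep p z v) (at (crd D p p)) u + Gam (F p) (dF p u) (dF p v)"

lemma drep_deriv:
  "((\<lambda>z. drep p z v) has_derivative (\<lambda>u. cov p u v - Gam (F p) (dF p u) (dF p v))) (at (crd D p p))"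
  using smooth_onD(2)[OF rep_smooth center_rep_dom]
  by (simp add: cov_def frechet_derivative_works[symmetric])

text \<open>Vanishing torsion along the submanifold: second derivatives of the local representative
  commute and the Christoffel symbols are symmetric.\<close>

lemma cov_sym: "cov p u v = cov p v u"
  unfolding cov_def
  using frechet_derivative_symmetric[OF open_rep_dom center_rep_dom rep_smooth, of p v u] christoffel(2)
  by simp

lemma linear_cov1: "linear (\<lambda>u. cov p u v)"
proof -
  have "linear (frechet_derivative (\<lambda>z. drep p z v) (at (crd D p p)))"
    by (intro linear_frechet_derivative smooth_onD(2)[OF rep_smooth center_rep_dom])
  moreover have "linear (\<lambda>u. Gam (F p) (dF p u) (dF p v))"
    using linear_compose[OF linear_dF, of "\<lambda>x. Gam (F p) x (dF p v)"] christoffel(1)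
    by (auto simp: bilinear_def o_def)
  ultimately show ?thesis
    unfolding cov_def by (rule linear_compose_add)
qed

lemma linear_cov2: "linear (cov p u)"
  using linear_cov1 cov_sym[of p u] by (metis (no_types, lifting) ext)

lemma tangent_image_subspace: "subspace (tangent_image D C F p)"
  unfolding tangent_image_def by (rule linear_subspace_image[OF linear_dF subspace_UNIV])

lemma second_fundamental_form_eq:
  "second_fundamental_form D C g F p u v = normal_part (g (F p)) (tangent_image D C F p) (cov p u v)"
proof -
  have "((\<lambda>x. let a = cinv D p x in to_chart C (F p) (F a) (dF a (coord_field D p v a)))
    has_derivative (\<lambda>u. cov p u v - Gam (F p) (dF p u) (dF p v))) (at (crd D p p))"
    by (rule has_derivative_transform_within_open[OF drep_deriv open_rep_dom center_rep_dom])
      (simp add: Let_def coord_field_drep[symmetric] rep_domD)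
  from frechet_derivative_at[OF this, symmetric] show ?thesis
    by (simp add: second_fundamental_form_def cov_deriv_along_def)
qed

lemma linear_second_fundamental_form:
  "linear (\<lambda>u. second_fundamental_form D C g F p u v)" "linear (second_fundamental_form D C g F p u)"
  unfolding second_fundamental_form_eq[abs_def]
  using linear_compose[OF linear_cov1 form.linear_normal_part[OF tangent_image_subspace]]
    linear_compose[OF linear_cov2 form.linear_normal_part[OF tangent_image_subspace]]
  by (simp_all add: o_def)

lemma rep_differentiable_center: "rep p differentiable (at (crd D p p))"
  by (rule smooth_onD(1)[OF rep_smooth center_rep_dom])

lemma metric_deriv_along:
  assumes a: "(a has_derivative a') (at (crd D p p))" and b: "(b has_derivative b') (at (crd D p p))"
  shows "((\<lambda>z. metric_coords C g (F p) (a z) (b z) (rep p z)) has_derivative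
    (\<lambda>u. g (F p) (a' u + Gam (F p) (dF p u) (a (crd D p p))) (b (crd D p p)) +
         g (F p) (a (crd D p p)) (b' u + Gam (F p) (dF p u) (b (crd D p p))))) (at (crd D p p))"
proof -
  let ?x = "crd D p p"
  have d: "metric_coords C g (F p) v w differentiable (at (rep p ?x))" for v w
    using metric_coords_differentiable[OF center_in] by simp
  have eq: "frechet_derivative (\<lambda>z. metric_coords C g (F p) v w (rep p z)) (at ?x) u =
    dmetric (F p) (dF p u) v w" for u v w
    using frechet_derivative_compose[OF rep_differentiable_center d, of v w]
    by (simp add: o_def dmetric_def)
  have "((\<lambda>z. metric_coords C g (F p) (a z) (b z) (rep p z)) has_derivative
    (\<lambda>u. frechet_derivative (\<lambda>z. metric_coords C g (F p) (a ?x) (b ?x) (rep p z)) (at ?x) u +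
      metric_coords C g (F p) (a' u) (b ?x) (rep p ?x) + metric_coords C g (F p) (a ?x) (b' u) (rep p ?x)))
      (at ?x)"
    using differentiable_chain_at[OF rep_differentiable_center d]
    by (intro has_derivative_bilinear_family[OF open_rep_dom center_rep_dom _ _ a b] metric_coords_bilinear)
      (auto simp: rep_domD o_def)
  moreover have "(\<lambda>u. dmetric (F p) (dF p u) (a ?x) (b ?x) + g (F p) (a' u) (b ?x) + g (F p) (a ?x) (b' u)) =
    (\<lambda>u. g (F p) (a' u + Gam (F p) (dF p u) (a ?x)) (b ?x) + g (F p) (a ?x) (b' u + Gam (F p) (dF p u) (b ?x)))"
    by (rule ext) (simp add: christoffel(3) form.linear_simps)
  ultimately show ?thesis by (simp add: eq metric_coords_center)
qed

text \<open>The Christoffel term is left standing with a minus sign, as in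
  \<open>drep_deriv\<close>, because \<open>metric_deriv_along\<close> adds exactly this term and
  the two cancel.\<close>

lemma phi_deriv_along:
  "((\<lambda>z. phi_coords (F p) (rep p z) (drep p z v)) has_derivative
    (\<lambda>u. nabla_phi (F p) (dF p u) (dF p v) + \<phi> (F p) (cov p u v) - Gam (F p) (dF p u) (\<phi> (F p) (dF p v))))
    (at (crd D p p))"
proof -
  let ?x = "crd D p p"
  have d: "(\<lambda>x. phi_coords (F p) x w) differentiable (at (rep p ?x))" for w
    using phi_coords_differentiable by simp
  have eq: "frechet_derivative (\<lambda>z. phi_coords (F p) (rep p z) w) (at ?x) u =
    nabla_phi (F p) (dF p u) w + \<phi> (F p) (Gam (F p) (dF p u) w) - Gam (F p) (dF p u) (\<phi> (F p) w)" for u w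
    using frechet_derivative_compose[OF rep_differentiable_center d, of w]
      frechet_derivative_at[OF phi_coords_deriv, of "F p" w]
    by (simp add: o_def nabla_phi_def)
  have "((\<lambda>z. phi_coords (F p) (rep p z) (drep p z v)) has_derivative
    (\<lambda>u. frechet_derivative (\<lambda>z. phi_coords (F p) (rep p z) (drep p ?x v)) (at ?x) u +
      phi_coords (F p) (rep p ?x) (cov p u v - Gam (F p) (dF p u) (dF p v)))) (at ?x)"
    using differentiable_chain_at[OF rep_differentiable_center d]
    by (intro has_derivative_linear_family[OF open_rep_dom center_rep_dom _ _ drep_deriv] linear_phi_coords)
      (auto simp: rep_domD o_def)
  then show ?thesis
    by (simp add: eq linear_diff[OF linear_phi] algebra_simps)
qed

lemma induced_metric_deriv:
  "(metric_coords D (induced_metric D C g F) p v w has_derivative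
    (\<lambda>u. g (F p) (cov p u v) (dF p w) + g (F p) (dF p v) (cov p u w))) (at (crd D p p))"
proof -
  have "((\<lambda>z. metric_coords C g (F p) (drep p z v) (drep p z w) (rep p z)) has_derivative
    (\<lambda>u. g (F p) (cov p u v) (dF p w) + g (F p) (dF p v) (cov p u w))) (at (crd D p p))"
    using metric_deriv_along[OF drep_deriv drep_deriv, of p v w] by simp
  then show ?thesis
    by (rule has_derivative_transform_within_open[OF _ open_rep_dom center_rep_dom])
      (simp add: metric_coords_eq coord_field_drep rep_domD induced_metric_def metric_coords_def Let_def)
qed

text \<open>Components of the pulled back fundamental 2-form g(\<phi> ., .) along two coordinate
  fields, as a function of the coordinates \<open>z\<close>.\<close>

definition omega_coords :: "'n \<Rightarrow> 'd \<Rightarrow> 'd \<Rightarrow> 'd \<Rightarrow> real" where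
  "omega_coords p v w z = (let a = cinv D p z in
     g (F a) (\<phi> (F a) (dF a (coord_field D p v a))) (dF a (coord_field D p w a)))"

lemma omega_deriv:
  "(omega_coords p v w has_derivative
    (\<lambda>u. g (F p) (nabla_phi (F p) (dF p u) (dF p v)) (dF p w) - g (F p) (cov p u v) (\<phi> (F p) (dF p w))
       + g (F p) (\<phi> (F p) (dF p v)) (cov p u w))) (at (crd D p p))"
proof -
  have "((\<lambda>z. metric_coords C g (F p) (phi_coords (F p) (rep p z) (drep p z v)) (drep p z w) (rep p z))
    has_derivative (\<lambda>u. g (F p) (nabla_phi (F p) (dF p u) (dF p v)) (dF p w)
       - g (F p) (cov p u v) (\<phi> (F p) (dF p w))
       + g (F p) (\<phi> (F p) (dF p v)) (cov p u w))) (at (crd D p p))"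
    using metric_deriv_along[OF phi_deriv_along drep_deriv, of p v w]
    by (simp add: form.linear_simps phi_skew)
  then show ?thesis
    by (rule has_derivative_transform_within_open[OF _ open_rep_dom center_rep_dom])
      (simp add: metric_coords_eq omega_coords_def coord_field_drep coord_field_phi_rep rep_domD Let_def)
qed

lemma eta_deriv_along:
  "((\<lambda>z. let a = cinv D p z in \<eta> (F a) (dF a (coord_field D p v a))) has_derivative
    (\<lambda>u. deta (F p) (dF p u) (dF p v) + \<eta> (F p) (cov p u v) - \<eta> (F p) (Gam (F p) (dF p u) (dF p v))))
    (at (crd D p p))"
proof -
  let ?x = "crd D p p"
  have d: "(\<lambda>x. eta_coords (F p) x w) differentiable (at (rep p ?x))" for w
    using eta_coords_differentiable by simp
  have eq: "frechet_derivative (\<lambda>z. eta_coords (F p) (rep p z) w) (at ?x) u = deta (F p) (dF p u) w" for u w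
    using frechet_derivative_compose[OF rep_differentiable_center d, of w]
    by (simp add: o_def deta_def)
  have "((\<lambda>z. eta_coords (F p) (rep p z) (drep p z v)) has_derivative
    (\<lambda>u. frechet_derivative (\<lambda>z. eta_coords (F p) (rep p z) (drep p ?x v)) (at ?x) u +
      eta_coords (F p) (rep p ?x) (cov p u v - Gam (F p) (dF p u) (dF p v)))) (at ?x)"
    using differentiable_chain_at[OF rep_differentiable_center d]
    by (intro has_derivative_linear_family[OF open_rep_dom center_rep_dom _ _ drep_deriv] linear_eta_coords)
      (auto simp: rep_domD o_def)
  then have "((\<lambda>z. eta_coords (F p) (rep p z) (drep p z v)) has_derivative
    (\<lambda>u. deta (F p) (dF p u) (dF p v) + \<eta> (F p) (cov p u v) - \<eta> (F p) (Gam (F p) (dF p u) (dF p v)))) (at ?x)"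
    by (simp add: eq linear_diff[OF linear_eta] algebra_simps)
  then show ?thesis
    by (rule has_derivative_transform_within_open[OF _ open_rep_dom center_rep_dom])
      (simp add: eta_coords_def coord_field_drep rep_domD Let_def)
qed

text \<open>Three instances of \<open>induced_metric_deriv\<close> combined; coordinate fields
  commute, so \<open>cov_sym\<close> leaves no bracket terms. The ambient derivative
  \<open>cov\<close> may stand on the left because it is only tested against tangent
  vectors.\<close>

lemma koszul:
  "2 * g (F p) (cov p u v) (dF p w) =
    frechet_derivative (metric_coords D (induced_metric D C g F) p v w) (at (crd D p p)) u +
    frechet_derivative (metric_coords D (induced_metric D C g F) p u w) (at (crd D p p)) v -
    frechet_derivative (metric_coords D (induced_metric D C g F) p u v) (at (crd D p p)) w"
  unfolding frechet_derivative_at[OF induced_metric_deriv, symmetric]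
  by (simp add: cov_sym[of p v u] cov_sym[of p w u] cov_sym[of p w v] form.sym[of _ "dF p _"])

end

section \<open>Partial maps and product charts\<close>

lemma smooth_on_affine:
  assumes "open S" "\<And>x. (f has_derivative f') (at x)"
  shows "smooth_on f S"
  unfolding smooth_on_def
proof
  fix k show "Ck_on k f S"
  proof (cases k)
    case 0
    then show ?thesis
      using assms(2) by (auto intro!: continuous_at_imp_continuous_on has_derivative_continuous)
  next
    case (Suc k)
    then show ?thesis
      using Ck_on_SucI[OF assms Ck_on_const] by simp
  qed
qed

context immersed_submanifold
begin

text \<open>Treats both partial maps of an immersion of a product at once: \<open>j\<close> freezes
  one factor, and in the charts centred at \<open>a\<close> and \<open>j a\<close> it is affine with
  linear part \<open>J\<close>.\<close>

context
  fixes E :: "('k::topological_space, 'l::euclidean_space) charts" and j :: "'k \<Rightarrow> 'n" and J :: "'l \<Rightarrow> 'd"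
  assumes E: "chart_family E" and J: "linear J" "inj J" and j: "continuous_on UNIV j"
    and dom: "\<And>a b. b \<in> cdom E a \<Longrightarrow> j b \<in> cdom D (j a)"
    and coords: "\<And>a b. b \<in> cdom E a \<Longrightarrow>
      crd D (j a) (j b) = crd D (j a) (j a) + J (crd E a b - crd E a a)"
begin

interpretation E: chart_family E by (rule E)

lemma cinv_restrict:
  assumes "z \<in> crd E a ` cdom E a"
  shows "cinv D (j a) (crd D (j a) (j a) + J (z - crd E a a)) = j (cinv E a z)"
proof -
  have "crd D (j a) (j (cinv E a z)) = crd D (j a) (j a) + J (z - crd E a a)"
    using coords[OF E.cinv_in[OF assms]] E.crd_cinv[OF assms] by simp
  then show ?thesis
    using D.cinv_crd[OF dom[OF E.cinv_in[OF assms]]] by simp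
qed

lemma affine_deriv:
  "((\<lambda>z. crd D (j a) (j a) + J (z - crd E a a)) has_derivative J) (at z)"
proof -
  have "bounded_linear J" using J(1) by (simp add: linear_conv_bounded_linear)
  moreover have "((\<lambda>z. z - crd E a a) has_derivative (\<lambda>z. z)) (at z)"
    by (auto intro!: derivative_eq_intros)
  ultimately have "((\<lambda>z. J (z - crd E a a)) has_derivative J) (at z)"
    by (rule bounded_linear.has_derivative)
  then show ?thesis
    by (auto intro!: derivative_eq_intros)
qed

lemma local_rep_restrict:
  "z \<in> crd E a ` cdom E a \<Longrightarrow> (crd C q \<circ> (F \<circ> j) \<circ> cinv E a) z =
    (crd C q \<circ> F \<circ> cinv D (j a)) (crd D (j a) (j a) + J (z - crd E a a))"
  by (simp add: cinv_restrict)

lemma smooth_map_restrict: "smooth_map E C (F \<circ> j)"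
  unfolding smooth_map_def
proof (intro conjI allI)
  have cF: "continuous_on UNIV F" using smooth_map by (simp add: smooth_map_def)
  show cont: "continuous_on UNIV (F \<circ> j)"
    using j cF by (metis continuous_on_compose continuous_on_subset subset_UNIV)
  fix a q
  let ?S = "crd E a ` (cdom E a \<inter> (F \<circ> j) -` cdom C q)"
  let ?T = "crd D (j a) ` (cdom D (j a) \<inter> F -` cdom C q)"
  let ?l = "\<lambda>z. crd D (j a) (j a) + J (z - crd E a a)"
  have S: "open ?S" by (rule E.open_crd_vimage[OF cont open_cdom])
  have "?l ` ?S \<subseteq> ?T"
  proof
    fix t assume "t \<in> ?l ` ?S"
    then obtain b where b: "b \<in> cdom E a" "F (j b) \<in> cdom C q" "t = ?l (crd E a b)" by auto
    then have "t = crd D (j a) (j b)" using coords by simp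
    then show "t \<in> ?T" using b dom by blast
  qed
  moreover have "smooth_on (crd C q \<circ> F \<circ> cinv D (j a)) ?T"
    using smooth_map by (simp add: smooth_map_def)
  ultimately have "smooth_on (\<lambda>z. (crd C q \<circ> F \<circ> cinv D (j a)) (?l z)) ?S"
    using smooth_on_compose[OF smooth_on_affine[OF S affine_deriv] _ S] by blast
  then show "smooth_on (crd C q \<circ> (F \<circ> j) \<circ> cinv E a) ?S"
    by (rule smooth_on_cong[OF _ S]) (use local_rep_restrict in auto)
qed

lemma frechet_restrict:
  assumes S: "open S" "z \<in> S" and eq: "\<And>z. z \<in> S \<Longrightarrow> h z = k (crd D (j a) (j a) + J (z - crd E a a))"
    and k: "k differentiable (at (crd D (j a) (j a) + J (z - crd E a a)))"
  shows "frechet_derivative h (at z) v =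
    frechet_derivative k (at (crd D (j a) (j a) + J (z - crd E a a))) (J v)"
proof -
  let ?l = "\<lambda>z. crd D (j a) (j a) + J (z - crd E a a)"
  have "(k \<circ> ?l has_derivative frechet_derivative k (at (?l z)) \<circ> J) (at z)"
    using k by (intro diff_chain_at[OF affine_deriv]) (simp add: frechet_derivative_works[symmetric])
  then have "(h has_derivative frechet_derivative k (at (?l z)) \<circ> J) (at z)"
    by (rule has_derivative_transform_within_open[OF _ S]) (simp add: eq)
  from frechet_derivative_at[OF this, symmetric] show ?thesis by simp
qed

lemma differential_restrict: "differential E C (F \<circ> j) a u = differential D C F (j a) (J u)"
proof -
  have k: "(crd C (F (j a)) \<circ> F \<circ> cinv D (j a)) differentiable
    (at (crd D (j a) (j a) + J (crd E a a - crd E a a)))"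
    using rep_differentiable_center[of "j a"] by (simp add: rep_def linear_0[OF J(1)])
  from frechet_restrict[OF E.open_crd[of a] E.center_in[of a] local_rep_restrict k] show ?thesis
    by (simp add: differential_def linear_0[OF J(1)] o_def)
qed

lemma immersed_restrict: "immersed_submanifold C \<phi> \<xi> \<eta> g E (F \<circ> j)"
proof -
  have "inj (differential E C (F \<circ> j) a)" for a
    using inj_compose[OF inj_dF[of "j a"] J(2)] differential_restrict[of a] by (simp add: inj_def)
  then show ?thesis
    using smooth_map_restrict by unfold_locales (simp add: immersion_def)
qed

text \<open>An affine insertion contributes no second derivative, so the ambient covariant
  derivative is that of the large submanifold on \<open>J u\<close> and \<open>J v\<close>. Only the
  space to be normal to shrinks, which is why a fibre may bend inside the product.\<close>

lemma sff_restrict: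
  "second_fundamental_form E C g (F \<circ> j) a u v =
    normal_part (g (F (j a))) (range (\<lambda>u. dF (j a) (J u))) (cov (j a) (J u) (J v))"
proof -
  interpret R: immersed_submanifold C \<phi> \<xi> \<eta> g E "F \<circ> j" by (rule immersed_restrict)
  let ?l = "\<lambda>z. crd D (j a) (j a) + J (z - crd E a a)"
  have in_dom: "?l z \<in> rep_dom (j a)" if "z \<in> R.rep_dom a" for z
  proof -
    obtain b where b: "b \<in> cdom E a" "F (j b) \<in> cdom C (F (j a))" "z = crd E a b"
      using \<open>z \<in> R.rep_dom a\<close> by (auto simp: R.rep_dom_def)
    then have "?l z = crd D (j a) (j b)" using coords by simp
    then show ?thesis using b dom by (auto simp: rep_dom_def)
  qed
  have rep: "R.rep a z = rep (j a) (?l z)" if "z \<in> R.rep_dom a" for z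
    using local_rep_restrict[of z a "F (j a)"] that by (auto simp: rep_def R.rep_def R.rep_dom_def)
  have drep: "R.drep a z v = drep (j a) (?l z) (J v)" if "z \<in> R.rep_dom a" for z v
    by (rule frechet_restrict[OF R.open_rep_dom that rep smooth_onD(1)[OF rep_smooth in_dom[OF that]]])
  have "frechet_derivative (\<lambda>z. R.drep a z v) (at (crd E a a)) u =
    frechet_derivative (\<lambda>z. drep (j a) z (J v)) (at (?l (crd E a a))) (J u)"
    by (rule frechet_restrict[OF R.open_rep_dom R.center_rep_dom drep
          smooth_onD(2)[OF rep_smooth in_dom[OF R.center_rep_dom]]])
  then have "R.cov a u v = cov (j a) (J u) (J v)"
    by (simp add: R.cov_def cov_def differential_restrict linear_0[OF J(1)])
  then show ?thesis
    by (simp add: R.second_fundamental_form_eq tangent_image_def differential_restrict[abs_def])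
qed

end

end

lemma cdom_prod: "cdom (prod_charts C1 C2) (x, y) = cdom C1 x \<times> cdom C2 y"
  and crd_prod: "crd (prod_charts C1 C2) (x, y) = map_prod (crd C1 x) (crd C2 y)"
  by (simp_all add: cdom_def crd_def prod_charts_def)

lemma cinv_prod:
  assumes C1: "chart_family C1" and C2: "chart_family C2"
    and z: "z1 \<in> crd C1 x ` cdom C1 x" "z2 \<in> crd C2 y ` cdom C2 y"
  shows "cinv (prod_charts C1 C2) (x, y) (z1, z2) = (cinv C1 x z1, cinv C2 y z2)"
proof -
  interpret C1: chart_family C1 by fact
  interpret C2: chart_family C2 by fact
  obtain a b where ab: "a \<in> cdom C1 x" "b \<in> cdom C2 y" "z1 = crd C1 x a" "z2 = crd C2 y b"
    using z by blast
  have "inj_on (crd C1 x) (cdom C1 x)" "inj_on (crd C2 y) (cdom C2 y)"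
    by (metis C1.cinv_crd inj_onI, metis C2.cinv_crd inj_onI)
  then have "inj_on (map_prod (crd C1 x) (crd C2 y)) (cdom C1 x \<times> cdom C2 y)"
    by (rule map_prod_inj_on)
  from inv_into_f_f[OF this, of "(a, b)"] show ?thesis
    using ab by (simp add: C1.cinv_crd C2.cinv_crd) (simp add: cinv_def cdom_prod crd_prod)
qed

lemma map_prod_deriv:
  assumes "(f has_derivative f') (at x)" "(g has_derivative g') (at y)"
  shows "(map_prod f g has_derivative map_prod f' g') (at (x, y))"
proof -
  have "((\<lambda>z. (f (fst z), g (snd z))) has_derivative (\<lambda>v. (f' (fst v), g' (snd v)))) (at (x, y))"
    using diff_chain_at[OF has_derivative_fst[OF has_derivative_ident], of f f' "(x, y)"]
      diff_chain_at[OF has_derivative_snd[OF has_derivative_ident], of g g' "(x, y)"] assms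
    by (intro has_derivative_Pair) (simp_all add: o_def)
  then show ?thesis
    by (simp add: map_prod_def case_prod_unfold)
qed

context
  fixes C1 :: "('a::topological_space, 'd::euclidean_space) charts"
    and C2 :: "('b::topological_space, 'f::euclidean_space) charts"
  assumes C1: "chart_family C1" and C2: "chart_family C2"
begin

interpretation C1: chart_family C1 by (rule C1)
interpretation C2: chart_family C2 by (rule C2)

lemma transition_prod_deriv:
  assumes "a \<in> cdom C1 x" "b \<in> cdom C2 y" "a \<in> cdom C1 x'" "b \<in> cdom C2 y'"
  shows "(crd (prod_charts C1 C2) (x', y') \<circ> cinv (prod_charts C1 C2) (x, y) has_derivative
    map_prod (coord_change C1 x x' a) (coord_change C2 y y' b)) (at (crd C1 x a, crd C2 y b))"
proof -
  let ?S = "crd C1 x ` cdom C1 x \<times> crd C2 y ` cdom C2 y"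
  have "(map_prod (crd C1 x' \<circ> cinv C1 x) (crd C2 y' \<circ> cinv C2 y) has_derivative
    map_prod (coord_change C1 x x' a) (coord_change C2 y y' b)) (at (crd C1 x a, crd C2 y b))"
    using C1.transition[OF assms(1,3)] C2.transition[OF assms(2,4)]
    by (intro map_prod_deriv) (auto simp: coord_change_def[abs_def] frechet_derivative_works[symmetric])
  moreover have "open ?S" "(crd C1 x a, crd C2 y b) \<in> ?S"
    using assms C1.open_crd C2.open_crd by (auto intro: open_Times)
  ultimately show ?thesis
    by (rule has_derivative_transform_within_open) (auto simp: cinv_prod[OF C1 C2] crd_prod)
qed

lemma chart_family_prod: "chart_family (prod_charts C1 C2)"
proof
  fix p q :: "'a \<times> 'b"
  obtain x y where p: "p = (x, y)" by (cases p)
  let ?D = "prod_charts C1 C2"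
  have img: "crd ?D (x, y) ` cdom ?D (x, y) = crd C1 x ` cdom C1 x \<times> crd C2 y ` cdom C2 y"
    by (auto simp: crd_prod cdom_prod)
  show "p \<in> cdom ?D p" using C1.center C2.center by (simp add: p cdom_prod)
  show "open (cdom ?D p)" using C1.open_cdom C2.open_cdom by (simp add: p cdom_prod open_Times)
  show "open (crd ?D p ` cdom ?D p)"
    unfolding p img using C1.open_crd C2.open_crd by (simp add: open_Times)
  have c: "continuous_on (A \<times> B) (map_prod h k)"
    if "continuous_on A h" "continuous_on B k" for A B and h :: "'u::topological_space \<Rightarrow> 'v::topological_space"
      and k :: "'w::topological_space \<Rightarrow> 'z::topological_space"
    unfolding map_prod_def case_prod_unfold
    by (intro continuous_on_Pair continuous_on_compose2[OF that(1)] continuous_on_compose2[OF that(2)]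
        continuous_intros) auto
  have h1: "continuous_on (cdom C1 x) (crd C1 x)" "continuous_on (crd C1 x ` cdom C1 x) (cinv C1 x)"
    and h2: "continuous_on (cdom C2 y) (crd C2 y)" "continuous_on (crd C2 y ` cdom C2 y) (cinv C2 y)"
    using C1.homeo[of x] C2.homeo[of y] by (auto simp: homeomorphism_def)
  show "homeomorphism (cdom ?D p) (crd ?D p ` cdom ?D p) (crd ?D p) (cinv ?D p)"
    unfolding p
  proof (rule homeomorphismI)
    show "continuous_on (cdom ?D (x, y)) (crd ?D (x, y))"
      unfolding cdom_prod crd_prod using h1(1) h2(1) by (rule c)
    have "continuous_on (crd ?D (x, y) ` cdom ?D (x, y)) (map_prod (cinv C1 x) (cinv C2 y))"
      unfolding img using h1(2) h2(2) by (rule c)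
    then show "continuous_on (crd ?D (x, y) ` cdom ?D (x, y)) (cinv ?D (x, y))"
      by (rule continuous_on_eq) (auto simp: img cinv_prod[OF C1 C2])
  qed (auto simp: cdom_prod crd_prod cinv_prod[OF C1 C2] C1.cinv_crd C2.cinv_crd)
  obtain x' y' where q: "q = (x', y')" by (cases q)
  fix c assume "c \<in> cdom ?D p" "c \<in> cdom ?D q"
  then show "(crd ?D q \<circ> cinv ?D p) differentiable (at (crd ?D p c))"
    using transition_prod_deriv[of "fst c" x "snd c" y x' y'] unfolding p q
    by (cases c) (auto simp: cdom_prod crd_prod differentiable_def)
qed

lemma coord_field_prod:
  assumes "a \<in> cdom C1 x" "b \<in> cdom C2 y"
  shows "coord_field (prod_charts C1 C2) (x, y) v (a, b) =
    (coord_field C1 x (fst v) a, coord_field C2 y (snd v) b)"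
  using frechet_derivative_at[OF transition_prod_deriv[OF assms C1.center C2.center], symmetric]
  by (cases v) (simp add: coord_field_def coord_change_def[of "prod_charts C1 C2"] crd_prod)

end

section \<open>Warped product semi-slant submanifolds\<close>

locale warped_semi_slant_submanifold = nearly_cosymplectic_manifold C \<phi> \<xi> \<eta> g
  for C :: "('m::{t2_space, second_countable_topology}, 'e::euclidean_space) charts"
    and \<phi> \<xi> \<eta> g +
  fixes C1 :: "('a::{t2_space, second_countable_topology}, 'd::euclidean_space) charts"
    and g1 :: "'a \<Rightarrow> 'd \<Rightarrow> 'd \<Rightarrow> real"
    and C2 :: "('b::{t2_space, second_countable_topology}, 'f::euclidean_space) charts"
    and g2 :: "'b \<Rightarrow> 'f \<Rightarrow> 'f \<Rightarrow> real"
    and f :: "'a \<Rightarrow> real" and \<iota> :: "'a \<times> 'b \<Rightarrow> 'm" and \<theta> :: real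
  assumes wp: "warped_product_semi_slant C \<phi> \<xi> g C1 g1 C2 g2 f \<iota> \<theta>"
begin

sublocale C1: riemannian_manifold C1 g1
  using wp by unfold_locales (auto simp: warped_product_semi_slant_def)

sublocale C2: riemannian_manifold C2 g2
  using wp by unfold_locales (auto simp: warped_product_semi_slant_def)

sublocale immersed_submanifold C \<phi> \<xi> \<eta> g "prod_charts C1 C2" \<iota>
  using wp chart_family_prod[OF C1.chart_family_axioms C2.chart_family_axioms]
  by (auto intro!: immersed_submanifold.intro immersed_submanifold_axioms.intro
      nearly_cosymplectic_manifold_axioms simp: warped_product_semi_slant_def)

lemma f_pos: "f x > 0"
  using wp by (simp add: warped_product_semi_slant_def)

lemma induced_eq: "induced_metric (prod_charts C1 C2) C g \<iota> = warped_metric g1 g2 f"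
  using wp by (simp add: warped_product_semi_slant_def)

lemma metric_dF:
  "g (\<iota> (x, y)) (dF (x, y) u) (dF (x, y) v) = g1 x (fst u) (fst v) + (f x)\<^sup>2 * g2 y (snd u) (snd v)"
  using fun_cong[OF fun_cong[OF fun_cong[OF induced_eq, of "(x, y)"], of u], of v]
  by (cases u, cases v) (simp add: induced_metric_def warped_metric_def)

abbreviation hor :: "'a \<times> 'b \<Rightarrow> 'd \<Rightarrow> 'e" where
  "hor p u \<equiv> dF p (u, 0)"

abbreviation ver :: "'a \<times> 'b \<Rightarrow> 'f \<Rightarrow> 'e" where
  "ver p w \<equiv> dF p (0, w)"

lemma metric_hor_ver:
  "g (\<iota> (x, y)) (hor (x, y) u) (hor (x, y) u') = g1 x u u'"
  "g (\<iota> (x, y)) (ver (x, y) w) (ver (x, y) w') = (f x)\<^sup>2 * g2 y w w'"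
  "g (\<iota> p) (hor p u) (ver p w) = 0"
  "g (\<iota> p) (ver p w) (hor p u) = 0"
  by (cases p, simp add: metric_dF C1.form.linear_simps C2.form.linear_simps)+

lemma linear_hor: "linear (hor p)" and linear_ver: "linear (ver p)"
  using linear_compose[OF _ linear_dF, of "\<lambda>u. (u, 0)"] linear_compose[OF _ linear_dF, of "\<lambda>u. (0, u)"]
  by (auto simp: o_def linear_iff)

lemma leaf:
  "differential C1 C (\<lambda>x. \<iota> (x, y)) x u = hor (x, y) u"
  "immersed_submanifold C \<phi> \<xi> \<eta> g C1 (\<lambda>x. \<iota> (x, y))"
  "second_fundamental_form C1 C g (\<lambda>x. \<iota> (x, y)) x u v =
    normal_part (g (\<iota> (x, y))) (range (hor (x, y))) (cov (x, y) (u, 0) (v, 0))"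
proof -
  have *: "linear (\<lambda>u::'d. (u, 0::'f))" "inj (\<lambda>u::'d. (u, 0::'f))" "continuous_on UNIV (\<lambda>x. (x, y))"
    "\<And>a b. b \<in> cdom C1 a \<Longrightarrow> (b, y) \<in> cdom (prod_charts C1 C2) (a, y)"
    "\<And>a b. b \<in> cdom C1 a \<Longrightarrow> crd (prod_charts C1 C2) (a, y) (b, y) =
      crd (prod_charts C1 C2) (a, y) (a, y) + (crd C1 a b - crd C1 a a, 0)"
    using C2.center by (auto simp: linear_iff inj_def cdom_prod crd_prod intro!: continuous_intros)
  show "differential C1 C (\<lambda>x. \<iota> (x, y)) x u = hor (x, y) u"
    using differential_restrict[OF C1.chart_family_axioms *] by (simp add: o_def)
  show "immersed_submanifold C \<phi> \<xi> \<eta> g C1 (\<lambda>x. \<iota> (x, y))"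
    using immersed_restrict[OF C1.chart_family_axioms *] by (simp add: o_def)
  show "second_fundamental_form C1 C g (\<lambda>x. \<iota> (x, y)) x u v =
    normal_part (g (\<iota> (x, y))) (range (hor (x, y))) (cov (x, y) (u, 0) (v, 0))"
    using sff_restrict[OF C1.chart_family_axioms *] by (simp add: o_def)
qed

lemma fibre:
  "differential C2 C (\<lambda>y. \<iota> (x, y)) y u = ver (x, y) u"
  "immersed_submanifold C \<phi> \<xi> \<eta> g C2 (\<lambda>y. \<iota> (x, y))"
  "second_fundamental_form C2 C g (\<lambda>y. \<iota> (x, y)) y u v =
    normal_part (g (\<iota> (x, y))) (range (ver (x, y))) (cov (x, y) (0, u) (0, v))"
proof -
  have *: "linear (\<lambda>u::'f. (0::'d, u))" "inj (\<lambda>u::'f. (0::'d, u))" "continuous_on UNIV (\<lambda>y. (x, y))"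
    "\<And>a b. b \<in> cdom C2 a \<Longrightarrow> (x, b) \<in> cdom (prod_charts C1 C2) (x, a)"
    "\<And>a b. b \<in> cdom C2 a \<Longrightarrow> crd (prod_charts C1 C2) (x, a) (x, b) =
      crd (prod_charts C1 C2) (x, a) (x, a) + (0, crd C2 a b - crd C2 a a)"
    using C1.center by (auto simp: linear_iff inj_def cdom_prod crd_prod intro!: continuous_intros)
  show "differential C2 C (\<lambda>y. \<iota> (x, y)) y u = ver (x, y) u"
    using differential_restrict[OF C2.chart_family_axioms *] by (simp add: o_def)
  show "immersed_submanifold C \<phi> \<xi> \<eta> g C2 (\<lambda>y. \<iota> (x, y))"
    using immersed_restrict[OF C2.chart_family_axioms *] by (simp add: o_def)
  show "second_fundamental_form C2 C g (\<lambda>y. \<iota> (x, y)) y u v =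
    normal_part (g (\<iota> (x, y))) (range (ver (x, y))) (cov (x, y) (0, u) (0, v))"
    using sff_restrict[OF C2.chart_family_axioms *] by (simp add: o_def)
qed

section \<open>The Levi-Civita connection of the warped metric\<close>

definition dlnf :: "'a \<Rightarrow> 'd \<Rightarrow> real" where
  "dlnf x u = frechet_derivative (f \<circ> cinv C1 x) (at (crd C1 x x)) u / f x"

lemma f_deriv: "((\<lambda>z. f (cinv C1 x z)) has_derivative (\<lambda>u. f x * dlnf x u)) (at (crd C1 x x))"
proof -
  have "(f \<circ> cinv C1 x) differentiable (at (crd C1 x x))"
    using wp by (intro smooth_onD(1)[OF _ C1.center_in])
      (simp add: warped_product_semi_slant_def smooth_fun_def)
  then show ?thesis
    using f_pos[of x] by (simp add: dlnf_def frechet_derivative_works o_def)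
qed

lemma f_deriv_fst:
  "((\<lambda>z. f (cinv C1 x (fst z))) has_derivative (\<lambda>u. f x * dlnf x (fst u))) (at (crd C1 x x, c))"
  using diff_chain_at[OF has_derivative_fst[OF has_derivative_ident], of "\<lambda>z. f (cinv C1 x z)"
      "\<lambda>u. f x * dlnf x u" "(crd C1 x x, c)"] f_deriv by (simp add: o_def)

lemma linear_dlnf: "linear (dlnf x)"
proof -
  have "linear (\<lambda>u. (1 / f x) *\<^sub>R (f x * dlnf x u))"
    by (intro linear_compose_scale_right has_derivative_linear[OF f_deriv])
  then show ?thesis using f_pos[of x] by simp
qed

lemma prod_dom_open: "open (crd C1 x ` cdom C1 x \<times> crd C2 y ` cdom C2 y)"
  "(crd C1 x x, crd C2 y y) \<in> crd C1 x ` cdom C1 x \<times> crd C2 y ` cdom C2 y"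
  using C1.open_crd C2.open_crd C1.center_in C2.center_in by (auto intro: open_Times)

text \<open>In product charts coordinate fields split into their two factors, so this is the product
  rule for \<open>g1 + f\<^sup>2 g2\<close>; it evaluates the right-hand side of
  \<open>koszul\<close>.\<close>

lemma warped_deriv:
  "frechet_derivative (metric_coords (prod_charts C1 C2) (induced_metric (prod_charts C1 C2) C g \<iota>) (x, y) v w)
     (at (crd (prod_charts C1 C2) (x, y) (x, y))) u =
   C1.dmetric x (fst u) (fst v) (fst w) + 2 * (f x)\<^sup>2 * dlnf x (fst u) * g2 y (snd v) (snd w) +
   (f x)\<^sup>2 * C2.dmetric y (snd u) (snd v) (snd w)"
proof -
  let ?c = "(crd C1 x x, crd C2 y y)"
  have 1: "((\<lambda>z. metric_coords C1 g1 x (fst v) (fst w) (fst z)) has_derivative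
    (\<lambda>u. C1.dmetric x (fst u) (fst v) (fst w))) (at ?c)"
    using diff_chain_at[OF has_derivative_fst[OF has_derivative_ident]
        frechet_derivative_works[THEN iffD1, OF C1.metric_coords_differentiable], of ?c x "fst v" "fst w"]
      C1.center_in by (simp add: o_def C1.dmetric_def)
  have 2: "((\<lambda>z. metric_coords C2 g2 y (snd v) (snd w) (snd z)) has_derivative
    (\<lambda>u. C2.dmetric y (snd u) (snd v) (snd w))) (at ?c)"
    using diff_chain_at[OF has_derivative_snd[OF has_derivative_ident]
        frechet_derivative_works[THEN iffD1, OF C2.metric_coords_differentiable], of ?c y "snd v" "snd w"]
      C2.center_in by (simp add: o_def C2.dmetric_def)
  note 3 = f_deriv_fst[of x "crd C2 y y"]
  have "((\<lambda>z. metric_coords C1 g1 x (fst v) (fst w) (fst z) +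
      f (cinv C1 x (fst z)) * f (cinv C1 x (fst z)) * metric_coords C2 g2 y (snd v) (snd w) (snd z))
    has_derivative (\<lambda>u. C1.dmetric x (fst u) (fst v) (fst w) +
      (f x * f x * C2.dmetric y (snd u) (snd v) (snd w) +
       (f x * (f x * dlnf x (fst u)) + f x * dlnf x (fst u) * f x) * g2 y (snd v) (snd w)))) (at ?c)"
    using has_derivative_add[OF 1 has_derivative_mult[OF has_derivative_mult[OF 3 3] 2]]
    by (simp add: C2.metric_coords_center)
  then have "(metric_coords (prod_charts C1 C2) (induced_metric (prod_charts C1 C2) C g \<iota>) (x, y) v w
    has_derivative (\<lambda>u. C1.dmetric x (fst u) (fst v) (fst w) +
      (f x * f x * C2.dmetric y (snd u) (snd v) (snd w) +
       (f x * (f x * dlnf x (fst u)) + f x * dlnf x (fst u) * f x) * g2 y (snd v) (snd w)))) (at ?c)"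
  proof (rule has_derivative_transform_within_open[OF _ prod_dom_open], safe)
    fix a b assume ab: "a \<in> cdom C1 x" "b \<in> cdom C2 y"
    then show "metric_coords C1 g1 x (fst v) (fst w) (fst (crd C1 x a, crd C2 y b)) +
       f (cinv C1 x (fst (crd C1 x a, crd C2 y b))) * f (cinv C1 x (fst (crd C1 x a, crd C2 y b))) *
       metric_coords C2 g2 y (snd v) (snd w) (snd (crd C1 x a, crd C2 y b)) =
       metric_coords (prod_charts C1 C2) (induced_metric (prod_charts C1 C2) C g \<iota>) (x, y) v w
        (crd C1 x a, crd C2 y b)"
      by (simp add: metric_coords_def[of "prod_charts C1 C2"] C1.metric_coords_eq C2.metric_coords_eq
          cinv_prod C1.chart_family_axioms C2.chart_family_axioms C1.cinv_crd C2.cinv_crd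
          coord_field_prod induced_eq warped_metric_def power2_eq_square)
  qed
  from frechet_derivative_at[OF this, symmetric] show ?thesis
    by (simp add: crd_prod power2_eq_square algebra_simps)
qed

lemma dmetric_0:
  "C1.dmetric x 0 v w = 0" "C1.dmetric x u 0 w = 0" "C1.dmetric x u v 0 = 0"
  "C2.dmetric y 0 v' w' = 0" "C2.dmetric y u' 0 w' = 0" "C2.dmetric y u' v' 0 = 0"
  using linear_0[OF C1.dmetric_linear(1)] linear_0[OF C1.dmetric_linear(2)] linear_0[OF C1.dmetric_linear(3)]
    linear_0[OF C2.dmetric_linear(1)] linear_0[OF C2.dmetric_linear(2)] linear_0[OF C2.dmetric_linear(3)]
  by auto

text \<open>All three terms of \<open>koszul\<close> vanish: inside the product the leaves are
  totally geodesic. In the next two lemmas only the derivative of \<open>f\<^sup>2\<close> survives,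
  with a sign that depends on which slot is horizontal.\<close>

lemma cov_hor_hor: "g (\<iota> p) (cov p (u, 0) (v, 0)) (ver p w) = 0"
  using koszul[of p "(u, 0)" "(v, 0)" "(0, w)"]
  by (cases p) (simp add: warped_deriv dmetric_0 linear_0[OF linear_dlnf] C2.form.linear_simps)

lemma cov_hor_ver:
  "g (\<iota> (x, y)) (cov (x, y) (u, 0) (0, v)) (ver (x, y) w) =
    dlnf x u * g (\<iota> (x, y)) (ver (x, y) v) (ver (x, y) w)"
  using koszul[of "(x, y)" "(u, 0)" "(0, v)" "(0, w)"]
  by (simp add: warped_deriv dmetric_0 linear_0[OF linear_dlnf] C2.form.linear_simps metric_hor_ver)

lemma cov_ver_ver:
  "g (\<iota> (x, y)) (cov (x, y) (0, v) (0, w)) (hor (x, y) u) =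
    - dlnf x u * g (\<iota> (x, y)) (ver (x, y) v) (ver (x, y) w)"
  using koszul[of "(x, y)" "(0, v)" "(0, w)" "(u, 0)"]
  by (simp add: warped_deriv dmetric_0 linear_0[OF linear_dlnf] C2.form.linear_simps metric_hor_ver)

section \<open>Invariant leaves and slant fibres\<close>

lemma tangent_image_leaf: "tangent_image C1 C (\<lambda>x. \<iota> (x, y)) x = range (hor (x, y))"
  and tangent_image_fibre: "tangent_image C2 C (\<lambda>y. \<iota> (x, y)) y = range (ver (x, y))"
  by (simp_all add: tangent_image_def leaf(1) fibre(1))

lemma phi_hor: "\<phi> (\<iota> p) (hor p u) \<in> range (hor p)"
proof (cases p)
  case (Pair x y)
  have "invariant_submanifold C1 C \<phi> (\<lambda>x. \<iota> (x, y))"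
    using wp by (simp add: warped_product_semi_slant_def)
  then show ?thesis
    by (auto simp: invariant_submanifold_def tangent_image_leaf Pair)
qed

lemma xi_hor: "\<xi> (\<iota> p) \<in> range (hor p)"
  using wp by (cases p) (simp add: warped_product_semi_slant_def tangent_image_leaf)

lemma eta_ver [simp]: "\<eta> (\<iota> p) (ver p w) = 0"
  using xi_hor[of p] by (auto simp: eta_eq metric_hor_ver)

lemma phi_hor_ver: "g (\<iota> p) (\<phi> (\<iota> p) (hor p u)) (ver p w) = 0"
  using phi_hor[of p u] by (auto simp: metric_hor_ver)

lemma slant:
  "slant_submanifold C2 C \<phi> \<xi> g (\<lambda>y. \<iota> (x, y)) \<theta>"
  "\<not> invariant_submanifold C2 C \<phi> (\<lambda>y. \<iota> (x, y))"
  using wp by (auto simp: warped_product_semi_slant_def proper_slant_submanifold_def)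

lemma subspace_ver: "subspace (range (ver p))"
  by (rule linear_subspace_image[OF linear_ver subspace_UNIV])

lemma subspace_hor: "subspace (range (hor p))"
  by (rule linear_subspace_image[OF linear_hor subspace_UNIV])

lemma ver_nonzero: "w \<noteq> 0 \<Longrightarrow> g (\<iota> p) (ver p w) (ver p w) > 0"
  using C2.form.pos f_pos[of "fst p"] by (cases p) (auto simp: metric_hor_ver intro!: mult_pos_pos)

lemma metric_phi_ver:
  "g (\<iota> p) (\<phi> (\<iota> p) (ver p v)) (\<phi> (\<iota> p) (ver p w)) = g (\<iota> p) (ver p v) (ver p w)"
  by (simp add: metric_phi_phi)

text \<open>\<open>\<phi>\<close> preserves the length of fibre vectors, as they are orthogonal to
  \<open>\<xi>\<close>; for the same reason a nonzero one is no multiple of \<open>\<xi>\<close>, so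
  that the slant condition applies to it.\<close>

lemma slant_norm:
  "g (\<iota> p) (tangential_part (g (\<iota> p)) (range (ver p)) (\<phi> (\<iota> p) (ver p w)))
     (tangential_part (g (\<iota> p)) (range (ver p)) (\<phi> (\<iota> p) (ver p w))) =
   (cos \<theta>)\<^sup>2 * g (\<iota> p) (ver p w) (ver p w)"
proof (cases "w = 0")
  case True
  have "\<phi> (\<iota> p) (ver p w) = 0" "ver p w = 0"
    using linear_0[OF linear_phi] linear_0[OF linear_ver] True by auto
  then show ?thesis
    using form.tangential_part_angle[OF subspace_ver[of p], of "\<iota> p" 0] by (simp add: form.linear_simps)
next
  case False
  obtain x y where p: "p = (x, y)" by (cases p)
  have nz: "ver p w \<noteq> 0" using ver_nonzero[OF False, of p] by (auto simp: form.linear_simps)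
  have "\<nexists>c. ver p w = c *\<^sub>R \<xi> (\<iota> p)"
  proof
    assume "\<exists>c. ver p w = c *\<^sub>R \<xi> (\<iota> p)"
    then obtain c where "ver p w = c *\<^sub>R \<xi> (\<iota> p)" ..
    then have "g (\<iota> p) (ver p w) (ver p w) = c * \<eta> (\<iota> p) (ver p w)"
      by (simp add: eta_eq form.linear_simps)
    then show False using ver_nonzero[OF False, of p] by simp
  qed
  then have "angle_to_subspace (g (\<iota> p)) (\<phi> (\<iota> p) (ver p w)) (range (ver p)) = \<theta>"
    using slant(1)[of x] nz by (auto simp: slant_submanifold_def p tangent_image_fibre)
  then show ?thesis
    using form.tangential_part_angle[OF subspace_ver[of p], of "\<iota> p" "\<phi> (\<iota> p) (ver p w)"]
    by (simp add: metric_phi_ver)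
qed

text \<open>Otherwise projecting \<open>\<phi> (\<iota> p) (ver p w)\<close> to the fibre loses no
  length, so this vector is tangent to the fibre, and the fibre would be invariant.\<close>

lemma sin_nonzero: "sin \<theta> \<noteq> 0"
proof
  assume s: "sin \<theta> = 0"
  fix x
  have "(cos \<theta>)\<^sup>2 = 1" using sin_squared_eq[of \<theta>] s by simp
  then have "\<phi> (\<iota> (x, y)) (ver (x, y) w) \<in> range (ver (x, y))" for y w
    using slant_norm[of "(x, y)" w] form.orthonormal_basis_exists[OF subspace_ver[of "(x, y)"], of "\<iota> (x, y)"]
      form.tangential_part_norm(3)[OF subspace_ver]
    by (metis metric_phi_ver mult_1)
  then have "invariant_submanifold C2 C \<phi> (\<lambda>y. \<iota> (x, y))"
    by (auto simp: invariant_submanifold_def tangent_image_fibre)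
  then show False using slant(2) by blast
qed

lemma scaled_fibre_form: "c > 0 \<Longrightarrow> pos_def_form (\<lambda>v w. c\<^sup>2 * g2 y v w)"
  using C2.form.inner_product[of y] unfolding inner_product_def bilinear_def
  by unfold_locales (auto simp: inner_product_def bilinear_def linear_iff algebra_simps)

text \<open>The constant \<open>c\<close> is independent of \<open>f x\<close> because a frame that
  is orthonormal over one base point will be kept fixed while the base point moves.\<close>

lemma slant_sum:
  assumes c: "c > 0" and W: "orthonormal_frame (\<lambda>v w. c\<^sup>2 * g2 y v w) W"
  shows "(\<Sum>k\<in>W. (g (\<iota> (x, y)) (\<phi> (\<iota> (x, y)) (ver (x, y) v)) (ver (x, y) k))\<^sup>2) =
    (cos \<theta>)\<^sup>2 * (f x)^4 / c\<^sup>2 * g2 y v v"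
proof -
  let ?p = "(x, y)" and ?P = "\<iota> (x, y)"
  interpret W: pos_def_form "\<lambda>v w. c\<^sup>2 * g2 y v w" using c by (rule scaled_fibre_form)
  note on = W.orthonormal_frameD[OF W]
  \<comment> \<open>This rescaling makes \<open>h\<close> an isometry from
    \<open>c\<^sup>2 * g2 y\<close> onto the tangent space of the fibre, so it carries
    \<open>W\<close> to an orthonormal basis there.\<close>
  define h where "h k = (c / f x) *\<^sub>R ver ?p k" for k
  have h: "linear h" unfolding h_def by (intro linear_compose_scale_right linear_ver)
  have gh: "g ?P (h k) (h l) = c\<^sup>2 * g2 y k l" for k l
    using f_pos[of x] by (simp add: h_def form.linear_simps metric_hor_ver power2_eq_square)
  have inj: "inj h"
  proof (rule injI)
    fix k l assume "h k = h l"
    then have "h (k - l) = 0" using linear_diff[OF h] by simp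
    then have "c\<^sup>2 * g2 y (k - l) (k - l) = 0" using gh[of "k - l" "k - l"] by (simp add: form.linear_simps)
    then show "k = l" using c C2.form.eq_0_iff by auto
  qed
  have rng: "range h = range (ver ?p)"
  proof
    show "range h \<subseteq> range (ver ?p)"
      unfolding h_def using subspace_scale[OF subspace_ver] by blast
    have "ver ?p k = h ((f x / c) *\<^sub>R k)" for k
      using c f_pos[of x] by (simp add: h_def linear_scale[OF linear_ver])
    then show "range (ver ?p) \<subseteq> range h" by auto
  qed
  have "form.orthonormal ?P (h ` W)"
    using on(1) inj unfolding form.orthonormal_def W.orthonormal_def by (auto simp: gh inj_eq)
  moreover have "span (h ` W) = range (ver ?p)"
    using linear_span_image[OF h, of W] on(2) rng by simp
  ultimately have "(\<Sum>e\<in>h ` W. (g ?P (\<phi> ?P (ver ?p v)) e)\<^sup>2) = (cos \<theta>)\<^sup>2 * g ?P (ver ?p v) (ver ?p v)"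
    using form.tangential_part_norm(1)[OF subspace_ver] slant_norm[of ?p v] by metis
  then have "(\<Sum>k\<in>W. (g ?P (\<phi> ?P (ver ?p v)) (h k))\<^sup>2) = (cos \<theta>)\<^sup>2 * ((f x)\<^sup>2 * g2 y v v)"
    by (simp add: sum.reindex[OF inj_on_subset[OF inj subset_UNIV]] metric_hor_ver)
  moreover have "(g ?P (\<phi> ?P (ver ?p v)) (h k))\<^sup>2 =
    (c / f x)\<^sup>2 * (g ?P (\<phi> ?P (ver ?p v)) (ver ?p k))\<^sup>2" for k
    by (simp add: h_def form.linear_simps power_mult_distrib power_divide)
  ultimately have "(c / f x)\<^sup>2 * (\<Sum>k\<in>W. (g ?P (\<phi> ?P (ver ?p v)) (ver ?p k))\<^sup>2) =
    (cos \<theta>)\<^sup>2 * ((f x)\<^sup>2 * g2 y v v)"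
    by (simp add: sum_distrib_left)
  then show ?thesis
    using c f_pos[of x] by (simp add: field_simps power2_eq_square power4_eq_xxxx)
qed

section \<open>The pulled back 2-form and its derivatives\<close>

lemma omega_mixed:
  "g (\<iota> p) (nabla_phi (\<iota> p) (dF p v) (hor p u)) (ver p w)
     - g (\<iota> p) (cov p v (u, 0)) (\<phi> (\<iota> p) (ver p w))
     + g (\<iota> p) (\<phi> (\<iota> p) (hor p u)) (cov p v (0, w)) = 0"
proof -
  obtain x y where p: "p = (x, y)" by (cases p)
  \<comment> \<open>The component is identically zero near \<open>p\<close>: \<open>\<phi>\<close>
    maps the tangent space of a leaf to itself, and leaves are orthogonal to fibres.\<close>
  have "(omega_coords p (u, 0) (0, w) has_derivative (\<lambda>v. 0)) (at (crd (prod_charts C1 C2) p p))"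
    unfolding p crd_prod
  proof (rule has_derivative_transform_within_open[OF has_derivative_const[of 0]])
    show "open (crd C1 x ` cdom C1 x \<times> crd C2 y ` cdom C2 y)" by (rule prod_dom_open)
    show "map_prod (crd C1 x) (crd C2 y) (x, y) \<in> crd C1 x ` cdom C1 x \<times> crd C2 y ` cdom C2 y"
      using prod_dom_open(2) by simp
    fix z assume "z \<in> crd C1 x ` cdom C1 x \<times> crd C2 y ` cdom C2 y"
    then obtain a b where ab: "a \<in> cdom C1 x" "b \<in> cdom C2 y" "z = (crd C1 x a, crd C2 y b)" by auto
    then show "0 = omega_coords (x, y) (u, 0) (0, w) z"
      using linear_0[OF C1.linear_coord_field[OF ab(1)]] linear_0[OF C2.linear_coord_field[OF ab(2)]]
      by (simp add: omega_coords_def cinv_prod C1.chart_family_axioms C2.chart_family_axioms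
          C1.cinv_crd C2.cinv_crd coord_field_prod phi_hor_ver)
  qed
  from fun_cong[OF has_derivative_unique[OF omega_deriv this], of v] show ?thesis by simp
qed

definition omega :: "'a \<times> 'b \<Rightarrow> 'f \<Rightarrow> 'f \<Rightarrow> real" where
  "omega p v w = g (\<iota> p) (\<phi> (\<iota> p) (ver p v)) (ver p w)"

text \<open>Not the exterior derivative: by \<open>omega_deriv\<close>, it is the derivative of the
  component of omega on the vertical coordinate fields \<open>v\<close>, \<open>w\<close> in the
  horizontal direction \<open>u\<close>.\<close>

definition domega :: "'a \<times> 'b \<Rightarrow> 'd \<Rightarrow> 'f \<Rightarrow> 'f \<Rightarrow> real" where
  "domega p u v w = g (\<iota> p) (nabla_phi (\<iota> p) (hor p u) (ver p v)) (ver p w)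
     - g (\<iota> p) (cov p (u, 0) (0, v)) (\<phi> (\<iota> p) (ver p w))
     + g (\<iota> p) (\<phi> (\<iota> p) (ver p v)) (cov p (u, 0) (0, w))"

lemma frame_sq:
  assumes "orthonormal_frame (\<lambda>v w. (f x)\<^sup>2 * g2 y v w) W" "v \<in> W"
  shows "g2 y v v = 1 / (f x)\<^sup>2"
  using assms f_pos[of x] by (auto simp: orthonormal_frame_def field_simps)

text \<open>The frame belongs to the base point \<open>x\<close> while omega is evaluated over any
  \<open>x'\<close>; this is what allows differentiation in \<open>x'\<close>.\<close>

lemma omega_sum:
  assumes W: "orthonormal_frame (\<lambda>v w. (f x)\<^sup>2 * g2 y v w) W"
  shows "(\<Sum>v\<in>W. \<Sum>w\<in>W. (omega (x', y) v w)\<^sup>2) = (cos \<theta>)\<^sup>2 * real DIM('f) / (f x)^4 * (f x')^4"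
proof -
  have "(\<Sum>w\<in>W. (omega (x', y) v w)\<^sup>2) = (cos \<theta>)\<^sup>2 * (f x')^4 / (f x)^4" if "v \<in> W" for v
    unfolding omega_def slant_sum[OF f_pos W] frame_sq[OF W that]
    by (simp add: power2_eq_square power4_eq_xxxx)
  then show ?thesis
    using W by (simp add: orthonormal_frame_def)
qed

text \<open>The tangential part of \<open>\<phi>\<close> on the fibres may vary along the base, but by slantness the squared
  length of \<open>omega\<close> is a constant multiple of \<open>f ^ 4\<close>, which is all that is differentiated here.\<close>

lemma omega_domega_sum:
  assumes W: "orthonormal_frame (\<lambda>v w. (f x)\<^sup>2 * g2 y v w) W"
  shows "(\<Sum>v\<in>W. \<Sum>w\<in>W. omega (x, y) v w * domega (x, y) u v w) =
    2 * dlnf x u * (cos \<theta>)\<^sup>2 * real DIM('f)"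
proof -
  let ?c = "crd C1 x x" and ?e = "crd C2 y y"
  define K where "K = (cos \<theta>)\<^sup>2 * real DIM('f) / (f x)^4"
  have om: "omega_coords (x, y) (0, v) (0, w) (z, ?e) = omega (cinv C1 x z, y) v w"
    if "z \<in> crd C1 x ` cdom C1 x" for v w z
    using that linear_0[OF C1.linear_coord_field[OF C1.cinv_in[OF that]]] C2.center
    by (simp add: omega_coords_def omega_def cinv_prod C1.chart_family_axioms C2.chart_family_axioms
        C2.center_in C1.cinv_in coord_field_prod Let_def)
  have d: "((\<lambda>z. omega_coords (x, y) (0, v) (0, w) (z, ?e)) has_derivative (\<lambda>u. domega (x, y) u v w)) (at ?c)"
    for v w
    using diff_chain_at[OF has_derivative_Pair[OF has_derivative_ident has_derivative_const[of ?e]],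
        of "omega_coords (x, y) (0, v) (0, w)" _ ?c] omega_deriv[of "(x, y)" "(0, v)" "(0, w)"]
    by (simp add: o_def domega_def crd_prod)
  have "((\<lambda>z. \<Sum>v\<in>W. \<Sum>w\<in>W. omega_coords (x, y) (0, v) (0, w) (z, ?e) * omega_coords (x, y) (0, v) (0, w) (z, ?e))
    has_derivative (\<lambda>u. \<Sum>v\<in>W. \<Sum>w\<in>W. omega_coords (x, y) (0, v) (0, w) (?c, ?e) * domega (x, y) u v w +
      domega (x, y) u v w * omega_coords (x, y) (0, v) (0, w) (?c, ?e))) (at ?c)"
    by (intro has_derivative_sum has_derivative_mult d)
  then have 1: "((\<lambda>z. \<Sum>v\<in>W. \<Sum>w\<in>W. omega_coords (x, y) (0, v) (0, w) (z, ?e) * omega_coords (x, y) (0, v) (0, w) (z, ?e))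
    has_derivative (\<lambda>u. 2 * (\<Sum>v\<in>W. \<Sum>w\<in>W. omega (x, y) v w * domega (x, y) u v w))) (at ?c)"
    by (simp add: om[OF C1.center_in] sum_distrib_left mult.commute)
  \<comment> \<open>The fourth power gives the factor 4 and the squares of omega in \<open>1\<close>
    give a factor 2, which leaves the 2 of the conclusion.\<close>
  have "((\<lambda>z. K * (f (cinv C1 x z))^4) has_derivative (\<lambda>u. 4 * dlnf x u * (cos \<theta>)\<^sup>2 * real DIM('f))) (at ?c)"
    using has_derivative_mult_right[OF has_derivative_power[OF f_deriv[of x], where n = 4], of K] f_pos[of x]
    by (simp add: K_def algebra_simps power4_eq_xxxx power3_eq_cube)
  then have 2: "((\<lambda>z. \<Sum>v\<in>W. \<Sum>w\<in>W. omega_coords (x, y) (0, v) (0, w) (z, ?e) * omega_coords (x, y) (0, v) (0, w) (z, ?e))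
    has_derivative (\<lambda>u. 4 * dlnf x u * (cos \<theta>)\<^sup>2 * real DIM('f))) (at ?c)"
    by (rule has_derivative_transform_within_open[OF _ C1.open_crd C1.center_in])
      (simp add: om K_def omega_sum[OF W] flip: power2_eq_square)
  from fun_cong[OF has_derivative_unique[OF 1 2], of u] show ?thesis by simp
qed

end

section \<open>The second fundamental form\<close>

text \<open>On the diagonal both skew forms vanish and only \<open>m\<close> remains. Off the
  diagonal the least value for a prescribed product of \<open>om\<close> and \<open>t\<close> is
  attained when \<open>t\<close> is \<open>2 / 3 * l\<close> times \<open>om\<close>, leaving one
  third of \<open>l * om\<close>. The 2 in \<open>2 / 3\<close> stems from
  \<open>omega_domega_sum\<close>, the 3 from \<open>domega_eq\<close>.\<close>

lemma skew_sum_bound: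
  fixes om t :: "'i \<Rightarrow> 'i \<Rightarrow> real"
  assumes "finite W" and om: "\<And>v w. om v w = - om w v" and t: "\<And>v w. t v w = - t w v"
    and om2: "(\<Sum>v\<in>W. \<Sum>w\<in>W. (om v w)\<^sup>2) = N"
    and omt: "(\<Sum>v\<in>W. \<Sum>w\<in>W. om v w * t v w) = 2 / 3 * l * N"
  shows "real (card W) * m\<^sup>2 + l\<^sup>2 * N / 9 \<le>
    (\<Sum>v\<in>W. \<Sum>w\<in>W. (l * om v w - t v w - m * (if v = w then 1 else 0))\<^sup>2)"
proof -
  \<comment> \<open>The coefficients are chosen so that, off the diagonal, the right side exceeds
    the left by the square of \<open>2 / 3 * l * om v w - t v w\<close>. After summation
    \<open>5 / 9 - 4 / 9\<close> gives the \<open>1 / 9\<close>.\<close>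
  have pt: "5 / 9 * l\<^sup>2 * (om v w)\<^sup>2 - 2 / 3 * l * (om v w * t v w) + (if v = w then m\<^sup>2 else 0) \<le>
    (l * om v w - t v w - m * (if v = w then 1 else 0))\<^sup>2" for v w
  proof (cases "v = w")
    case True
    then have "om v w = 0" "t v w = 0" using om[of v v] t[of v v] by auto
    then show ?thesis by simp
  next
    case False
    have "(l * om v w - t v w)\<^sup>2 - (5 / 9 * l\<^sup>2 * (om v w)\<^sup>2 - 2 / 3 * l * (om v w * t v w)) =
      (2 / 3 * (l * om v w) - t v w)\<^sup>2"
      by (simp add: power2_eq_square algebra_simps)
    then have "0 \<le> (l * om v w - t v w)\<^sup>2 - (5 / 9 * l\<^sup>2 * (om v w)\<^sup>2 - 2 / 3 * l * (om v w * t v w))"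
      by (simp only: zero_le_power2)
    then show ?thesis
      using False by (simp only: diff_ge_0_iff_ge if_False) simp
  qed
  have "(\<Sum>v\<in>W. \<Sum>w\<in>W. 5 / 9 * l\<^sup>2 * (om v w)\<^sup>2 - 2 / 3 * l * (om v w * t v w) + (if v = w then m\<^sup>2 else 0)) =
    5 / 9 * l\<^sup>2 * (\<Sum>v\<in>W. \<Sum>w\<in>W. (om v w)\<^sup>2) - 2 / 3 * l * (\<Sum>v\<in>W. \<Sum>w\<in>W. om v w * t v w) + real (card W) * m\<^sup>2"
    using \<open>finite W\<close> by (simp add: sum.distrib sum_subtractf sum_distrib_left)
  also have "\<dots> = 5 / 9 * l\<^sup>2 * N - 2 / 3 * l * (2 / 3 * l * N) + real (card W) * m\<^sup>2"
    unfolding om2 omt ..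
  also have "\<dots> = real (card W) * m\<^sup>2 + l\<^sup>2 * N / 9"
    by (simp add: power2_eq_square algebra_simps)
  finally have "real (card W) * m\<^sup>2 + l\<^sup>2 * N / 9 = (\<Sum>v\<in>W. \<Sum>w\<in>W. 5 / 9 * l\<^sup>2 * (om v w)\<^sup>2 -
    2 / 3 * l * (om v w * t v w) + (if v = w then m\<^sup>2 else 0))" by (rule sym)
  also have "\<dots> \<le> (\<Sum>v\<in>W. \<Sum>w\<in>W. (l * om v w - t v w - m * (if v = w then 1 else 0))\<^sup>2)"
    by (intro sum_mono pt)
  finally show ?thesis .
qed

context warped_semi_slant_submanifold
begin

abbreviation sff :: "'a \<times> 'b \<Rightarrow> 'd \<times> 'f \<Rightarrow> 'd \<times> 'f \<Rightarrow> 'e" where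
  "sff p \<equiv> second_fundamental_form (prod_charts C1 C2) C g \<iota> p"

definition nabla_form :: "'a \<times> 'b \<Rightarrow> 'd \<Rightarrow> 'f \<Rightarrow> 'f \<Rightarrow> real" where
  "nabla_form p u v w = g (\<iota> p) (nabla_phi (\<iota> p) (hor p u) (ver p v)) (ver p w)"

lemma nabla_form_skew: "nabla_form p u v w = - nabla_form p u w v"
  unfolding nabla_form_def
  using nabla_phi_skew2[of "\<iota> p" "hor p u" "ver p v" "ver p w"] by (simp add: form.sym)

lemma omega_skew: "omega p v w = - omega p w v"
  unfolding omega_def by (subst phi_skew) (simp add: form.sym)

text \<open>This is \<open>omega_mixed\<close> in the direction of a fibre vector, solved for the
  middle term: skewness of \<open>nabla_phi\<close> and symmetry of \<open>cov\<close> move the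
  horizontal vector to the front, and \<open>cov_ver_ver\<close> evaluates the last term since
  \<open>\<phi>\<close> keeps \<open>hor (x, y) u\<close> horizontal.\<close>

lemma cov_phi:
  assumes u': "\<phi> (\<iota> (x, y)) (hor (x, y) u) = hor (x, y) u'"
  shows "g (\<iota> (x, y)) (cov (x, y) (u, 0) (0, v)) (\<phi> (\<iota> (x, y)) (ver (x, y) w)) =
    - nabla_form (x, y) u v w - dlnf x u' * g (\<iota> (x, y)) (ver (x, y) v) (ver (x, y) w)"
proof -
  have "g (\<iota> (x, y)) (hor (x, y) u') (cov (x, y) (0, v) (0, w)) =
    - dlnf x u' * g (\<iota> (x, y)) (ver (x, y) v) (ver (x, y) w)"
    using cov_ver_ver[of x y v w u'] form.sym by metis
  then show ?thesis
    using omega_mixed[of "(x, y)" "(0, v)" u w] u'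
      nabla_phi_skew1[of "\<iota> (x, y)" "ver (x, y) v" "hor (x, y) u"] cov_sym[of "(x, y)" "(0, v)" "(u, 0)"]
    by (simp add: nabla_form_def form.linear_simps)
qed

text \<open>By \<open>cov_phi\<close> each of the two connection terms contributes one more copy of
  \<open>nabla_form\<close>, while the terms in \<open>dlnf x u'\<close> are symmetric in
  \<open>v\<close> and \<open>w\<close>, enter with opposite signs and cancel.\<close>

lemma domega_eq: "domega (x, y) u v w = 3 * nabla_form (x, y) u v w"
proof -
  obtain u' where u': "\<phi> (\<iota> (x, y)) (hor (x, y) u) = hor (x, y) u'"
    using phi_hor by blast
  have "g (\<iota> (x, y)) (\<phi> (\<iota> (x, y)) (ver (x, y) v)) (cov (x, y) (u, 0) (0, w)) =
    g (\<iota> (x, y)) (cov (x, y) (u, 0) (0, w)) (\<phi> (\<iota> (x, y)) (ver (x, y) v))"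
    by (rule form.sym)
  then show ?thesis
    unfolding domega_def cov_phi[OF u'] nabla_form_def[symmetric]
    using nabla_form_skew[of "(x, y)" u v w] form.sym[of "\<iota> (x, y)" "ver (x, y) v" "ver (x, y) w"]
    by simp
qed

text \<open>Two evaluations of the derivative of \<open>\<phi>\<close> along a fibre vector
  \<open>w\<close>, applied to \<open>\<xi>\<close> and tested against the image of \<open>w\<close>
  under \<open>\<phi>\<close>. As \<open>\<eta>\<close> vanishes on fibres,
  \<open>nabla_phi_xi\<close> and \<open>cov_ver_ver\<close> give minus \<open>dlnf x u\<close>
  times the squared length of \<open>w\<close>; after exchanging the arguments,
  \<open>nabla_phi_ortho\<close> gives zero.\<close>

lemma dlnf_xi:
  assumes u: "\<xi> (\<iota> (x, y)) = hor (x, y) u"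
  shows "dlnf x u = 0"
proof -
  let ?p = "(x, y)" and ?P = "\<iota> (x, y)"
  obtain w :: 'f where w: "w \<noteq> 0" using nonempty_Basis nonzero_Basis by blast
  have "((\<lambda>z. let a = cinv (prod_charts C1 C2) ?p z in
      \<eta> (\<iota> a) (dF a (coord_field (prod_charts C1 C2) ?p (0, w) a))) has_derivative (\<lambda>v. 0))
    (at (crd (prod_charts C1 C2) ?p ?p))"
    unfolding crd_prod
  proof (rule has_derivative_transform_within_open[OF has_derivative_const[of 0]])
    show "open (crd C1 x ` cdom C1 x \<times> crd C2 y ` cdom C2 y)" by (rule prod_dom_open)
    show "map_prod (crd C1 x) (crd C2 y) (x, y) \<in> crd C1 x ` cdom C1 x \<times> crd C2 y ` cdom C2 y"
      using prod_dom_open(2) by simp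
    fix z assume "z \<in> crd C1 x ` cdom C1 x \<times> crd C2 y ` cdom C2 y"
    then obtain a b where ab: "a \<in> cdom C1 x" "b \<in> cdom C2 y" "z = (crd C1 x a, crd C2 y b)" by auto
    then show "0 = (let a = cinv (prod_charts C1 C2) ?p z in
      \<eta> (\<iota> a) (dF a (coord_field (prod_charts C1 C2) ?p (0, w) a)))"
      using linear_0[OF C1.linear_coord_field[OF ab(1)]]
      by (simp add: cinv_prod C1.chart_family_axioms C2.chart_family_axioms
          C1.cinv_crd C2.cinv_crd coord_field_prod Let_def)
  qed
  from fun_cong[OF has_derivative_unique[OF eta_deriv_along this], of "(0, w)"]
  have "deta ?P (ver ?p w) (ver ?p w) + \<eta> ?P (cov ?p (0, w) (0, w)) =
    \<eta> ?P (Gam ?P (ver ?p w) (ver ?p w))" by simp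
  then have "g ?P (nabla_phi ?P (ver ?p w) (\<xi> ?P)) (\<phi> ?P (ver ?p w)) = \<eta> ?P (cov ?p (0, w) (0, w))"
    using nabla_phi_xi[OF eta_ver, of ?p "ver ?p w" w] by simp
  also have "\<dots> = - dlnf x u * g ?P (ver ?p w) (ver ?p w)"
    using cov_ver_ver[of x y w w u] by (simp add: eta_eq u)
  finally have "dlnf x u * g ?P (ver ?p w) (ver ?p w) =
    g ?P (nabla_phi ?P (\<xi> ?P) (ver ?p w)) (\<phi> ?P (ver ?p w))"
    using nabla_phi_skew1[of ?P "ver ?p w" "\<xi> ?P"] by (simp add: form.linear_simps)
  also have "\<dots> = 0" by (rule nabla_phi_ortho) simp
  finally show ?thesis using ver_nonzero[OF w, of ?p] by simp
qed

section \<open>The normal part of \<phi> on the fibres\<close>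

definition nu :: "'a \<times> 'b \<Rightarrow> 'f \<Rightarrow> 'e" where
  "nu p w = normal_part (g (\<iota> p)) (range (ver p)) (\<phi> (\<iota> p) (ver p w))"

lemma linear_nu: "linear (nu p)"
  unfolding nu_def[abs_def]
  using linear_compose[OF linear_compose[OF linear_ver linear_phi] form.linear_normal_part[OF subspace_ver]]
  by (simp add: o_def)

lemma nu_decomp: "\<exists>k. \<phi> (\<iota> p) (ver p w) = nu p w + ver p k"
proof -
  have "\<phi> (\<iota> p) (ver p w) - nu p w \<in> range (ver p)"
    unfolding nu_def by (rule form.normal_part(2)[OF subspace_ver])
  then obtain k where "\<phi> (\<iota> p) (ver p w) - nu p w = ver p k" by blast
  then have "\<phi> (\<iota> p) (ver p w) = nu p w + ver p k" by (simp add: diff_eq_eq add.commute)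
  then show ?thesis ..
qed

lemma nu_ver: "g (\<iota> p) (nu p w) (ver p v) = 0"
  unfolding nu_def by (rule form.normal_part(1)[OF subspace_ver]) simp

text \<open>\<open>nu\<close> is defined as normal to the fibre only; that it is normal to the whole
  product follows because \<open>\<phi>\<close> of a fibre vector has no horizontal
  component.\<close>

lemma nu_hor: "g (\<iota> p) (nu p w) (hor p u) = 0"
proof -
  obtain k where k: "\<phi> (\<iota> p) (ver p w) = nu p w + ver p k" using nu_decomp by blast
  have "g (\<iota> p) (\<phi> (\<iota> p) (ver p w)) (hor p u) = 0"
    using phi_hor_ver[of p u w] by (subst phi_skew) (simp add: form.sym)
  then show ?thesis by (simp add: k form.linear_simps metric_hor_ver)
qed

lemma tangent_split:
  assumes "t \<in> tangent_image (prod_charts C1 C2) C \<iota> p"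
  obtains u w where "t = hor p u + ver p w"
proof -
  obtain u w where "t = dF p ((u, 0) + (0, w))"
    using assms by (auto simp: tangent_image_def)
  then show ?thesis
    using that linear_add[OF linear_dF, of p "(u, 0)" "(0, w)"] by metis
qed

lemma nu_normal: "t \<in> tangent_image (prod_charts C1 C2) C \<iota> p \<Longrightarrow> g (\<iota> p) (nu p w) t = 0"
  by (erule tangent_split) (simp add: form.linear_simps nu_ver nu_hor)

text \<open>Pythagoras with \<open>slant_norm\<close> settles \<open>v = w\<close>, and polarisation
  the rest. Divided by \<open>sin \<theta>\<close>, \<open>nu\<close> thus carries orthonormal fibre
  vectors to orthonormal normal vectors.\<close>

lemma nu_nu: "g (\<iota> p) (nu p v) (nu p w) = (sin \<theta>)\<^sup>2 * g (\<iota> p) (ver p v) (ver p w)"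
proof -
  have sq: "g (\<iota> p) (nu p w) (nu p w) = (sin \<theta>)\<^sup>2 * g (\<iota> p) (ver p w) (ver p w)" for w
  proof -
    let ?t = "tangential_part (g (\<iota> p)) (range (ver p)) (\<phi> (\<iota> p) (ver p w))"
    obtain k where k: "\<phi> (\<iota> p) (ver p w) = nu p w + ver p k" using nu_decomp by blast
    have "?t = \<phi> (\<iota> p) (ver p w) - nu p w" by (simp add: tangential_part_def nu_def)
    also have "\<dots> = ver p k" using k by simp
    finally have "g (\<iota> p) (ver p k) (ver p k) = (cos \<theta>)\<^sup>2 * g (\<iota> p) (ver p w) (ver p w)"
      using slant_norm[of p w] by simp
    moreover have "g (\<iota> p) (nu p w + ver p k) (nu p w + ver p k) = g (\<iota> p) (ver p w) (ver p w)"
      using metric_phi_ver[of p w w] by (simp add: k)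
    ultimately show ?thesis
      using nu_ver[of p w k] form.sym[of "\<iota> p" "nu p w" "ver p k"]
      by (simp add: form.linear_simps sin_squared_eq algebra_simps)
  qed
  show ?thesis
    using sq[of "v + w"] sq[of v] sq[of w] form.sym[of "\<iota> p" "nu p v" "nu p w"]
      form.sym[of "\<iota> p" "ver p v" "ver p w"]
    by (simp add: linear_add[OF linear_nu] linear_add[OF linear_ver] form.linear_simps algebra_simps)
qed

text \<open>Against a normal vector \<open>sff\<close> may be replaced by \<open>cov\<close>.
  Writing \<open>nu\<close> as \<open>\<phi>\<close> minus its fibre part, the first piece is
  \<open>cov_phi\<close> and the second, by \<open>cov_hor_ver\<close>, produces the term with
  \<open>omega\<close>.\<close>

lemma sff_nu:
  assumes u': "\<phi> (\<iota> (x, y)) (hor (x, y) u) = hor (x, y) u'"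
  shows "g (\<iota> (x, y)) (sff (x, y) (u, 0) (0, v)) (nu (x, y) w) =
    dlnf x u * omega (x, y) v w - nabla_form (x, y) u v w
      - dlnf x u' * g (\<iota> (x, y)) (ver (x, y) v) (ver (x, y) w)"
proof -
  let ?p = "(x, y)" and ?P = "\<iota> (x, y)"
  let ?c = "cov ?p (u, 0) (0, v)"
  obtain k where k: "\<phi> ?P (ver ?p w) = nu ?p w + ver ?p k" using nu_decomp by blast
  have "?c - sff ?p (u, 0) (0, v) \<in> tangent_image (prod_charts C1 C2) C \<iota> ?p"
    unfolding second_fundamental_form_eq by (rule form.normal_part(2)[OF tangent_image_subspace])
  from nu_normal[OF this, of w] have "g ?P (sff ?p (u, 0) (0, v)) (nu ?p w) = g ?P ?c (nu ?p w)"
    using form.sym[of ?P "nu ?p w" ?c] form.sym[of ?P "nu ?p w" "sff ?p (u, 0) (0, v)"]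
    by (simp add: form.linear_simps)
  also have "\<dots> = g ?P ?c (\<phi> ?P (ver ?p w)) - dlnf x u * g ?P (ver ?p v) (ver ?p k)"
    by (simp add: k form.linear_simps cov_hor_ver)
  also have "g ?P (ver ?p v) (ver ?p k) = g ?P (ver ?p v) (\<phi> ?P (ver ?p w))"
    using nu_ver[of ?p w v] form.sym[of ?P "nu ?p w" "ver ?p v"] by (simp add: k form.linear_simps)
  also have "\<dots> = - omega ?p v w"
    by (simp add: omega_def phi_skew)
  finally show ?thesis by (simp add: cov_phi[OF u'])
qed

text \<open>\<open>skew_sum_bound\<close> with \<open>l = dlnf x u\<close>,
  \<open>m = dlnf x u'\<close>, and with omega and \<open>nabla_form\<close> as the two skew
  forms.\<close>

lemma mixed_bound:
  assumes u': "\<phi> (\<iota> (x, y)) (hor (x, y) u) = hor (x, y) u'"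
    and W: "orthonormal_frame (\<lambda>v w. (f x)\<^sup>2 * g2 y v w) W"
  shows "real DIM('f) / (sin \<theta>)\<^sup>2 * ((dlnf x u')\<^sup>2 + (cos \<theta>)\<^sup>2 / 9 * (dlnf x u)\<^sup>2) \<le>
    (\<Sum>v\<in>W. g (\<iota> (x, y)) (sff (x, y) (u, 0) (0, v)) (sff (x, y) (u, 0) (0, v)))"
proof -
  let ?p = "(x, y)" and ?P = "\<iota> (x, y)"
  define N where "N = (cos \<theta>)\<^sup>2 * real DIM('f)"
  have fin: "finite W" and card: "card W = DIM('f)"
    and on: "\<And>v w. v \<in> W \<Longrightarrow> w \<in> W \<Longrightarrow> g ?P (ver ?p v) (ver ?p w) = (if v = w then 1 else 0)"
    using W by (auto simp: orthonormal_frame_def metric_hor_ver)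
  have "(\<Sum>v\<in>W. \<Sum>w\<in>W. omega ?p v w * nabla_form ?p u v w) = 2 / 3 * dlnf x u * N"
    using omega_domega_sum[OF W, of u]
    by (simp add: domega_eq N_def algebra_simps flip: sum_distrib_left)
  moreover have "(\<Sum>v\<in>W. \<Sum>w\<in>W. (omega ?p v w)\<^sup>2) = N"
    using omega_sum[OF W, of x] f_pos[of x] by (simp add: N_def)
  ultimately have "real (card W) * (dlnf x u')\<^sup>2 + (dlnf x u)\<^sup>2 * N / 9 \<le>
    (\<Sum>v\<in>W. \<Sum>w\<in>W. (dlnf x u * omega ?p v w - nabla_form ?p u v w
      - dlnf x u' * (if v = w then 1 else 0))\<^sup>2)"
    by (intro skew_sum_bound[OF fin omega_skew nabla_form_skew])
  also have "\<dots> = (\<Sum>v\<in>W. \<Sum>w\<in>W. (g ?P (sff ?p (u, 0) (0, v)) (nu ?p w))\<^sup>2)"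
    by (intro sum.cong refl) (simp add: sff_nu[OF u'] on)
  finally have 1: "real (card W) * (dlnf x u')\<^sup>2 + (dlnf x u)\<^sup>2 * N / 9 \<le>
    (\<Sum>v\<in>W. \<Sum>w\<in>W. (g ?P (sff ?p (u, 0) (0, v)) (nu ?p w))\<^sup>2)" .
  \<comment> \<open>Only the components along the image of \<open>nu\<close> are estimated; normal
    directions outside it are dropped by Bessel's inequality.\<close>
  have "(\<Sum>w\<in>W. (g ?P z (nu ?p w))\<^sup>2) \<le> (sin \<theta>)\<^sup>2 * g ?P z z" for z
  proof -
    have "(\<Sum>w\<in>W. (g ?P z ((1 / sin \<theta>) *\<^sub>R nu ?p w))\<^sup>2) \<le> g ?P z z"
    proof (rule form.bessel[OF fin])
      fix v w assume "v \<in> W" "w \<in> W"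
      then show "g ?P ((1 / sin \<theta>) *\<^sub>R nu ?p v) ((1 / sin \<theta>) *\<^sub>R nu ?p w) = (if v = w then 1 else 0)"
        using sin_nonzero by (simp add: form.linear_simps nu_nu on power2_eq_square)
    qed
    moreover have "(g ?P z ((1 / sin \<theta>) *\<^sub>R nu ?p w))\<^sup>2 = (g ?P z (nu ?p w))\<^sup>2 / (sin \<theta>)\<^sup>2" for w
      by (simp add: form.linear_simps power_divide)
    ultimately show ?thesis
      using sin_nonzero by (simp add: field_simps flip: sum_divide_distrib)
  qed
  then have "(\<Sum>v\<in>W. \<Sum>w\<in>W. (g ?P (sff ?p (u, 0) (0, v)) (nu ?p w))\<^sup>2) \<le>
    (\<Sum>v\<in>W. (sin \<theta>)\<^sup>2 * g ?P (sff ?p (u, 0) (0, v)) (sff ?p (u, 0) (0, v)))"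
    by (rule sum_mono)
  with 1 have "real (card W) * (dlnf x u')\<^sup>2 + (dlnf x u)\<^sup>2 * N / 9 \<le>
    (sin \<theta>)\<^sup>2 * (\<Sum>v\<in>W. g ?P (sff ?p (u, 0) (0, v)) (sff ?p (u, 0) (0, v)))"
    by (simp add: sum_distrib_left)
  moreover have "(sin \<theta>)\<^sup>2 > 0" using sin_nonzero by simp
  ultimately show ?thesis
    by (simp add: card N_def field_simps)
qed

text \<open>\<open>J\<close> is \<open>\<phi>\<close> transported to the leaf and \<open>G\<close>
  the gradient of ln f there. Skewness turns the second sum into the squared length of
  \<open>J G\<close>, and this equals that of \<open>G\<close> because \<open>dlnf_xi\<close> makes
  \<open>G\<close> orthogonal to \<open>\<xi>\<close>.\<close>

lemma dlnf_sq_sum: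
  assumes U: "orthonormal_frame (g1 x) U"
    and J: "\<And>u. \<phi> (\<iota> (x, y)) (hor (x, y) u) = hor (x, y) (J u)"
    and G: "\<And>u. g1 x G u = dlnf x u"
  shows "(\<Sum>u\<in>U. (dlnf x u)\<^sup>2) = g1 x G G" "(\<Sum>u\<in>U. (dlnf x (J u))\<^sup>2) = g1 x G G"
proof -
  note on = C1.form.orthonormal_frameD[OF U]
  let ?p = "(x, y)" and ?P = "\<iota> (x, y)"
  show "(\<Sum>u\<in>U. (dlnf x u)\<^sup>2) = g1 x G G"
    using C1.form.parseval_sq[OF on(1), of G] on(2) G by simp
  have "dlnf x (J u) = - g1 x (J G) u" for u
    using phi_skew[of ?P "hor ?p G" "hor ?p u"]
    by (simp add: J metric_hor_ver G)
  then have "(\<Sum>u\<in>U. (dlnf x (J u))\<^sup>2) = (\<Sum>u\<in>U. (g1 x (J G) u)\<^sup>2)" by simp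
  also have "\<dots> = g1 x (J G) (J G)"
    using C1.form.parseval_sq[OF on(1), of "J G"] on(2) by simp
  also have "\<dots> = g ?P (\<phi> ?P (hor ?p G)) (\<phi> ?P (hor ?p G))"
    by (simp add: J metric_hor_ver)
  also have "\<dots> = g1 x G G - (\<eta> ?P (hor ?p G))\<^sup>2"
    unfolding metric_phi_phi by (simp add: metric_hor_ver power2_eq_square)
  also have "\<eta> ?P (hor ?p G) = 0"
  proof -
    obtain k where k: "\<xi> ?P = hor ?p k" using xi_hor by blast
    then show ?thesis using dlnf_xi[OF k] by (simp add: eta_eq metric_hor_ver G)
  qed
  finally show "(\<Sum>u\<in>U. (dlnf x (J u))\<^sup>2) = g1 x G G" by simp
qed

section \<open>Frames adapted to the product and the inequality\<close>

lemma induced_form: "pos_def_form (induced_metric (prod_charts C1 C2) C g \<iota> p)"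
proof
  have z: "dF p u \<noteq> 0" if "u \<noteq> 0" for u
    using inj_dF[of p] that linear_injective_0[OF linear_dF] by blast
  have "bilinear (\<lambda>u v. g (\<iota> p) (dF p u) (dF p v))"
    unfolding bilinear_def
    using linear_compose[OF linear_dF form.linear_left] linear_compose[OF linear_dF form.linear_right]
    by (auto simp: o_def)
  then show "inner_product (induced_metric (prod_charts C1 C2) C g \<iota> p)"
    unfolding inner_product_def induced_metric_def[abs_def] using form.pos[OF z] form.sym by blast
qed

lemma product_frame:
  assumes U: "orthonormal_frame (g1 x) U" and W: "orthonormal_frame (\<lambda>v w. (f x)\<^sup>2 * g2 y v w) W"
  defines "E \<equiv> (\<lambda>u. (u, 0)) ` U \<union> (\<lambda>w. (0, w)) ` W"
  shows "orthonormal_frame (induced_metric (prod_charts C1 C2) C g \<iota> (x, y)) E"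
    and "(\<Sum>e\<in>E. q e) = (\<Sum>u\<in>U. q (u, 0)) + (\<Sum>w\<in>W. q (0, w))"
proof -
  have fin: "finite U" "finite W" using U W by (auto simp: orthonormal_frame_def)
  have U0: "u \<noteq> 0" if "u \<in> U" for u
  proof -
    have "g1 x u u = 1" using U that by (simp add: orthonormal_frame_def)
    then show ?thesis by (auto simp: C1.form.linear_simps)
  qed
  have disj: "(\<lambda>u. (u, 0)) ` U \<inter> (\<lambda>w. (0, w)) ` W = {}" using U0 by auto
  have inj: "inj_on (\<lambda>u. (u, 0)) U" "inj_on (\<lambda>w. (0, w)) W" by (auto simp: inj_on_def)
  have "card E = DIM('d \<times> 'f)"
    unfolding E_def using fin disj U W
    by (simp add: card_Un_disjoint card_image[OF inj(1)] card_image[OF inj(2)] orthonormal_frame_def)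
  moreover have "\<forall>u\<in>U. \<forall>v\<in>U. g1 x u v = (if u = v then 1 else 0)"
    "\<forall>v\<in>W. \<forall>w\<in>W. (f x)\<^sup>2 * g2 y v w = (if v = w then 1 else 0)"
    using U W by (simp_all add: orthonormal_frame_def)
  then have "\<forall>e\<in>E. \<forall>e'\<in>E. warped_metric g1 g2 f (x, y) e e' = (if e = e' then 1 else 0)"
    unfolding E_def warped_metric_def ball_Un ball_simps
    using U0 by (simp add: C1.form.linear_simps C2.form.linear_simps)
  ultimately show "orthonormal_frame (induced_metric (prod_charts C1 C2) C g \<iota> (x, y)) E"
    using fin by (simp add: orthonormal_frame_def E_def induced_eq)
  show "(\<Sum>e\<in>E. q e) = (\<Sum>u\<in>U. q (u, 0)) + (\<Sum>w\<in>W. q (0, w))"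
    unfolding E_def using fin disj
    by (simp add: sum.union_disjoint sum.reindex[OF inj(1)] sum.reindex[OF inj(2)])
qed

text \<open>The arbitrary frame is exchanged for the product frame in one summation at a time, since
  each exchange needs a bilinear expression. Symmetry of the second fundamental form merges the two
  mixed blocks, hence the factor 2.\<close>

lemma sff_norm_sq_split:
  assumes U: "orthonormal_frame (g1 x) U" and W: "orthonormal_frame (\<lambda>v w. (f x)\<^sup>2 * g2 y v w) W"
  defines "h \<equiv> \<lambda>u v. g (\<iota> (x, y)) (sff (x, y) u v) (sff (x, y) u v)"
  shows "sff_norm_sq (prod_charts C1 C2) C g \<iota> (x, y) =
    (\<Sum>u\<in>U. \<Sum>v\<in>U. h (u, 0) (v, 0)) + 2 * (\<Sum>u\<in>U. \<Sum>w\<in>W. h (u, 0) (0, w)) +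
    (\<Sum>v\<in>W. \<Sum>w\<in>W. h (0, v) (0, w))"
    and "sff_trace (prod_charts C1 C2) C g \<iota> (x, y) =
      (\<Sum>u\<in>U. sff (x, y) (u, 0) (u, 0)) + (\<Sum>w\<in>W. sff (x, y) (0, w) (0, w))"
proof -
  let ?B = "induced_metric (prod_charts C1 C2) C g \<iota> (x, y)" and ?P = "\<iota> (x, y)"
  interpret I: pos_def_form ?B by (rule induced_form)
  define E where "E = (SOME E. orthonormal_frame ?B E)"
  define E' where "E' = (\<lambda>u. (u, 0)) ` U \<union> (\<lambda>w. (0, w)) ` W"
  have E: "orthonormal_frame ?B E" unfolding E_def by (rule someI_ex[OF I.orthonormal_frame_exists])
  have E': "orthonormal_frame ?B E'" unfolding E'_def by (rule product_frame[OF U W])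
  note split = product_frame(2)[OF U W, folded E'_def]
  note lin = linear_second_fundamental_form
  have gl: "linear (\<lambda>u. g ?P (sff (x, y) u v) z)" "linear (\<lambda>u. g ?P (sff (x, y) v u) z)"
    "linear (\<lambda>u. g ?P z (sff (x, y) u v))" "linear (\<lambda>u. g ?P z (sff (x, y) v u))" for v z
    using linear_compose[OF lin(1) form.linear_left] linear_compose[OF lin(2) form.linear_left]
      linear_compose[OF lin(1) form.linear_right] linear_compose[OF lin(2) form.linear_right]
    by (auto simp: o_def)
  have hs: "h (0, w) (u, 0) = h (u, 0) (0, w)" for u w
    by (simp add: h_def second_fundamental_form_eq cov_sym[of _ "(0, w)"])
  have "sff_norm_sq (prod_charts C1 C2) C g \<iota> (x, y) = (\<Sum>e\<in>E. \<Sum>e'\<in>E. h e e')"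
    by (simp add: sff_norm_sq_def E_def h_def Let_def)
  also have "\<dots> = (\<Sum>e\<in>E. \<Sum>e'\<in>E'. h e e')"
    unfolding h_def
    by (intro sum.cong refl I.trace_frame_independent[OF E E',
          where Q = "\<lambda>a b. g ?P (sff (x, y) _ a) (sff (x, y) _ b)"] gl)
  also have "\<dots> = (\<Sum>e\<in>E'. \<Sum>e'\<in>E'. h e e')"
    unfolding h_def
    by (intro I.trace_frame_independent[OF E E',
          where Q = "\<lambda>a b. \<Sum>e'\<in>E'. g ?P (sff (x, y) a e') (sff (x, y) b e')"]
        linear_compose_sum ballI gl)
  also have "\<dots> = (\<Sum>u\<in>U. \<Sum>v\<in>U. h (u, 0) (v, 0)) + 2 * (\<Sum>u\<in>U. \<Sum>w\<in>W. h (u, 0) (0, w)) +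
    (\<Sum>v\<in>W. \<Sum>w\<in>W. h (0, v) (0, w))"
    using sum.swap[of "\<lambda>w u. h (u, 0) (0, w)" U W] by (simp add: split sum.distrib hs)
  finally show "sff_norm_sq (prod_charts C1 C2) C g \<iota> (x, y) =
    (\<Sum>u\<in>U. \<Sum>v\<in>U. h (u, 0) (v, 0)) + 2 * (\<Sum>u\<in>U. \<Sum>w\<in>W. h (u, 0) (0, w)) +
    (\<Sum>v\<in>W. \<Sum>w\<in>W. h (0, v) (0, w))" .
  have "sff_trace (prod_charts C1 C2) C g \<iota> (x, y) = (\<Sum>e\<in>E'. sff (x, y) e e)"
    unfolding sff_trace_def Let_def E_def[symmetric]
    by (rule I.trace_frame_independent[OF E E' lin])
  then show "sff_trace (prod_charts C1 C2) C g \<iota> (x, y) =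
    (\<Sum>u\<in>U. sff (x, y) (u, 0) (u, 0)) + (\<Sum>w\<in>W. sff (x, y) (0, w) (0, w))"
    by (simp add: split)
qed

lemma gradient_norm:
  assumes G: "\<And>u. g1 x G u = dlnf x u"
  shows "gradient_norm_sq (prod_charts C1 C2) (warped_metric g1 g2 f) (\<lambda>(x, y). ln (f x)) (x, y) = g1 x G G"
proof -
  let ?D = "prod_charts C1 C2" and ?c = "(crd C1 x x, crd C2 y y)"
  interpret I: pos_def_form "warped_metric g1 g2 f (x, y)"
    using induced_form[of "(x, y)"] by (simp add: induced_eq)
  note 3 = f_deriv_fst[of x "crd C2 y y"]
  have "((\<lambda>z. ln (f (cinv C1 x (fst z)))) has_derivative (\<lambda>u. dlnf x (fst u))) (at ?c)"
    using has_derivative_ln[OF _ 3] f_pos[of x] less_imp_neq[OF f_pos[of x]] by (simp add: field_simps)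
  then have "((\<lambda>(x, y). ln (f x)) \<circ> cinv ?D (x, y) has_derivative (\<lambda>u. dlnf x (fst u))) (at ?c)"
    by (rule has_derivative_transform_within_open[OF _ prod_dom_open])
      (auto simp: cinv_prod C1.chart_family_axioms C2.chart_family_axioms)
  from frechet_derivative_at[OF this, symmetric]
  have d: "frechet_derivative ((\<lambda>(x, y). ln (f x)) \<circ> cinv ?D (x, y)) (at (crd ?D (x, y) (x, y))) =
    (\<lambda>u. dlnf x (fst u))" by (simp add: crd_prod)
  have G0: "warped_metric g1 g2 f (x, y) (G, 0) v = dlnf x (fst v)" for v
    by (cases v) (simp add: warped_metric_def G C2.form.linear_simps)
  have "gradient ?D (warped_metric g1 g2 f) (\<lambda>(x, y). ln (f x)) (x, y) = (G, 0)"
    unfolding gradient_def d by (rule the_equality) (auto simp: G0 intro!: I.eqI)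
  then show ?thesis
    by (simp add: gradient_norm_sq_def warped_metric_def C2.form.linear_simps)
qed

text \<open>The two unmixed blocks are kept on the left: dropping them gives the inequality, while
  in the equality case they are forced to be zero.\<close>

lemma sff_norm_sq_bound:
  assumes U: "orthonormal_frame (g1 x) U" and W: "orthonormal_frame (\<lambda>v w. (f x)\<^sup>2 * g2 y v w) W"
  shows "(\<Sum>u\<in>U. \<Sum>v\<in>U. g (\<iota> (x, y)) (sff (x, y) (u, 0) (v, 0)) (sff (x, y) (u, 0) (v, 0))) +
    (\<Sum>v\<in>W. \<Sum>w\<in>W. g (\<iota> (x, y)) (sff (x, y) (0, v) (0, w)) (sff (x, y) (0, v) (0, w))) +
    2 * real DIM('f) / (sin \<theta>)\<^sup>2 * (1 + (cos \<theta>)\<^sup>2 / 9) *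
      gradient_norm_sq (prod_charts C1 C2) (warped_metric g1 g2 f) (\<lambda>(x, y). ln (f x)) (x, y)
    \<le> sff_norm_sq (prod_charts C1 C2) C g \<iota> (x, y)"
proof -
  obtain G where G: "\<And>u. g1 x G u = dlnf x u"
    using C1.form.riesz[OF linear_dlnf] by blast
  have "\<forall>u. \<exists>u'. \<phi> (\<iota> (x, y)) (hor (x, y) u) = hor (x, y) u'"
    using phi_hor by blast
  then obtain J where J: "\<And>u. \<phi> (\<iota> (x, y)) (hor (x, y) u) = hor (x, y) (J u)" by metis
  note s = dlnf_sq_sum[OF U J G]
  have "(\<Sum>u\<in>U. real DIM('f) / (sin \<theta>)\<^sup>2 * ((dlnf x (J u))\<^sup>2 + (cos \<theta>)\<^sup>2 / 9 * (dlnf x u)\<^sup>2)) \<le>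
    (\<Sum>u\<in>U. \<Sum>v\<in>W. g (\<iota> (x, y)) (sff (x, y) (u, 0) (0, v)) (sff (x, y) (u, 0) (0, v)))"
    by (rule sum_mono[OF mixed_bound[OF J W]])
  moreover have "(\<Sum>u\<in>U. real DIM('f) / (sin \<theta>)\<^sup>2 * ((dlnf x (J u))\<^sup>2 + (cos \<theta>)\<^sup>2 / 9 * (dlnf x u)\<^sup>2)) =
    real DIM('f) / (sin \<theta>)\<^sup>2 * (1 + (cos \<theta>)\<^sup>2 / 9) * g1 x G G"
    by (simp only: sum.distrib sum_distrib_left[symmetric] s) (simp add: algebra_simps)
  ultimately show ?thesis
    unfolding sff_norm_sq_split(1)[OF U W] gradient_norm[OF G] by linarith
qed

lemma frames_exist:
  "\<exists>U. orthonormal_frame (g1 x) U" "\<exists>W. orthonormal_frame (\<lambda>v w. (f x)\<^sup>2 * g2 y v w) W"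
proof -
  show "\<exists>U. orthonormal_frame (g1 x) U" by (rule C1.form.orthonormal_frame_exists)
  interpret W: pos_def_form "\<lambda>v w. (f x)\<^sup>2 * g2 y v w" using f_pos by (rule scaled_fibre_form)
  show "\<exists>W. orthonormal_frame (\<lambda>v w. (f x)\<^sup>2 * g2 y v w) W" by (rule W.orthonormal_frame_exists)
qed

section \<open>The equality case\<close>

lemma linear_sff: "linear (\<lambda>u. sff p (u, 0) z)" "linear (\<lambda>u. sff p z (u, 0))"
  "linear (\<lambda>w. sff p (0, w) z)" "linear (\<lambda>w. sff p z (0, w))"
proof -
  have *: "linear (\<lambda>u::'d. (u, 0::'f))" "linear (\<lambda>w::'f. (0::'d, w))" by (auto simp: linear_iff)
  show "linear (\<lambda>u. sff p (u, 0) z)" "linear (\<lambda>u. sff p z (u, 0))"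
    "linear (\<lambda>w. sff p (0, w) z)" "linear (\<lambda>w. sff p z (0, w))"
    using linear_compose[OF *(1) linear_second_fundamental_form(1)]
      linear_compose[OF *(1) linear_second_fundamental_form(2)]
      linear_compose[OF *(2) linear_second_fundamental_form(1)]
      linear_compose[OF *(2) linear_second_fundamental_form(2)]
    by (simp_all add: o_def)
qed

text \<open>The unmixed blocks are sums of squares squeezed to zero by
  \<open>sff_norm_sq_bound\<close>; linearity in each argument extends the vanishing from the frames
  to all vectors.\<close>

lemma sff_zero:
  assumes "sff_norm_sq (prod_charts C1 C2) C g \<iota> (x, y) \<le> 2 * real DIM('f) / (sin \<theta>)\<^sup>2 * (1 + (cos \<theta>)\<^sup>2 / 9) *
      gradient_norm_sq (prod_charts C1 C2) (warped_metric g1 g2 f) (\<lambda>(x, y). ln (f x)) (x, y)"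
  shows "sff (x, y) (u, 0) (u', 0) = 0" "sff (x, y) (0, w) (0, w') = 0"
proof -
  obtain U where U: "orthonormal_frame (g1 x) U" using frames_exist(1) by blast
  obtain W where W: "orthonormal_frame (\<lambda>v w. (f x)\<^sup>2 * g2 y v w) W" using frames_exist(2) by blast
  interpret W: pos_def_form "\<lambda>v w. (f x)\<^sup>2 * g2 y v w" using f_pos by (rule scaled_fibre_form)
  let ?q = "\<lambda>u v. g (\<iota> (x, y)) (sff (x, y) u v) (sff (x, y) u v)"
  have fin: "finite U" "finite W" using U W by (auto simp: orthonormal_frame_def)
  have nn: "0 \<le> (\<Sum>u\<in>U. \<Sum>v\<in>U. ?q (u, 0) (v, 0))" "0 \<le> (\<Sum>v\<in>W. \<Sum>w\<in>W. ?q (0, v) (0, w))"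
    by (intro sum_nonneg form.nonneg)+
  have "(\<Sum>u\<in>U. \<Sum>v\<in>U. ?q (u, 0) (v, 0)) = 0" "(\<Sum>v\<in>W. \<Sum>w\<in>W. ?q (0, v) (0, w)) = 0"
    using nn sff_norm_sq_bound[OF U W] assms by linarith+
  then have z: "\<And>u v. u \<in> U \<Longrightarrow> v \<in> U \<Longrightarrow> sff (x, y) (u, 0) (v, 0) = 0"
    "\<And>v w. v \<in> W \<Longrightarrow> w \<in> W \<Longrightarrow> sff (x, y) (0, v) (0, w) = 0"
    using fin by (auto simp: sum_nonneg_eq_0_iff sum_nonneg form.nonneg form.eq_0_iff)
  have "sff (x, y) (u, 0) (v, 0) = 0" if "v \<in> U" for v
    using linear_eq_0_on_span[OF linear_sff(1) z(1)[OF _ that]] C1.form.orthonormal_frameD(2)[OF U] by blast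
  then show "sff (x, y) (u, 0) (u', 0) = 0"
    using linear_eq_0_on_span[OF linear_sff(2), of U "(x, y)" "(u, 0)"] C1.form.orthonormal_frameD(2)[OF U]
    by blast
  have "sff (x, y) (0, w) (0, v) = 0" if "v \<in> W" for v
    using linear_eq_0_on_span[OF linear_sff(3) z(2)[OF _ that]] W.orthonormal_frameD(2)[OF W] by blast
  then show "sff (x, y) (0, w) (0, w') = 0"
    using linear_eq_0_on_span[OF linear_sff(4), of W "(x, y)" "(0, w)"] W.orthonormal_frameD(2)[OF W]
    by blast
qed

text \<open>A vanishing second fundamental form puts \<open>cov\<close> into the tangent space of
  the product, and \<open>cov_hor_hor\<close> removes its fibre component; what remains is tangent
  to the leaf.\<close>

lemma leaf_sff_zero:
  assumes "sff (x, y) (u, 0) (v, 0) = 0"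
  shows "second_fundamental_form C1 C g (\<lambda>x. \<iota> (x, y)) x u v = 0"
proof -
  let ?p = "(x, y)" and ?P = "\<iota> (x, y)"
  have "cov ?p (u, 0) (v, 0) \<in> tangent_image (prod_charts C1 C2) C \<iota> ?p"
    using assms unfolding second_fundamental_form_eq by (rule form.normal_part_eq_0[OF tangent_image_subspace])
  then obtain a b where ab: "cov ?p (u, 0) (v, 0) = hor ?p a + ver ?p b"
    by (rule tangent_split)
  have "g ?P (ver ?p b) (ver ?p b) = 0"
    using cov_hor_hor[of ?p u v b] by (simp add: ab form.linear_simps metric_hor_ver(3))
  then have "ver ?p b = 0" by (simp add: form.eq_0_iff)
  then show ?thesis
    unfolding leaf(3) by (intro form.normal_part_eq[OF subspace_hor]) (auto simp: ab form.linear_simps)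
qed

text \<open>Again \<open>cov\<close> is tangent to the product, so its part normal to the fibre is
  horizontal, and \<open>cov_ver_ver\<close> identifies that part by pairing it with all horizontal
  vectors.\<close>

lemma fibre_sff:
  assumes "sff (x, y) (0, v) (0, w) = 0" and G: "\<And>u. g1 x G u = dlnf x u"
  shows "second_fundamental_form C2 C g (\<lambda>y. \<iota> (x, y)) y v w =
    - (g (\<iota> (x, y)) (ver (x, y) v) (ver (x, y) w)) *\<^sub>R hor (x, y) G"
proof -
  let ?p = "(x, y)" and ?P = "\<iota> (x, y)"
  let ?s = "- g ?P (ver ?p v) (ver ?p w)"
  have "cov ?p (0, v) (0, w) \<in> tangent_image (prod_charts C1 C2) C \<iota> ?p"
    using assms unfolding second_fundamental_form_eq
    by (intro form.normal_part_eq_0[OF tangent_image_subspace])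
  then obtain a b where ab: "cov ?p (0, v) (0, w) = hor ?p a + ver ?p b"
    by (rule tangent_split)
  have "g1 x a u = g1 x (?s *\<^sub>R G) u" for u
  proof -
    have "g1 x a u = g ?P (cov ?p (0, v) (0, w)) (hor ?p u)"
      by (simp add: ab form.linear_simps metric_hor_ver)
    also have "\<dots> = g1 x (?s *\<^sub>R G) u"
      unfolding cov_ver_ver by (simp add: C1.form.linear_simps G)
    finally show ?thesis .
  qed
  then have a: "a = ?s *\<^sub>R G" by (rule C1.form.eqI)
  have "hor ?p a = ?s *\<^sub>R hor ?p G" unfolding a by (rule linear_scale[OF linear_hor])
  then show ?thesis
    unfolding fibre(3) by (intro form.normal_part_eq[OF subspace_ver])
      (auto simp: ab form.linear_simps metric_hor_ver)
qed

text \<open>By \<open>fibre_sff\<close> every unit vector contributes \<open>- hor (x, y) G\<close>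
  to the trace, so this is the mean curvature vector: minus the gradient of ln f.\<close>

lemma fibre_umbilical:
  assumes "\<And>y v w. sff (x, y) (0, v) (0, w) = 0"
  shows "totally_umbilical C2 C g (\<lambda>y. \<iota> (x, y))"
  unfolding totally_umbilical_def
proof (intro allI)
  fix y v w
  let ?p = "(x, y)" and ?P = "\<iota> (x, y)" and ?B = "induced_metric C2 C g (\<lambda>y. \<iota> (x, y)) y"
  obtain G where G: "\<And>u. g1 x G u = dlnf x u"
    using C1.form.riesz[OF linear_dlnf] by blast
  have B: "?B v w = g ?P (ver ?p v) (ver ?p w)" for v w
    by (simp add: induced_metric_def fibre(1))
  then have "?B = (\<lambda>v w. (f x)\<^sup>2 * g2 y v w)" by (intro ext) (simp add: metric_hor_ver)
  then have ex: "\<exists>E. orthonormal_frame ?B E" using frames_exist(2) by simp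
  define E where "E = (SOME E. orthonormal_frame ?B E)"
  have E: "orthonormal_frame ?B E" unfolding E_def by (rule someI_ex[OF ex])
  have "sff_trace C2 C g (\<lambda>y. \<iota> (x, y)) y = (\<Sum>e\<in>E. - hor ?p G)"
    unfolding sff_trace_def Let_def E_def[symmetric]
    using E by (intro sum.cong refl) (simp add: fibre_sff[OF assms G] orthonormal_frame_def B[symmetric])
  also have "\<dots> = - real DIM('f) *\<^sub>R hor ?p G"
    using E by (simp add: orthonormal_frame_def sum_negf sum_constant_scaleR)
  finally have "mean_curvature C2 C g (\<lambda>y. \<iota> (x, y)) y = - hor ?p G"
    by (simp add: mean_curvature_def)
  then show "second_fundamental_form C2 C g (\<lambda>y. \<iota> (x, y)) y v w =
    ?B v w *\<^sub>R mean_curvature C2 C g (\<lambda>y. \<iota> (x, y)) y"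
    by (simp add: fibre_sff[OF assms G] B)
qed

end

theorem theorem3p5:
  fixes C :: "('m::{t2_space, second_countable_topology}, 'e::euclidean_space) charts"
    and \<phi> :: "'m \<Rightarrow> 'e \<Rightarrow> 'e" and \<xi> :: "'m \<Rightarrow> 'e" and \<eta> :: "'m \<Rightarrow> 'e \<Rightarrow> real"
    and g :: "'m \<Rightarrow> 'e \<Rightarrow> 'e \<Rightarrow> real"
    and C1 :: "('a::{t2_space, second_countable_topology}, 'd::euclidean_space) charts"
    and g1 :: "'a \<Rightarrow> 'd \<Rightarrow> 'd \<Rightarrow> real"
    and C2 :: "('b::{t2_space, second_countable_topology}, 'f::euclidean_space) charts"
    and g2 :: "'b \<Rightarrow> 'f \<Rightarrow> 'f \<Rightarrow> real"
    and f :: "'a \<Rightarrow> real" and \<iota> :: "'a \<times> 'b \<Rightarrow> 'm" and \<theta> :: real and q :: nat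
  assumes "nearly_cosymplectic C \<phi> \<xi> \<eta> g"
    and "warped_product_semi_slant C \<phi> \<xi> g C1 g1 C2 g2 f \<iota> \<theta>"
    and "2 * q = DIM('f)"
  shows "(\<forall>p. sff_norm_sq (prod_charts C1 C2) C g \<iota> p
               \<ge> 4 * real q * (1 / sin \<theta>)\<^sup>2 * (1 + 1 / 9 * (cos \<theta>)\<^sup>2)
                   * gradient_norm_sq (prod_charts C1 C2) (warped_metric g1 g2 f) (\<lambda>(x, y). ln (f x)) p)
    \<and>
    ((\<forall>p. sff_norm_sq (prod_charts C1 C2) C g \<iota> p
               = 4 * real q * (1 / sin \<theta>)\<^sup>2 * (1 + 1 / 9 * (cos \<theta>)\<^sup>2)
                   * gradient_norm_sq (prod_charts C1 C2) (warped_metric g1 g2 f) (\<lambda>(x, y). ln (f x)) p)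
      \<longrightarrow> (\<forall>y. totally_geodesic C1 C g (\<lambda>x. \<iota> (x, y))) \<and>
          (\<forall>x. totally_umbilical C2 C g (\<lambda>y. \<iota> (x, y))) \<and>
          minimal_submanifold (prod_charts C1 C2) C g \<iota>)"
proof -
  interpret warped_semi_slant_submanifold C \<phi> \<xi> \<eta> g C1 g1 C2 g2 f \<iota> \<theta>
    using assms by unfold_locales
  have "real DIM('f) = 2 * real q" using assms(3) by linarith
  \<comment> \<open>In the bound \<open>4 * q\<close> is twice the dimension of the fibre; this 2 is
    the one that counts both mixed blocks.\<close>
  then have const: "4 * real q * (1 / sin \<theta>)\<^sup>2 * (1 + 1 / 9 * (cos \<theta>)\<^sup>2) =
    2 * real DIM('f) / (sin \<theta>)\<^sup>2 * (1 + (cos \<theta>)\<^sup>2 / 9)"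
    by (simp add: power_divide)
  show ?thesis
    unfolding const
  proof (intro conjI allI impI)
    fix p :: "'a \<times> 'b"
    obtain x y where p: "p = (x, y)" by (cases p)
    obtain U where U: "orthonormal_frame (g1 x) U" using frames_exist(1) by blast
    obtain W where W: "orthonormal_frame (\<lambda>v w. (f x)\<^sup>2 * g2 y v w) W" using frames_exist(2) by blast
    let ?q = "\<lambda>u v. g (\<iota> (x, y)) (sff (x, y) u v) (sff (x, y) u v)"
    have "0 \<le> (\<Sum>u\<in>U. \<Sum>v\<in>U. ?q (u, 0) (v, 0))" "0 \<le> (\<Sum>v\<in>W. \<Sum>w\<in>W. ?q (0, v) (0, w))"
      by (intro sum_nonneg form.nonneg)+
    then show "2 * real DIM('f) / (sin \<theta>)\<^sup>2 * (1 + (cos \<theta>)\<^sup>2 / 9) *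
      gradient_norm_sq (prod_charts C1 C2) (warped_metric g1 g2 f) (\<lambda>(x, y). ln (f x)) p
      \<le> sff_norm_sq (prod_charts C1 C2) C g \<iota> p"
      using sff_norm_sq_bound[OF U W] unfolding p by linarith
  next
    assume eq: "\<forall>p. sff_norm_sq (prod_charts C1 C2) C g \<iota> p = 2 * real DIM('f) / (sin \<theta>)\<^sup>2 *
      (1 + (cos \<theta>)\<^sup>2 / 9) *
      gradient_norm_sq (prod_charts C1 C2) (warped_metric g1 g2 f) (\<lambda>(x, y). ln (f x)) p"
    note z = sff_zero[OF eq_refl[OF eq[rule_format]]]
    show "totally_geodesic C1 C g (\<lambda>x. \<iota> (x, y))" for y
      by (simp add: totally_geodesic_def leaf_sff_zero[OF z(1)])
    show "totally_umbilical C2 C g (\<lambda>y. \<iota> (x, y))" for x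
      by (rule fibre_umbilical[OF z(2)])
    show "minimal_submanifold (prod_charts C1 C2) C g \<iota>"
      unfolding minimal_submanifold_def
    proof
      fix p :: "'a \<times> 'b"
      obtain x y where p: "p = (x, y)" by (cases p)
      obtain U where U: "orthonormal_frame (g1 x) U" using frames_exist(1) by blast
      obtain W where W: "orthonormal_frame (\<lambda>v w. (f x)\<^sup>2 * g2 y v w) W" using frames_exist(2) by blast
      \<comment> \<open>In a product frame the trace only meets unmixed pairs, so mixed values of
        the second fundamental form, which may be nonzero, do not enter.\<close>
      show "sff_trace (prod_charts C1 C2) C g \<iota> p = 0"
        by (simp add: p sff_norm_sq_split(2)[OF U W] z)
    qed
  qed
qed

end
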